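(* For $x\in(\operatorname{Gr}_{kn})_{\geq0}$, set $\mathcal{M}(x)=\{J\in{[n]\choose k}: P_J(x)\neq0\}$. Then the filling of $\lambda(\mathcal{M}(x))$ given by \[ L(x)_B= \begin{cases} 0 & \text{if $P_{M(B,\mathcal{M}(x))}(x)=0$;}\\ + & \text{if $P_{M(B,\mathcal{M}(x))}(x)\neq 0$.} \end{cases} \] is a Le-diagram, and $x$ lies in the positroid cell $(S_{\mathcal{M}_L})_{\geq0}$ (with $L=L(x)$).
   Context: Let $\operatorname{Gr}_{kn}$ be the Grassmannian of $k$-dimensional subspaces of $\mathbb{R}^n$, with Pl\"ucker coordinates $P_J$, $J\in\binom{[n]}{k}$; $(\operatorname{Gr}_{kn})_{\geq0}$ is the set of points whose Pl\"ucker coordinates can be chosen simultaneously nonnegative. For $\mathcal{M}\subseteq\binom{[n]}{k}$, the positroid cell $(S_\mathcal{M})_{\geq0}$ is the set of $x\in(\operatorname{Gr}_{kn})_{\geq0}$ with $P_J(x)\neq0$ iff $J\in\mathcal{M}$. A Le-diagram is a partition $\lambda$ fitting in a $k\times(n-k)$ rectangle with a filling of its boxes by $0$ and $+$ such that no $0$ has a $+$ above it in the same column and a $+$ to its left in the same row. Box $B=(r,c)$ is in the $r$-th row from the top and $c$-th column from the right. Label the steps of the southeast border of $\lambda$ (from northeast to southwest corner of the rectangle) by $1,\dots,n$; south steps are boundary sources $I=\{i_1<\dots<i_k\}$, west steps are boundary sinks $[n]\setminus I=\{j_1<\dots<j_{n-k}\}$. The $\Gamma$-graph $G_L$ consists of,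 for each box $B=(r,c)$ with $L_B=+$, a hook with corner at the northwest corner of $B$, with a horizontal path directed from source $i_r$ to the corner and a vertical path directed from the corner to sink $j_c$. $\mathcal{M}_L$ is the set of $J$ such that there is a non-intersecting path collection in $G_L$ from sources $I$ to destinations $J$. (Postnikov: the cells $(S_{\mathcal{M}_L})_{\geq0}$, over Le-diagrams $L$ in the $k\times(n-k)$ rectangle, partition $(\operatorname{Gr}_{kn})_{\geq0}$.) For $\mathcal{M}\subseteq\binom{[n]}{k}$, let $I=\{i_1<\dots<i_k\}$ be the lexicographically minimal set in $\mathcal{M}$, $[n]\setminus I=\{j_1<\dots<j_{n-k}\}$, and $\lambda(\mathcal{M})$ the partition in the $k\times(n-k)$ rectangle whose southeast border has south steps in positions $I$ and west steps in positions $[n]\setminus I$. For a box $B=(r,c)$ let $A_{r,c}=[n]\setminus\{i_r+1,\dots,j_c-1\}$, $M'(B,\mathcal{M})=\operatorname{lexmax}\{J\in\mathcal{M}: J\cap A_{r,c}=I\cap A_{r,c}\}$, and $M(B,\mathcal{M})=(M'(B,\mathcal{M})\setminus\{i_r\})\cup\{j_c\}$. *)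

theory Defs
  imports
    "Jordan_Normal_Form.DL_Submatrix"
    "Jordan_Normal_Form.VS_Connect"
    "Graph_Theory.Graph_Theory"
    "HOL-Library.List_Lexorder"
    "HOL-Library.Ramsey"
begin

section \<open>The nonnegative Grassmannian\<close>

text \<open>
  Coordinates are labelled by \<open>{1..n}\<close>, whereas matrix columns are numbered from 0; hence
  the column set of a minor is \<open>Suc -` J\<close>. The set of all \<open>k\<close>-element subsets of
  \<open>{1..n}\<close> is \<open>nsets {1..n} k\<close>.
\<close>

definition Grassmannian :: "nat \<Rightarrow> nat \<Rightarrow> real vec set set" where
  "Grassmannian k n =
     {x. VectorSpace.subspace class_ring x (module_vec TYPE(real) n) \<and>
         vectorspace.dim class_ring ((module_vec TYPE(real) n)\<lparr>carrier := x\<rparr>) = k}"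

definition represents :: "nat \<Rightarrow> nat \<Rightarrow> real mat \<Rightarrow> real vec set \<Rightarrow> bool" where
  "represents k n A x \<longleftrightarrow> A \<in> carrier_mat k n \<and> vec_space.row_space n A = x"

text \<open>
  Homogeneous coordinates: they are computed from one fixed but arbitrary matrix with row
  space \<open>x\<close>. Another such matrix is obtained by multiplication with an invertible
  \<open>k \<times> k\<close> matrix, so it multiplies all coordinates by a common nonzero scalar.
\<close>

definition Pluecker :: "nat \<Rightarrow> nat \<Rightarrow> real vec set \<Rightarrow> nat set \<Rightarrow> real" where
  "Pluecker k n x J = det (submatrix (SOME A. represents k n A x) UNIV (Suc -` J))"

definition nonneg_Grassmannian :: "nat \<Rightarrow> nat \<Rightarrow> real vec set set" where
  "nonneg_Grassmannian k n =
     {x \<in> Grassmannian k n.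
        \<exists>t::real. t \<noteq> 0 \<and> (\<forall>J \<in> nsets {1..n} k. 0 \<le> t * Pluecker k n x J)}"

definition matroid_of :: "nat \<Rightarrow> nat \<Rightarrow> real vec set \<Rightarrow> nat set set" where
  "matroid_of k n x = {J \<in> nsets {1..n} k. Pluecker k n x J \<noteq> 0}"

definition positroid_cell :: "nat \<Rightarrow> nat \<Rightarrow> nat set set \<Rightarrow> real vec set set" where
  "positroid_cell k n \<M> =
     {x \<in> nonneg_Grassmannian k n. \<forall>J \<in> nsets {1..n} k. Pluecker k n x J \<noteq> 0 \<longleftrightarrow> J \<in> \<M>}"

section \<open>Le-diagrams\<close>

text \<open>The \<open>r\<close>-th smallest element of a finite set, counted from 1.\<close>

definition nth_elem :: "nat set \<Rightarrow> nat \<Rightarrow> nat" where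
  "nth_elem S r = sorted_list_of_set S ! (r - 1)"

text \<open>
  A partition in the \<open>k \<times> m\<close> rectangle is the list of its \<open>k\<close> row lengths, zeros included.
\<close>

definition partition_in_rect :: "nat \<Rightarrow> nat \<Rightarrow> nat list \<Rightarrow> bool" where
  "partition_in_rect k m lam \<longleftrightarrow> length lam = k \<and> sorted_wrt (\<ge>) lam \<and> set lam \<subseteq> {0..m}"

text \<open>
  Columns are counted from the right-hand side of the rectangle (not of the partition), and
  rows are left-justified: row \<open>r\<close> occupies the leftmost \<open>lam ! (r - 1)\<close> of the \<open>n - k\<close> columns.
\<close>

definition boxes :: "nat \<Rightarrow> nat \<Rightarrow> nat list \<Rightarrow> (nat \<times> nat) set" where
  "boxes k n lam =
     {(r, c). r \<in> {1..k} \<and> c \<in> {1..n - k} \<and> n - k - lam ! (r - 1) < c}"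

text \<open>
  Before the south step of row \<open>r\<close>, the southeast border has made \<open>r - 1\<close> south steps and
  \<open>n - k - lam ! (r - 1)\<close> west steps.
\<close>

definition sources :: "nat \<Rightarrow> nat \<Rightarrow> nat list \<Rightarrow> nat set" where
  "sources k n lam = (\<lambda>r. r + (n - k - lam ! (r - 1))) ` {1..k}"

definition sinks :: "nat \<Rightarrow> nat \<Rightarrow> nat list \<Rightarrow> nat set" where
  "sinks k n lam = {1..n} - sources k n lam"

datatype entry = Zero | Plus

text \<open>Only the values of a filling on the boxes of the partition matter.\<close>

type_synonym filling = "nat \<times> nat \<Rightarrow> entry"

definition Le_diagram :: "nat \<Rightarrow> nat \<Rightarrow> nat list \<Rightarrow> filling \<Rightarrow> bool" where
  "Le_diagram k n lam L \<longleftrightarrow>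
     k \<le> n \<and> partition_in_rect k (n - k) lam \<and>
     \<not> (\<exists>r c r' c'. (r, c) \<in> boxes k n lam \<and> L (r, c) = Zero \<and>
           (r', c) \<in> boxes k n lam \<and> r' < r \<and> L (r', c) = Plus \<and>
           (r, c') \<in> boxes k n lam \<and> c < c' \<and> L (r, c') = Plus)"

section \<open>The graph of a Le-diagram\<close>

text \<open>
  \<open>Boundary i\<close> is the boundary vertex with label \<open>i\<close>, and \<open>Corner (r, c)\<close> is the northwest
  corner of the box \<open>(r, c)\<close>.
\<close>

datatype vertex = Boundary nat | Corner "nat \<times> nat"

text \<open>
  The hook of a box, as the list of all corners that it passes. Corners visited by a single
  straight line only subdivide an edge. In a Le-diagram, hooks cross only at northwest corners
  of boxes filled with \<open>Plus\<close>; for other fillings every crossing counts as a vertex.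
\<close>

definition hook :: "nat \<Rightarrow> nat \<Rightarrow> nat list \<Rightarrow> nat \<times> nat \<Rightarrow> vertex list" where
  "hook k n lam = (\<lambda>(r, c).
     [Boundary (nth_elem (sources k n lam) r)] @
     [Corner (r, c'). c' \<leftarrow> [1..<Suc c], (r, c') \<in> boxes k n lam] @
     [Corner (r', c). r' \<leftarrow> [Suc r..<Suc k], (r', c) \<in> boxes k n lam] @
     [Boundary (nth_elem (sinks k n lam) c)])"

definition Gamma_graph :: "nat \<Rightarrow> nat \<Rightarrow> nat list \<Rightarrow> filling \<Rightarrow> vertex pair_pre_digraph" where
  "Gamma_graph k n lam L =
     (let hooks = hook k n lam ` {B \<in> boxes k n lam. L B = Plus}
      in \<lparr> pverts = Boundary ` {1..n} \<union> (\<Union>p \<in> hooks. set p),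
           parcs = (\<Union>p \<in> hooks. set (vwalk_arcs p)) \<rparr>)"

text \<open>
  One path per source. Sources have no incoming arcs, so a source that is also a
  destination is joined to itself by the path of length zero.
\<close>

definition nonintersecting_paths ::
    "vertex pair_pre_digraph \<Rightarrow> nat set \<Rightarrow> nat set \<Rightarrow> (nat \<Rightarrow> vertex list) \<Rightarrow> bool" where
  "nonintersecting_paths G I J p \<longleftrightarrow>
     (\<forall>i \<in> I. vpath (p i) (with_proj G) \<and> hd (p i) = Boundary i) \<and>
     (\<forall>i \<in> I. \<forall>i' \<in> I. i \<noteq> i' \<longrightarrow> set (p i) \<inter> set (p i') = {}) \<and>
     (\<lambda>i. last (p i)) ` I = Boundary ` J"

definition Le_matroid :: "nat \<Rightarrow> nat \<Rightarrow> nat list \<Rightarrow> filling \<Rightarrow> nat set set" where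
  "Le_matroid k n lam L =
     {J \<in> nsets {1..n} k.
        \<exists>p. nonintersecting_paths (Gamma_graph k n lam L) (sources k n lam) J p}"

section \<open>The filling determined by a point\<close>

text \<open>Sets are compared lexicographically via the increasing lists of their elements.\<close>

definition lexmin :: "nat set set \<Rightarrow> nat set" where
  "lexmin \<M> = arg_min_on sorted_list_of_set \<M>"

definition lexmax :: "nat set set \<Rightarrow> nat set" where
  "lexmax \<M> = arg_max_on sorted_list_of_set \<M>"

text \<open>
  Row \<open>r\<close> of the partition with south steps \<open>I\<close> has one box for every west step after the
  \<open>r\<close>-th south step.
\<close>

definition shape :: "nat \<Rightarrow> nat set set \<Rightarrow> nat list" where
  "shape n \<M> =
     (let I = lexmin \<M>
      in map (\<lambda>i. card {j \<in> {1..n} - I. i < j}) (sorted_list_of_set I))"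

text \<open>The southeast border of this partition has its south steps exactly in positions \<open>I\<close>.\<close>

lemma sources_border:
  assumes I: "I \<subseteq> {1..n}" "card I = k"
  shows "sources k n (map (\<lambda>i. card {j \<in> {1..n} - I. i < j}) (sorted_list_of_set I)) = I"
proof -
  define xs where "xs = sorted_list_of_set I"
  have fin: "finite I" using I(1) finite_subset by blast
  have xs: "sorted_wrt (<) xs" "set xs = I" "length xs = k" "distinct xs"
    using fin I(2) by (auto simp: xs_def)
  have kn: "k \<le> n" using I card_mono[of "{1..n}" I] by simp
  have key: "r + (n - k - card {j \<in> {1..n} - I. xs ! (r - 1) < j}) = xs ! (r - 1)"
    if r: "r \<in> {1..k}" for r
  proof -
    let ?i = "xs ! (r - 1)"
    have i: "?i \<in> I" using r xs by (metis One_nat_def Suc_le_eq Suc_pred atLeastAtMost_iff nth_mem)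
    then have i': "1 \<le> ?i" "?i \<le> n" using I(1) by auto
    have below: "{j \<in> I. j < ?i} = (!) xs ` {..<r - 1}"
    proof (intro equalityI subsetI)
      fix j assume "j \<in> {j \<in> I. j < ?i}"
      then obtain t where t: "t < k" "xs ! t = j" "xs ! t < ?i" using xs by (auto simp: in_set_conv_nth)
      have "\<not> r - 1 < t" using sorted_wrt_nth_less[OF xs(1), of "r - 1" t] t xs(3) by auto
      moreover have "t \<noteq> r - 1" using t by auto
      ultimately show "j \<in> (!) xs ` {..<r - 1}" using t by auto
    next
      fix j assume "j \<in> (!) xs ` {..<r - 1}"
      then obtain t where t: "t < r - 1" "j = xs ! t" by auto
      then show "j \<in> {j \<in> I. j < ?i}"
        using sorted_wrt_nth_less[OF xs(1), of t "r - 1"] r xs by auto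
    qed
    have cb: "card {j \<in> I. j < ?i} = r - 1"
      unfolding below using xs r by (subst card_image) (auto simp: inj_on_def nth_eq_iff_index_eq)
    have "I = {j \<in> I. j < ?i} \<union> {?i} \<union> {j \<in> I. ?i < j}" using i by auto
    then have "k = card ({j \<in> I. j < ?i} \<union> {?i} \<union> {j \<in> I. ?i < j})" using I(2) by simp
    also have "\<dots> = (r - 1) + 1 + card {j \<in> I. ?i < j}"
      using fin cb by (subst card_Un_disjoint; auto)+
    finally have ca: "card {j \<in> I. ?i < j} = k - r" using r by auto
    have "{?i<..n} = {j \<in> {1..n} - I. ?i < j} \<union> {j \<in> I. ?i < j}" using I(1) by auto
    then have "n - ?i = card ({j \<in> {1..n} - I. ?i < j} \<union> {j \<in> I. ?i < j})"
      by (metis card_greaterThanAtMost)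
    also have "\<dots> = card {j \<in> {1..n} - I. ?i < j} + (k - r)"
      using fin ca by (subst card_Un_disjoint) auto
    finally have "n - ?i = card {j \<in> {1..n} - I. ?i < j} + (k - r)" .
    moreover have "r \<le> ?i"
    proof -
      have "{j \<in> I. j < ?i} \<subseteq> {1..<?i}" using I(1) by auto
      from card_mono[OF _ this] cb r i' show ?thesis by auto
    qed
    ultimately show ?thesis using r kn i' by auto
  qed
  have "sources k n (map (\<lambda>i. card {j \<in> {1..n} - I. i < j}) xs) = (\<lambda>r. xs ! (r - 1)) ` {1..k}"
    unfolding sources_def
  proof (intro image_cong refl)
    fix r assume r: "r \<in> {1..k}"
    then have "r - 1 < length xs" using xs(3) by auto
    then show "r + (n - k - map (\<lambda>i. card {j \<in> {1..n} - I. i < j}) xs ! (r - 1)) = xs ! (r - 1)"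
      using key[OF r] by simp
  qed
  also have "\<dots> = (!) xs ` ((\<lambda>r. r - 1) ` {1..k})" by (simp add: image_image)
  also have "(\<lambda>r. r - 1) ` {1..k} = {..<k}"
  proof (intro equalityI subsetI)
    fix t assume "t \<in> {..<k}"
    then show "t \<in> (\<lambda>r. r - 1) ` {1..k}" by (intro image_eqI[of _ _ "Suc t"]) auto
  qed auto
  also have "(!) xs ` {..<k} = I" using xs by (auto simp: set_conv_nth)
  finally show ?thesis unfolding xs_def .
qed

definition src :: "nat set set \<Rightarrow> nat \<Rightarrow> nat" where
  "src \<M> r = nth_elem (lexmin \<M>) r"

definition snk :: "nat \<Rightarrow> nat set set \<Rightarrow> nat \<Rightarrow> nat" where
  "snk n \<M> c = nth_elem ({1..n} - lexmin \<M>) c"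

definition fixed_labels :: "nat \<Rightarrow> nat set set \<Rightarrow> nat \<times> nat \<Rightarrow> nat set" where
  "fixed_labels n \<M> = (\<lambda>(r, c). {1..n} - {src \<M> r <..< snk n \<M> c})"

definition M_set' :: "nat \<Rightarrow> nat \<times> nat \<Rightarrow> nat set set \<Rightarrow> nat set" where
  "M_set' n B \<M> =
     lexmax {J \<in> \<M>. J \<inter> fixed_labels n \<M> B = lexmin \<M> \<inter> fixed_labels n \<M> B}"

definition M_set :: "nat \<Rightarrow> nat \<times> nat \<Rightarrow> nat set set \<Rightarrow> nat set" where
  "M_set n B \<M> = (M_set' n B \<M> - {src \<M> (fst B)}) \<union> {snk n \<M> (snd B)}"

definition filling_of :: "nat \<Rightarrow> nat \<Rightarrow> real vec set \<Rightarrow> filling" where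
  "filling_of k n x B =
     (if Pluecker k n x (M_set n B (matroid_of k n x)) = 0 then Zero else Plus)"

end

theory Submission
  imports Defs "Jordan_Normal_Form.DL_Rank"
begin

text \<open>
  The proof is by induction on the number of boxes of \<open>\<lambda>(\<M>(x))\<close>, removing a box at a corner
  of the southeast border. Such a box sits between consecutive labels with \<open>i\<close> in the
  lexicographically minimal basis \<open>I\<close> and \<open>i + 1\<close> outside \<open>I\<close>. Write \<open>I'\<close> for \<open>I - i + (i + 1)\<close>.

  If \<open>P\<^bsub>I'\<^esub>(x) = 0\<close>, then total nonnegativity forces \<open>i\<close> to be a coloop or \<open>i + 1\<close> to be a loop,
  and exchanging the two columns (up to a sign) gives a point with one box less. If
  \<open>P\<^bsub>I'\<^esub>(x) \<noteq> 0\<close>, subtract from column \<open>i\<close> the largest multiple of column \<open>i + 1\<close> that keeps all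
  Pluecker coordinates nonnegative. At that moment some coordinate vanishes, and a three-term
  Pluecker relation shows that then \<open>P\<^sub>I\<close> vanishes as well, so that \<open>I'\<close> becomes the minimal basis.

  In both cases the fillings agree off the removed box, and the matroids of the two points are
  related in the same way as the families of destination sets of the two \<open>\<Gamma>\<close>-graphs. The latter
  are compared through partial injections contained in the arc relation: in an acyclic graph these
  are the same as families of disjoint paths, but they can be changed locally at one vertex.
\<close>

section \<open>Lexicographic order on sets\<close>

text \<open>The obstacle is that the filling of every remaining box has to survive a removal,
  although the lexicographic maxima that define it are taken in two different matroids. This
  comparison uses only basis exchange and what the relation P_ac P_bd = P_ab P_cd + P_ad P_bc says
  about nonvanishing of nonnegative coordinates, hence the locale \<open>tnn_matroid\<close>; real
  numbers serve to show that the smaller point exists. If P_I' is nonzero, boxes whose interval of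
  free labels does not contain both i and i + 1 are handled by transporting everything along the
  transposition of i and i + 1, which respects the order of the competing sets. For the other boxes
  the transposition moves neither end label, and the maximum itself is shown not to change.

  P_I vanishes after the largest subtraction for this reason: if I were still a basis it would still
  be minimal, and then bases would be closed under replacing i + 1 by i, which would revive the very
  coordinate that was made to vanish.\<close>

definition lex_less :: "nat set \<Rightarrow> nat set \<Rightarrow> bool" where
  "lex_less A B \<longleftrightarrow> (\<exists>m \<in> A - B. A \<inter> {..<m} = B \<inter> {..<m})"

lemma lex_lessI:
  assumes "m \<in> A" "m \<notin> B" "\<And>t. t < m \<Longrightarrow> t \<in> A \<longleftrightarrow> t \<in> B"
  shows "lex_less A B"
  using assms unfolding lex_less_def by auto

lemma lex_lessE:
  assumes "lex_less A B"
  obtains m where "m \<in> A" "m \<notin> B" "\<And>t. t < m \<Longrightarrow> t \<in> A \<longleftrightarrow> t \<in> B"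
  using assms unfolding lex_less_def by blast

lemma lex_less_linear:
  assumes "A \<noteq> B"
  shows "lex_less A B \<or> lex_less B A"
proof -
  define m where "m = (LEAST t. (t \<in> A) \<noteq> (t \<in> B))"
  from assms obtain t where t: "(t \<in> A) \<noteq> (t \<in> B)" by blast
  from LeastI[of "\<lambda>t. (t \<in> A) \<noteq> (t \<in> B)", OF t] have m: "(m \<in> A) \<noteq> (m \<in> B)"
    unfolding m_def .
  have below: "t \<in> A \<longleftrightarrow> t \<in> B" if "t < m" for t
    using not_less_Least[of t "\<lambda>t. (t \<in> A) \<noteq> (t \<in> B)"] that unfolding m_def by blast
  show ?thesis
    using m below by (cases "m \<in> A") (auto intro: lex_lessI)
qed

lemma sorted_list_of_set_split:
  fixes A :: "nat set"
  assumes "finite A" "m \<in> A"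
  shows "sorted_list_of_set A =
    sorted_list_of_set (A \<inter> {..<m}) @ m # sorted_list_of_set (A \<inter> {m<..})"
proof (rule sorted_distinct_set_unique)
  show "sorted (sorted_list_of_set (A \<inter> {..<m}) @ m # sorted_list_of_set (A \<inter> {m<..}))"
    using assms by (auto simp: sorted_append less_imp_le intro: order.strict_implies_order)
qed (use assms in \<open>auto simp: not_less\<close>)

text \<open>Equal cardinality supplies an element of \<open>B\<close> above the first difference
  \<open>m\<close>, so after the common prefix the list of \<open>B\<close> goes on with an entry
  larger than \<open>m\<close>. For sets of different size the list of \<open>B\<close> could be a
  proper prefix and hence smaller.\<close>

lemma lex_less_imp_list_less:
  assumes fin: "finite A" "finite B" and card: "card A = card B" and less: "lex_less A B"
  shows "sorted_list_of_set A < sorted_list_of_set B"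
proof -
  from less obtain m where m: "m \<in> A" "m \<notin> B" and below: "A \<inter> {..<m} = B \<inter> {..<m}"
    unfolding lex_less_def by auto
  have A: "A = (A \<inter> {..<m}) \<union> {m} \<union> (A \<inter> {m<..})" using m by auto
  have B: "B = (B \<inter> {..<m}) \<union> (B \<inter> {m<..})" using m by (auto simp: not_less order_le_less)
  have "B \<inter> {m<..} \<noteq> {}"
  proof
    assume "B \<inter> {m<..} = {}"
    with B below have "B \<subset> A" using m by auto
    from psubset_card_mono[OF fin(1) this] card show False by simp
  qed
  define q where "q = Min (B \<inter> {m<..})"
  have q: "q \<in> B" "m < q" and qmin: "\<And>t. t \<in> B \<Longrightarrow> m < t \<Longrightarrow> q \<le> t"
    using Min_in[of "B \<inter> {m<..}"] \<open>B \<inter> {m<..} \<noteq> {}\<close> fin by (auto simp: q_def)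
  have "B \<inter> {..<q} = A \<inter> {..<m}"
  proof -
    have "t < m" if "t \<in> B" "t < q" for t
      using qmin[OF that(1)] that m by (metis leD linorder_neqE_nat)
    then show ?thesis unfolding below using q by auto
  qed
  then have "sorted_list_of_set B =
      sorted_list_of_set (A \<inter> {..<m}) @ q # sorted_list_of_set (B \<inter> {q<..})"
    using sorted_list_of_set_split[OF fin(2) q(1)] by simp
  then show ?thesis
    unfolding sorted_list_of_set_split[OF fin(1) m(1)] list_less_def
    using q(2) by (auto intro!: lexord_append_leftI)
qed

lemma list_less_iff_lex_less:
  assumes "finite A" "finite B" "card A = card B"
  shows "sorted_list_of_set A < sorted_list_of_set B \<longleftrightarrow> lex_less A B"
  using lex_less_imp_list_less[OF assms] lex_less_imp_list_less[OF assms(2,1)] assms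
    lex_less_linear[of A B] by (metis order.asym less_irrefl)

lemma lex_less_asym: "lex_less A B \<Longrightarrow> \<not> lex_less B A"
  unfolding lex_less_def by (smt (verit, best) DiffE Int_iff lessThan_iff linorder_neqE_nat)

lemma lex_less_trans:
  assumes "lex_less A B" "lex_less B C"
  shows "lex_less A C"
proof -
  obtain a where a: "a \<in> A" "a \<notin> B" "\<And>t. t < a \<Longrightarrow> t \<in> A \<longleftrightarrow> t \<in> B"
    using assms(1) by (erule lex_lessE) 
  obtain b where b: "b \<in> B" "b \<notin> C" "\<And>t. t < b \<Longrightarrow> t \<in> B \<longleftrightarrow> t \<in> C"
    using assms(2) by (erule lex_lessE)
  have "a \<noteq> b" using a b by auto
  then consider "a < b" | "b < a" by linarith
  then show ?thesis
  proof cases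
    case 1
    then show ?thesis by (intro lex_lessI[of a]) (use a b in auto)
  next
    case 2
    then show ?thesis by (intro lex_lessI[of b]) (use a b in auto)
  qed
qed

lemma lexmin_characterization:
  assumes M: "M \<subseteq> nsets V k" "finite V" and I: "I \<in> M" "\<And>J. J \<in> M \<Longrightarrow> J \<noteq> I \<Longrightarrow> lex_less I J"
  shows "lexmin M = I"
proof -
  have fin: "finite J \<and> card J = k" if "J \<in> M" for J
    using that M by (auto simp: nsets_def)
  have "is_arg_min sorted_list_of_set (\<lambda>J. J \<in> M) J \<longleftrightarrow> J = I" for J
  proof -
    have "is_arg_min sorted_list_of_set (\<lambda>J. J \<in> M) J \<longleftrightarrow> J \<in> M \<and> (\<forall>K\<in>M. \<not> lex_less K J)"
      unfolding is_arg_min_def using fin list_less_iff_lex_less by metis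
    then show ?thesis using I lex_less_asym by metis
  qed
  then show ?thesis
    unfolding lexmin_def arg_min_on_def arg_min_def by (intro some_equality) auto
qed

lemma lexmin_less:
  assumes M: "M \<subseteq> nsets V k" "finite V" "M \<noteq> {}"
  shows "lexmin M \<in> M" "\<And>J. J \<in> M \<Longrightarrow> J \<noteq> lexmin M \<Longrightarrow> lex_less (lexmin M) J"
proof -
  have fin: "finite J \<and> card J = k" if "J \<in> M" for J
    using that M by (auto simp: nsets_def)
  have "finite M" using M finite_imp_finite_nsets finite_subset by blast
  from arg_min_if_finite[OF this M(3), of sorted_list_of_set]
  show in_M: "lexmin M \<in> M" and "\<And>J. J \<in> M \<Longrightarrow> J \<noteq> lexmin M \<Longrightarrow> lex_less (lexmin M) J"
    unfolding lexmin_def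
    using fin list_less_iff_lex_less lex_less_linear by (metis, metis)
qed

lemma lexmax_characterization:
  assumes M: "M \<subseteq> nsets V k" "finite V" and T: "T \<in> M" "\<And>J. J \<in> M \<Longrightarrow> J \<noteq> T \<Longrightarrow> lex_less J T"
  shows "lexmax M = T"
proof -
  have fin: "finite J \<and> card J = k" if "J \<in> M" for J
    using that M by (auto simp: nsets_def)
  have "is_arg_max sorted_list_of_set (\<lambda>J. J \<in> M) J \<longleftrightarrow> J = T" for J
  proof -
    have "is_arg_max sorted_list_of_set (\<lambda>J. J \<in> M) J \<longleftrightarrow> J \<in> M \<and> (\<forall>K\<in>M. \<not> lex_less J K)"
      unfolding is_arg_max_def using fin list_less_iff_lex_less by metis
    then show ?thesis using T lex_less_asym by metis
  qed
  then show ?thesis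
    unfolding lexmax_def arg_max_on_def arg_max_def by (intro some_equality) auto
qed

lemma lexmax_exists:
  assumes M: "M \<subseteq> nsets V k" "finite V" "M \<noteq> {}"
  shows "\<exists>T\<in>M. \<forall>J\<in>M. J \<noteq> T \<longrightarrow> lex_less J T"
proof -
  have fin: "finite J \<and> card J = k" if "J \<in> M" for J
    using that M by (auto simp: nsets_def)
  have finM: "finite M" using M finite_imp_finite_nsets finite_subset by blast
  have "\<exists>T\<in>M. \<forall>J\<in>M. \<not> sorted_list_of_set T < sorted_list_of_set J"
    using finM M(3)
  proof -
    let ?S = "sorted_list_of_set ` M"
    have "finite ?S" "?S \<noteq> {}" using finM M(3) by auto
    from Max_in[OF this] obtain T where "T \<in> M" "sorted_list_of_set T = Max ?S" by auto
    moreover have "sorted_list_of_set J \<le> Max ?S" if "J \<in> M" for J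
      using that \<open>finite ?S\<close> by auto
    ultimately show ?thesis by (metis leD)
  qed
  then show ?thesis using fin list_less_iff_lex_less lex_less_linear by metis
qed

lemma lexmax_iff:
  assumes M: "M \<subseteq> nsets V k" "finite V" "M \<noteq> {}"
  shows "lexmax M = T \<longleftrightarrow> T \<in> M \<and> (\<forall>J\<in>M. J \<noteq> T \<longrightarrow> lex_less J T)"
  using lexmax_characterization[OF M(1,2)] lexmax_exists[OF M] by metis

section \<open>Matroids with the sign condition of the three-term relations\<close>

abbreviation adj_swap :: "nat \<Rightarrow> nat \<Rightarrow> nat" where
  "adj_swap i \<equiv> transpose i (Suc i)"

lemma mem_transpose_image [simp]: "t \<in> transpose a b ` S \<longleftrightarrow> transpose a b t \<in> S"
  by (metis image_iff transpose_involutory)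

lemma transpose_image_involutory [simp]: "transpose a b ` transpose a b ` S = S"
  by (simp add: image_comp)

lemma card_transpose_image [simp]: "card (transpose a b ` S) = card S"
  by (metis card_image inj_transpose inj_on_subset subset_UNIV)

lemma adj_swap_image_insert:
  "i \<in> J \<Longrightarrow> Suc i \<notin> J \<Longrightarrow> adj_swap i ` J = insert (Suc i) (J - {i})"
  "Suc i \<in> J \<Longrightarrow> i \<notin> J \<Longrightarrow> adj_swap i ` J = insert i (J - {Suc i})"
  by (auto simp: transpose_def split: if_splits)

lemma adj_swap_image_same: "i \<in> J \<longleftrightarrow> Suc i \<in> J \<Longrightarrow> adj_swap i ` J = J"
  by (auto simp: transpose_def split: if_splits)

text \<open>The first difference is carried along by the transposition or moves between
  \<open>i\<close> and \<open>Suc i\<close>. The order can be reversed only if the sets agree below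
  \<open>i\<close> and each contains exactly one of the two labels, \<open>J\<close> the smaller and
  \<open>K\<close> the larger one; the second assumption excludes this pattern.\<close>

lemma lex_less_adj_swap:
  assumes "lex_less J K" "\<not> (i \<in> J \<and> Suc i \<notin> J \<and> i \<notin> K \<and> Suc i \<in> K)"
  shows "lex_less (adj_swap i ` J) (adj_swap i ` K)"
proof -
  from assms(1) obtain m where m: "m \<in> J" "m \<notin> K" "\<And>t. t < m \<Longrightarrow> t \<in> J \<longleftrightarrow> t \<in> K"
    by (erule lex_lessE)
  consider "m < i" | "m = i" "Suc i \<in> J" "Suc i \<notin> K" | "m = i" "Suc i \<in> J \<longleftrightarrow> Suc i \<in> K"
    | "m = Suc i" | "Suc i < m"
    using assms(2) m by (metis linorder_neqE_nat not_less_eq)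
  then show ?thesis
  proof cases
    case 1
    show ?thesis by (rule lex_lessI[of m]) (use m 1 in \<open>auto simp: transpose_def\<close>)
  next
    case 2
    show ?thesis by (rule lex_lessI[of i]) (use m 2 in \<open>auto simp: transpose_def\<close>)
  next
    case 3
    show ?thesis
      by (rule lex_lessI[of "Suc i"]) (use m 3 in \<open>auto simp: transpose_def less_Suc_eq\<close>)
  next
    case 4
    show ?thesis by (rule lex_lessI[of i]) (use m 4 in \<open>auto simp: transpose_def\<close>)
  next
    case 5
    show ?thesis by (rule lex_lessI[of m]) (use m 5 in \<open>auto simp: transpose_def\<close>)
  qed
qed

definition basis_exchange :: "nat set set \<Rightarrow> bool" where
  "basis_exchange M \<longleftrightarrow> (\<forall>J\<in>M. \<forall>K\<in>M. \<forall>a\<in>J - K. \<exists>b\<in>K - J.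
     insert b (J - {a}) \<in> M \<and> insert a (K - {b}) \<in> M)"

text \<open>What the relation P_ac P_bd = P_ab P_cd + P_ad P_bc, with common part \<open>R\<close>,
  says about nonvanishing when no coordinate is negative: one nonzero product on the right makes
  both factors on the left nonzero.\<close>

definition three_term :: "nat set set \<Rightarrow> bool" where
  "three_term M \<longleftrightarrow> (\<forall>R a b c d. a < b \<and> b < c \<and> c < d \<and> R \<inter> {a, b, c, d} = {} \<and>
     (R \<union> {a, b} \<in> M \<and> R \<union> {c, d} \<in> M \<or> R \<union> {a, d} \<in> M \<and> R \<union> {b, c} \<in> M) \<longrightarrow>
     R \<union> {a, c} \<in> M \<and> R \<union> {b, d} \<in> M)"

lemma three_termD:
  assumes "three_term M" "a < b" "b < c" "c < d" "R \<inter> {a, b, c, d} = {}"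
  shows "R \<union> {a, b} \<in> M \<Longrightarrow> R \<union> {c, d} \<in> M \<Longrightarrow> R \<union> {a, c} \<in> M"
    and "R \<union> {a, d} \<in> M \<Longrightarrow> R \<union> {b, c} \<in> M \<Longrightarrow> R \<union> {b, d} \<in> M"
  using assms unfolding three_term_def by blast+

lemma card_split_at:
  fixes S :: "nat set"
  assumes "finite S"
  shows "card S = card (S \<inter> {..t}) + card (S \<inter> {t<..})"
proof -
  have "S = (S \<inter> {..t}) \<union> (S \<inter> {t<..})" by auto
  then show ?thesis using assms card_Un_disjoint[of "S \<inter> {..t}" "S \<inter> {t<..}"] by fastforce
qed

section \<open>Consequences of exchange and positivity for neighbouring labels\<close>

locale tnn_matroid =
  fixes n k :: nat and M :: "nat set set"
  assumes sets: "M \<subseteq> nsets {1..n} k"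
    and nonempty: "M \<noteq> {}"
    and exchange: "basis_exchange M"
    and positive: "three_term M"
begin

lemma member:
  assumes "J \<in> M"
  shows "finite J" "card J = k" "J \<subseteq> {1..n}"
  using assms sets by (auto simp: nsets_def)

lemma exchangeE:
  assumes "J \<in> M" "K \<in> M" "a \<in> J" "a \<notin> K"
  obtains b where "b \<in> K" "b \<notin> J" "insert b (J - {a}) \<in> M" "insert a (K - {b}) \<in> M"
  using exchange assms unfolding basis_exchange_def by blast

lemma lexmin_in: "lexmin M \<in> M"
  and lexmin_lex_less: "J \<in> M \<Longrightarrow> J \<noteq> lexmin M \<Longrightarrow> lex_less (lexmin M) J"
  using lexmin_less[OF sets _ nonempty] by auto

lemma lexmin_exchange_less:
  assumes "a \<in> lexmin M" "b \<notin> lexmin M" "insert b (lexmin M - {a}) \<in> M"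
  shows "a < b"
proof -
  have "insert b (lexmin M - {a}) \<noteq> lexmin M" using assms by auto
  from lexmin_lex_less[OF assms(3) this] show ?thesis
    using assms(1,2) by (elim lex_lessE) (metis Diff_iff insertCI insertE linorder_neqE_nat singletonD)
qed

text \<open>A basis \<open>J\<close> lacking some \<open>a > t\<close> of the minimal basis is
  brought nearer to it by exchanging \<open>a\<close> in. Minimality makes the expelled
  \<open>b\<close> larger than \<open>a\<close>, so the part up to \<open>t\<close> is untouched.
  Once no such \<open>a\<close> is left, the part of \<open>J\<close> above \<open>t\<close>
  contains that of the minimal basis, and equal cardinalities give the bound.\<close>

lemma gale_order:
  assumes "J \<in> M"
  shows "card (J \<inter> {..t}) \<le> card (lexmin M \<inter> {..t})"
  using assms
proof (induction "card (lexmin M - J)" arbitrary: J rule: less_induct)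
  case less
  let ?I = "lexmin M"
  have fin: "finite J" "finite ?I" and card: "card J = card ?I"
    using member[OF less.prems] member[OF lexmin_in] by auto
  show ?case
  proof (cases "\<exists>a\<in>?I - J. t < a")
    case True
    then obtain a where a: "a \<in> ?I" "a \<notin> J" "t < a" by auto
    obtain b where b: "b \<in> J" "b \<notin> ?I" "insert b (?I - {a}) \<in> M" "insert a (J - {b}) \<in> M"
      using exchangeE[OF lexmin_in less.prems a(1,2)] by blast
    have "a < b" using lexmin_exchange_less a(1) b by blast
    then have "insert a (J - {b}) \<inter> {..t} = J \<inter> {..t}" using a(3) by auto
    moreover have "card (?I - insert a (J - {b})) < card (?I - J)"
      using a b fin by (intro psubset_card_mono) auto
    ultimately show ?thesis using less.hyps[OF _ b(4)] by simp
  next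
    case False
    then have "?I \<inter> {t<..} \<subseteq> J \<inter> {t<..}" by auto
    then have "card (?I \<inter> {t<..}) \<le> card (J \<inter> {t<..})" using fin by (intro card_mono) auto
    then show ?thesis using card_split_at[OF fin(1), of t] card_split_at[OF fin(2), of t] card by linarith
  qed
qed

text \<open>If the swapped set were missing, exchanges with the minimal basis would not pair
  \<open>i\<close> with \<open>Suc i\<close> but would yield \<open>j\<close> beyond
  \<open>Suc i\<close> and \<open>a\<close> below \<open>i\<close>. With
  \<open>R = J - {Suc i, j}\<close>, the bases \<open>R \<union> {a, j}\<close> and
  \<open>R \<union> {i, Suc i}\<close> are the outer and the inner pair of a three-term relation
  that forces \<open>R \<union> {i, j}\<close>, which is the swapped set.\<close>

lemma adj_swap_closed:
  assumes i: "i \<in> lexmin M" "Suc i \<notin> lexmin M" and J: "J \<in> M" "Suc i \<in> J" "i \<notin> J"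
  shows "adj_swap i ` J \<in> M"
proof (rule ccontr)
  assume not_in: "adj_swap i ` J \<notin> M"
  let ?I = "lexmin M"
  obtain j where j: "j \<in> J" "j \<notin> ?I" "insert j (?I - {i}) \<in> M" "insert i (J - {j}) \<in> M"
    using exchangeE[OF lexmin_in J(1) i(1) J(3)] by blast
  have "i < j" using lexmin_exchange_less i(1) j by blast
  moreover have "j \<noteq> Suc i" using j(4) not_in adj_swap_image_insert(2)[OF J(2,3)] by auto
  ultimately have ij: "Suc i < j" by simp
  obtain a where a: "a \<in> ?I" "a \<notin> J" "insert a (J - {Suc i}) \<in> M" "insert (Suc i) (?I - {a}) \<in> M"
    using exchangeE[OF J(1) lexmin_in J(2) i(2)] by blast
  have "a < Suc i" using lexmin_exchange_less a(1,4) i(2) by blast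
  moreover have "a \<noteq> i" using a(3) not_in adj_swap_image_insert(2)[OF J(2,3)] by auto
  ultimately have ai: "a < i" by simp
  define R where "R = J - {Suc i, j}"
  have "R \<union> {a, j} = insert a (J - {Suc i})" "R \<union> {i, Suc i} = insert i (J - {j})"
    using j(1) ij J(2) by (auto simp: R_def)
  then have "R \<union> {a, j} \<in> M" "R \<union> {i, Suc i} \<in> M" using a(3) j(4) by simp_all
  then have "R \<union> {i, j} \<in> M"
    using three_termD(2)[OF positive ai lessI ij, of R] a(2) J by (auto simp: R_def)
  moreover have "R \<union> {i, j} = adj_swap i ` J"
    unfolding adj_swap_image_insert(2)[OF J(2,3)] using j(1) ij by (auto simp: R_def)
  ultimately show False using not_in by simp
qed

text \<open>A basis without \<open>i\<close> and a basis with \<open>Suc i\<close>, exchanged with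
  the minimal basis, give labels \<open>j > Suc i\<close> and \<open>a < i\<close>. One more
  exchange completes a three-term relation that contains the minimal basis and forces the swapped
  one.\<close>

lemma loop_or_coloop:
  assumes i: "i \<in> lexmin M" "Suc i \<notin> lexmin M" "adj_swap i ` lexmin M \<notin> M"
  shows "(\<forall>J\<in>M. i \<in> J) \<or> (\<forall>J\<in>M. Suc i \<notin> J)"
proof (rule ccontr)
  assume "\<not> ?thesis"
  then obtain J K where J: "J \<in> M" "i \<notin> J" and K: "K \<in> M" "Suc i \<in> K" by auto
  let ?I = "lexmin M"
  have swap: "insert (Suc i) (?I - {i}) \<notin> M" using i adj_swap_image_insert(1) by auto
  obtain j where j: "j \<in> J" "j \<notin> ?I" "insert j (?I - {i}) \<in> M"
    using exchangeE[OF lexmin_in J(1) i(1) J(2)] by blast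
  have "i < j" using lexmin_exchange_less i(1) j by blast
  moreover have "j \<noteq> Suc i" using j swap by auto
  ultimately have ij: "Suc i < j" by simp
  obtain a where a: "a \<in> ?I" "a \<notin> K" "insert (Suc i) (?I - {a}) \<in> M"
    using exchangeE[OF K(1) lexmin_in K(2) i(2)] by blast
  have "a < Suc i" using lexmin_exchange_less a(1,3) i(2) by blast
  moreover have "a \<noteq> i" using a(3) swap by auto
  ultimately have ai: "a < i" by simp
  define R where "R = ?I - {a, i}"
  have I: "?I = R \<union> {a, i}" using a(1) i(1) by (auto simp: R_def)
  have R: "R \<inter> {a, i, Suc i, j} = {}" using i(2) j(2) by (auto simp: R_def)
  have sets': "insert (Suc i) (?I - {i}) = R \<union> {a, Suc i}" "insert j (?I - {i}) = R \<union> {a, j}"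
    "insert (Suc i) (?I - {a}) = R \<union> {i, Suc i}"
    using ai a(1) i(1) by (auto simp: R_def)
  \<comment> \<open>Expelling \<open>i\<close> from the first of these bases can bring in only
    \<open>a\<close> or \<open>j\<close>. The label \<open>a\<close> would produce the swapped
    minimal basis, so it is \<open>j\<close> that enters.\<close>
  have "R \<union> {i, Suc i} \<in> M" "R \<union> {a, j} \<in> M" using a(3) j(3) unfolding sets' by auto
  moreover have "i \<in> R \<union> {i, Suc i}" "i \<notin> R \<union> {a, j}" using R ai ij by auto
  ultimately obtain b where b: "b \<in> R \<union> {a, j}" "b \<notin> R \<union> {i, Suc i}"
      "insert b (R \<union> {i, Suc i} - {i}) \<in> M"
    by (rule exchangeE)
  have eq: "insert b (R \<union> {i, Suc i} - {i}) = R \<union> {b, Suc i}"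
    using R b(2) by auto
  have "b \<noteq> a"
  proof
    assume "b = a"
    with b(3) have "R \<union> {a, Suc i} \<in> M" unfolding eq by simp
    with swap show False unfolding sets' by simp
  qed
  with b(1,2) have "b = j" by simp
  with b(3) have "R \<union> {j, Suc i} \<in> M" unfolding eq by simp
  moreover have "{j, Suc i} = {Suc i, j}" by blast
  ultimately have R1: "R \<union> {Suc i, j} \<in> M" by metis
  have "R \<union> {a, i} \<in> M" by (metis I lexmin_in)
  from this R1 have "R \<union> {a, Suc i} \<in> M"
    by (rule three_termD(1)[OF positive ai lessI ij R])
  with swap show False unfolding sets' by simp
qed

end

section \<open>Bases attached to boxes under removal of a corner box\<close>

text \<open>The condition on the competitors for \<open>M'(B, M)\<close>, phrased without the
  ambient set \<open>{1..n}\<close> so that it can be transported by transpositions;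
  \<open>agree_off_iff\<close> is the link to the original form.\<close>

definition agree_off :: "nat \<Rightarrow> nat \<Rightarrow> nat set \<Rightarrow> nat set \<Rightarrow> bool" where
  "agree_off p q J K \<longleftrightarrow> (\<forall>t. \<not> (p < t \<and> t < q) \<longrightarrow> (t \<in> J \<longleftrightarrow> t \<in> K))"

text \<open>
  For a box \<open>B\<close> in the row of the source \<open>p\<close> and the column of the sink \<open>q\<close>, \<open>hook_max M p q\<close> and
  \<open>hook_basis M p q\<close> are the sets \<open>M'(B, M)\<close> and \<open>M(B, M)\<close>.
\<close>

definition hook_max :: "nat set set \<Rightarrow> nat \<Rightarrow> nat \<Rightarrow> nat set" where
  "hook_max M p q = lexmax {J \<in> M. agree_off p q J (lexmin M)}"

definition hook_basis :: "nat set set \<Rightarrow> nat \<Rightarrow> nat \<Rightarrow> nat set" where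
  "hook_basis M p q = insert q (hook_max M p q - {p})"

lemma agree_off_refl [simp]: "agree_off p q J J"
  by (simp add: agree_off_def)

lemma agree_off_iff:
  assumes "J \<subseteq> V" "K \<subseteq> V"
  shows "agree_off p q J K \<longleftrightarrow> J \<inter> (V - {p<..<q}) = K \<inter> (V - {p<..<q})"
  using assms unfolding agree_off_def by (auto simp: set_eq_iff)

text \<open>The transposition carries the free interval of \<open>(p, q)\<close> to that of the
  transposed ends, except that for \<open>p = i\<close> the label \<open>Suc i\<close>, and for
  \<open>q = Suc i\<close> the label \<open>i\<close>, drops out of it. There \<open>J\<close> must
  then agree with \<open>I\<close>, which contains \<open>i\<close> but not \<open>Suc i\<close>;
  hence the two extra conditions.\<close>

lemma agree_off_adj_swap:
  assumes "p \<in> I" "q \<notin> I" "p < q" "i \<in> I" "Suc i \<notin> I" "(p, q) \<noteq> (i, Suc i)"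
  shows "agree_off (adj_swap i p) (adj_swap i q) (adj_swap i ` J) (adj_swap i ` I) \<longleftrightarrow>
    agree_off p q J I \<and> (p = i \<longrightarrow> Suc i \<notin> J) \<and> (q = Suc i \<longrightarrow> i \<in> J)"
proof -
  let ?s = "adj_swap i"
  have "agree_off (?s p) (?s q) (?s ` J) (?s ` I) \<longleftrightarrow>
      (\<forall>t. \<not> (?s p < t \<and> t < ?s q) \<longrightarrow> (?s t \<in> J \<longleftrightarrow> ?s t \<in> I))"
    by (simp add: agree_off_def)
  also have "\<dots> \<longleftrightarrow> (\<forall>t. \<not> (?s p < ?s t \<and> ?s t < ?s q) \<longrightarrow> (t \<in> J \<longleftrightarrow> t \<in> I))"
    by (metis transpose_involutory)
  also have "\<dots> \<longleftrightarrow> agree_off p q J I \<and> (p = i \<longrightarrow> Suc i \<notin> J) \<and> (q = Suc i \<longrightarrow> i \<in> J)"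
  proof -
    have pq: "p \<noteq> Suc i" "q \<noteq> i" using assms by auto
    have eq: "(?s p < ?s t \<and> ?s t < ?s q) \<longleftrightarrow>
        p < t \<and> t < q \<and> \<not> (p = i \<and> t = Suc i) \<and> \<not> (q = Suc i \<and> t = i)" for t
      using pq assms(3,6) by (auto simp: transpose_def)
    show ?thesis unfolding eq agree_off_def using assms by auto
  qed
  finally show ?thesis .
qed

text \<open>An open interval that does not contain both \<open>i\<close> and \<open>Suc i\<close>
  lies on one side of the cut between them. So either the parts up to \<open>i\<close> or the parts
  above \<open>i\<close> coincide, and equal cardinalities do the rest.\<close>

lemma agree_off_card:
  assumes "agree_off p q J I" "finite J" "finite I" "card J = card I" "\<not> (p < i \<and> Suc i < q)"
  shows "card (J \<inter> {..i}) = card (I \<inter> {..i})"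
proof (cases "p < i")
  case False
  then have "J \<inter> {..i} = I \<inter> {..i}" using assms(1) by (auto simp: agree_off_def)
  then show ?thesis by simp
next
  case True
  then have "J \<inter> {i<..} = I \<inter> {i<..}" using assms(1,5) by (auto simp: agree_off_def)
  then show ?thesis
    using card_split_at[OF assms(2), of i] card_split_at[OF assms(3), of i] assms(4) by simp
qed

context tnn_matroid
begin

lemma hook_max:
  "hook_max M p q \<in> M" "agree_off p q (hook_max M p q) (lexmin M)"
  "J \<in> M \<Longrightarrow> agree_off p q J (lexmin M) \<Longrightarrow> J \<noteq> hook_max M p q \<Longrightarrow> lex_less J (hook_max M p q)"
proof -
  let ?F = "{J \<in> M. agree_off p q J (lexmin M)}"
  have F: "?F \<subseteq> nsets {1..n} k" "?F \<noteq> {}" using sets lexmin_in by auto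
  from lexmax_iff[OF F(1) _ F(2), of "hook_max M p q"] 
  show "hook_max M p q \<in> M" "agree_off p q (hook_max M p q) (lexmin M)"
    "J \<in> M \<Longrightarrow> agree_off p q J (lexmin M) \<Longrightarrow> J \<noteq> hook_max M p q \<Longrightarrow> lex_less J (hook_max M p q)"
    by (auto simp: hook_max_def)
qed

lemma hook_max_eqI:
  assumes "T \<in> M" "agree_off p q T (lexmin M)"
    and "\<And>J. J \<in> M \<Longrightarrow> agree_off p q J (lexmin M) \<Longrightarrow> J \<noteq> T \<Longrightarrow> lex_less J T"
  shows "hook_max M p q = T"
  using hook_max[where p = p and q = q] assms lex_less_asym by metis

end

section \<open>Attached bases before and after a removal\<close>

locale removable_step = M: tnn_matroid n k M + N: tnn_matroid n k N
  for n k :: nat and M N :: "nat set set" +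
  fixes i :: nat
  assumes desc: "i \<in> lexmin M" "Suc i \<notin> lexmin M"
begin

abbreviation "s \<equiv> adj_swap i"

text \<open>The transposition maps the competitors in \<open>M\<close> onto those in
  \<open>N\<close>, and \<open>no_flip\<close> rules out the only pattern that could reverse their
  order, so the two maxima correspond.\<close>

lemma hook_basis_swap:
  assumes lexmin_N: "lexmin N = s ` lexmin M"
    and feasible: "\<And>J. (J \<in> M \<and> agree_off p q J (lexmin M)) \<longleftrightarrow>
      (s ` J \<in> N \<and> agree_off (s p) (s q) (s ` J) (lexmin N))"
    and no_flip: "\<And>J K. J \<in> M \<Longrightarrow> agree_off p q J (lexmin M) \<Longrightarrow> K \<in> M \<Longrightarrow>
      agree_off p q K (lexmin M) \<Longrightarrow> \<not> (i \<in> J \<and> Suc i \<notin> J \<and> i \<notin> K \<and> Suc i \<in> K)"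
  shows "hook_basis N (s p) (s q) = s ` hook_basis M p q"
proof -
  let ?T = "hook_max M p q"
  have T: "?T \<in> M" "agree_off p q ?T (lexmin M)" by (rule M.hook_max)+
  have "hook_max N (s p) (s q) = s ` ?T"
  proof (rule N.hook_max_eqI)
    show "s ` ?T \<in> N" "agree_off (s p) (s q) (s ` ?T) (lexmin N)" using feasible T by blast+
    fix J assume J: "J \<in> N" "agree_off (s p) (s q) J (lexmin N)" "J \<noteq> s ` ?T"
    have "J = s ` s ` J" by simp
    with J feasible[of "s ` J"] have J': "s ` J \<in> M" "agree_off p q (s ` J) (lexmin M)" by simp_all
    moreover have "s ` J \<noteq> ?T" using J(3) by (metis transpose_image_involutory)
    ultimately have "lex_less (s ` J) ?T" by (intro M.hook_max)
    from lex_less_adj_swap[OF this no_flip[OF J' T]] show "lex_less J (s ` ?T)" by simp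
  qed
  then show ?thesis
    unfolding hook_basis_def by (simp add: image_set_diff[OF inj_transpose])
qed

end

locale trivial_removal = removable_step +
  assumes N_eq: "N = (`) (adj_swap i) ` M"
    and loop_coloop: "(\<forall>J\<in>M. i \<in> J) \<or> (\<forall>J\<in>M. Suc i \<notin> J)"
begin

lemma mem_N: "s ` J \<in> N \<longleftrightarrow> J \<in> M"
proof
  assume "s ` J \<in> N"
  then obtain K where K: "K \<in> M" "s ` J = s ` K" unfolding N_eq by auto
  from K(2) have "s ` s ` J = s ` s ` K" by simp
  then show "J \<in> M" using K(1) by simp
qed (simp add: N_eq)

lemma lexmin_N: "lexmin N = s ` lexmin M"
proof (rule lexmin_characterization[OF N.sets])
  show "s ` lexmin M \<in> N" using M.lexmin_in mem_N by simp
  fix J assume J: "J \<in> N" "J \<noteq> s ` lexmin M"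
  have "s ` J \<in> M" using J(1) mem_N[of "s ` J"] by simp
  moreover have "s ` J \<noteq> lexmin M" using J(2) by (metis transpose_image_involutory)
  ultimately have "lex_less (lexmin M) (s ` J)" by (rule M.lexmin_lex_less)
  moreover have "\<not> (i \<in> lexmin M \<and> Suc i \<notin> lexmin M \<and> i \<notin> s ` J \<and> Suc i \<in> s ` J)"
    using loop_coloop \<open>s ` J \<in> M\<close> by blast
  ultimately have "lex_less (s ` lexmin M) (s ` s ` J)" by (rule lex_less_adj_swap)
  then show "lex_less (s ` lexmin M) J" by simp
qed simp

lemma hook_basis_mem_N:
  assumes "p \<in> lexmin M" "q \<notin> lexmin M" "p < q" "(p, q) \<noteq> (i, Suc i)"
  shows "hook_basis N (s p) (s q) \<in> N \<longleftrightarrow> hook_basis M p q \<in> M"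
proof -
  have p: "p \<noteq> Suc i" and q: "q \<noteq> i" using assms desc by auto
  note agree = agree_off_adj_swap[OF assms(1-3) desc assms(4), folded lexmin_N]
  \<comment> \<open>The extra conditions of \<open>agree_off_adj_swap\<close> hold for all bases
    unless the end label itself is the coloop or the loop. In these two cases neither matroid
    contains its attached set, which omits a coloop or contains a loop.\<close>
  consider (coloop) "\<forall>J\<in>M. i \<in> J" "p = i" | (loop) "\<forall>J\<in>M. Suc i \<notin> J" "q = Suc i"
    | (other) "\<forall>J\<in>M. (p = i \<longrightarrow> Suc i \<notin> J) \<and> (q = Suc i \<longrightarrow> i \<in> J)"
    using loop_coloop assms(4) by auto
  then show ?thesis
  proof cases
    case coloop
    have "s q \<noteq> Suc i" using q by (auto simp: transpose_def)
    then have "i \<notin> hook_basis M p q" "i \<notin> s ` hook_basis N (s p) (s q)"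
      using coloop assms(3) by (auto simp: hook_basis_def)
    then show ?thesis
      using coloop(1) mem_N[of "s ` hook_basis N (s p) (s q)"] by (metis transpose_image_involutory)
  next
    case loop
    have "Suc i \<in> hook_basis M p q" "Suc i \<in> s ` hook_basis N (s p) (s q)"
      using loop by (auto simp: hook_basis_def)
    then show ?thesis
      using loop(1) mem_N[of "s ` hook_basis N (s p) (s q)"] by (metis transpose_image_involutory)
  next
    case other
    have "hook_basis N (s p) (s q) = s ` hook_basis M p q"
    proof (rule hook_basis_swap[OF lexmin_N])
      show "J \<in> M \<and> agree_off p q J (lexmin M) \<longleftrightarrow>
          s ` J \<in> N \<and> agree_off (s p) (s q) (s ` J) (lexmin N)" for J
        unfolding agree mem_N using other by blast
    qed (use loop_coloop in blast)
    then show ?thesis by (simp add: mem_N)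
  qed
qed

lemma hook_basis_coloop: "\<forall>J\<in>M. i \<in> J \<Longrightarrow> i < q \<Longrightarrow> hook_basis M i q \<notin> M"
  by (auto simp: hook_basis_def)

lemma hook_basis_loop: "\<forall>J\<in>M. Suc i \<notin> J \<Longrightarrow> hook_basis M p (Suc i) \<notin> M"
  by (auto simp: hook_basis_def)

end

text \<open>\<open>M_eq\<close> is the trace of adding a positive multiple of column
  \<open>Suc i\<close> to column \<open>i\<close> of a nonnegative configuration: a coordinate grows
  by that multiple of the coordinate of the transposed set, and nothing cancels.
  \<open>lexmin_notin\<close> records that \<open>N\<close> arises from the largest possible
  subtraction.\<close>

locale bridge_removal = removable_step +
  assumes M_eq: "J \<in> M \<longleftrightarrow> J \<in> N \<or> i \<in> J \<and> Suc i \<notin> J \<and> adj_swap i ` J \<in> N"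
    and lexmin_notin: "lexmin M \<notin> N"
begin

lemma swap_lexmin_in: "s ` lexmin M \<in> N"
  using M_eq[of "lexmin M"] M.lexmin_in lexmin_notin by auto

text \<open>Every \<open>J\<close> in \<open>N\<close> is a basis of \<open>M\<close> other than the
  minimal one, hence lies above it. It remains to follow the first difference when \<open>i\<close>
  moves to \<open>Suc i\<close>.\<close>

lemma lexmin_N: "lexmin N = s ` lexmin M"
proof (rule lexmin_characterization[OF N.sets])
  show "s ` lexmin M \<in> N" by (rule swap_lexmin_in)
  let ?I = "lexmin M"
  fix J assume J: "J \<in> N" "J \<noteq> s ` ?I"
  then have "J \<in> M" "J \<noteq> ?I" using M_eq lexmin_notin by auto
  then have "lex_less ?I J" by (rule M.lexmin_lex_less)
  then obtain m where m: "m \<in> ?I" "m \<notin> J" "\<And>t. t < m \<Longrightarrow> t \<in> ?I \<longleftrightarrow> t \<in> J"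
    by (erule lex_lessE)
  have mem: "t \<in> s ` ?I \<longleftrightarrow> t = Suc i \<or> t \<noteq> i \<and> t \<in> ?I" for t
    using desc by (auto simp: transpose_def)
  consider "m < i" | "m = i" "Suc i \<notin> J" | "m = i" "Suc i \<in> J" | "Suc i < m"
    using m(1) desc(2) by (metis linorder_neqE_nat not_less_eq)
  then show "lex_less (s ` ?I) J"
  proof cases
    case 1
    show ?thesis by (rule lex_lessI[of m]) (use 1 m mem in auto)
  next
    case 2
    show ?thesis by (rule lex_lessI[of "Suc i"]) (use 2 m mem in \<open>auto simp: less_Suc_eq\<close>)
  next
    case 3
    have "s ` J \<in> M" using M.adj_swap_closed[OF desc \<open>J \<in> M\<close>] 3 m by auto
    moreover have "s ` J \<noteq> ?I" using J(2) by (metis transpose_image_involutory)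
    ultimately have "lex_less ?I (s ` J)" by (rule M.lexmin_lex_less)
    from lex_less_adj_swap[OF this, of i] show ?thesis using 3 m by simp
  next
    case 4
    \<comment> \<open>This case is contradictory. Exchanging \<open>i\<close> into the swapped basis
      would expel \<open>Suc i\<close>, which puts the old minimal basis into \<open>N\<close>, or
      some \<open>b > Suc i\<close>, which gives a basis of \<open>M\<close> with \<open>b\<close>
      replaced by the smaller label \<open>Suc i\<close>.\<close>
    have "i \<in> J" using 4 m(3)[of i] desc by simp
    have "i \<notin> s ` ?I" using desc by simp
    with \<open>i \<in> J\<close> obtain b where b: "b \<in> s ` ?I" "b \<notin> J" "insert b (J - {i}) \<in> N"
        "insert i (s ` ?I - {b}) \<in> N"
      using N.exchangeE[OF J(1) swap_lexmin_in] by blast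
    have "b \<noteq> Suc i"
    proof
      assume "b = Suc i"
      then have "t \<in> insert i (s ` ?I - {b}) \<longleftrightarrow> t \<in> ?I" for t
        using mem[of t] desc by (simp only: insert_iff Diff_iff) blast
      then have "insert i (s ` ?I - {b}) = ?I" by blast
      with b(4) lexmin_notin show False by simp
    qed
    then have "b \<in> ?I" "b \<noteq> i" using b(1) mem by auto
    have "b > Suc i"
    proof (rule ccontr)
      assume "\<not> b > Suc i"
      then have "b < m" using 4 by simp
      then show False using m(3)[of b] \<open>b \<in> ?I\<close> b(2) by simp
    qed
    have "t \<in> insert i (s ` ?I - {b}) \<longleftrightarrow> t \<in> insert (Suc i) (?I - {b})" for t
      using mem[of t] desc \<open>b \<noteq> i\<close> \<open>b \<noteq> Suc i\<close> by (simp only: insert_iff Diff_iff) blast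
    then have "insert i (s ` ?I - {b}) = insert (Suc i) (?I - {b})" by blast
    then have "insert (Suc i) (?I - {b}) \<in> M" using b(4) M_eq by auto
    from M.lexmin_exchange_less[OF \<open>b \<in> ?I\<close> desc(2) this] \<open>b > Suc i\<close> show ?thesis by simp
  qed
qed simp

text \<open>The minimal basis of \<open>N\<close> has one label fewer in \<open>{..i}\<close> than
  that of \<open>M\<close>, and by \<open>gale_order\<close> no basis of \<open>N\<close> has more
  labels there than the minimal one.\<close>

lemma notin_N:
  assumes "card (J \<inter> {..i}) = card (lexmin M \<inter> {..i})"
  shows "J \<notin> N"
proof
  assume "J \<in> N"
  from N.gale_order[OF this, of i] assms lexmin_N
  have "card (lexmin M \<inter> {..i}) \<le> card (s ` lexmin M \<inter> {..i})" by simp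
  also have "s ` lexmin M \<inter> {..i} = lexmin M \<inter> {..i} - {i}"
    using desc by (auto simp: transpose_def split: if_splits)
  also have "card \<dots> < card (lexmin M \<inter> {..i})"
    using desc M.member(1)[OF M.lexmin_in] by (intro psubset_card_mono) auto
  finally show False by simp
qed

lemma hook_basis_mem_N:
  assumes p: "p \<in> lexmin M" and q: "q \<notin> lexmin M" "q \<in> {1..n}" "p < q" and pq: "(p, q) \<noteq> (i, Suc i)"
  shows "hook_basis N (s p) (s q) \<in> N \<longleftrightarrow> hook_basis M p q \<in> M"
proof (cases "p < i \<and> Suc i < q")
  case False
  have p': "p \<noteq> Suc i" and q': "q \<noteq> i" using p q desc by auto
  note agree = agree_off_adj_swap[OF p q(1,3) desc pq, folded lexmin_N]
  have card: "card (J \<inter> {..i}) = card (lexmin M \<inter> {..i})"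
    if "J \<in> M" "agree_off p q J (lexmin M)" for J
    using agree_off_card[OF that(2) _ _ _ False] M.member[OF that(1)] M.member[OF M.lexmin_in] by simp
  \<comment> \<open>All competitors have the count that is impossible in \<open>N\<close>, so each
    of them is a basis of \<open>M\<close> only through its transposed set.\<close>
  have feas: "i \<in> J \<and> Suc i \<notin> J \<and> s ` J \<in> N" if "J \<in> M" "agree_off p q J (lexmin M)" for J
    using notin_N[OF card[OF that]] M_eq[of J] that(1) by blast
  have swap: "hook_basis N (s p) (s q) = s ` hook_basis M p q"
  proof (rule hook_basis_swap[OF lexmin_N])
    show "J \<in> M \<and> agree_off p q J (lexmin M) \<longleftrightarrow>
          s ` J \<in> N \<and> agree_off (s p) (s q) (s ` J) (lexmin N)" for J
    proof
      assume "J \<in> M \<and> agree_off p q J (lexmin M)"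
      then show "s ` J \<in> N \<and> agree_off (s p) (s q) (s ` J) (lexmin N)"
        unfolding agree using feas by blast
    next
      assume *: "s ` J \<in> N \<and> agree_off (s p) (s q) (s ` J) (lexmin N)"
      then have ag: "agree_off p q J (lexmin M)" "p = i \<Longrightarrow> Suc i \<notin> J" "q = Suc i \<Longrightarrow> i \<in> J"
        unfolding agree by auto
      have "\<not> (p < i \<and> i < q) \<or> q = Suc i" "\<not> (p < Suc i \<and> Suc i < q) \<or> p = i"
        using False p' q' by auto
      then have "i \<in> J" "Suc i \<notin> J" using ag desc unfolding agree_off_def by blast+
      then show "J \<in> M \<and> agree_off p q J (lexmin M)"
        using M_eq[of J] * ag by blast
    qed
  qed (use feas in blast)
  let ?T = "hook_max M p q" let ?Z = "hook_basis M p q"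
  have T: "?T \<in> M" "agree_off p q ?T (lexmin M)" by (rule M.hook_max)+
  have iT: "i \<in> ?T" "Suc i \<notin> ?T" using feas[OF T] by auto
  show ?thesis
  proof (cases "p = i \<or> q = Suc i")
    case True
    \<comment> \<open>For \<open>p = i\<close> the attached set contains neither label, for
      \<open>q = Suc i\<close> both of them; in either case transposing does not move it.\<close>
    then have "i \<in> ?Z \<longleftrightarrow> Suc i \<in> ?Z"
      using iT pq p' q' by (auto simp: hook_basis_def)
    then show ?thesis unfolding swap using adj_swap_image_same[of i ?Z] M_eq[of ?Z] by auto
  next
    case outside: False
    then have Z: "i \<in> ?Z" "Suc i \<notin> ?Z" using iT p' q' by (auto simp: hook_basis_def)
    have "p \<in> ?T" "q \<notin> ?T" using T(2) p q by (auto simp: agree_off_def)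
    \<comment> \<open>Replacing \<open>p\<close> by \<open>q\<close> now stays on one side of the
      cut between \<open>i\<close> and \<open>Suc i\<close>. The attached set keeps the count that
      excludes it from \<open>N\<close>, so it can be a basis of \<open>M\<close> only through its
      transposed set.\<close>
    have "p > Suc i \<or> q < i" using False outside p' q' by auto
    then have "card (?Z \<inter> {..i}) = card (?T \<inter> {..i})"
    proof
      assume "p > Suc i"
      then have "?Z \<inter> {..i} = ?T \<inter> {..i}" using q(3) by (auto simp: hook_basis_def)
      then show ?thesis by simp
    next
      assume "q < i"
      then have "?Z \<inter> {..i} = insert q (?T \<inter> {..i} - {p})" using q(3) by (auto simp: hook_basis_def)
      moreover have "card (insert q (?T \<inter> {..i} - {p})) = Suc (card (?T \<inter> {..i} - {p}))"
        using \<open>q \<notin> ?T\<close> by simp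
      moreover have "Suc (card (?T \<inter> {..i} - {p})) = card (?T \<inter> {..i})"
        using \<open>p \<in> ?T\<close> q(3) \<open>q < i\<close> by (intro card_Suc_Diff1) auto
      ultimately show ?thesis by (simp only:)
    qed
    also have "\<dots> = card (lexmin M \<inter> {..i})" by (rule card[OF T])
    finally have "?Z \<notin> N" by (rule notin_N)
    then show ?thesis unfolding swap using M_eq[of ?Z] Z by blast
  qed
next
  case inside: True
  then have pq': "s p = p" "s q = q" by (auto simp: transpose_def)
  let ?T = "hook_max N p q"
  have fixed: "s t = t" if "\<not> (p < t \<and> t < q)" for t
    using inside that by (auto simp: transpose_def)
  have agree_s: "agree_off p q (s ` J) K" if "agree_off p q J K" for J K
    unfolding agree_off_def
  proof (intro allI impI)
    fix t assume t: "\<not> (p < t \<and> t < q)"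
    then show "t \<in> s ` J \<longleftrightarrow> t \<in> K"
      using fixed[OF t] that by (simp add: agree_off_def)
  qed
  have agree: "agree_off p q J (lexmin N) \<longleftrightarrow> agree_off p q J (lexmin M)" for J
    unfolding agree_off_def lexmin_N mem_transpose_image using fixed by metis
  have T: "?T \<in> N" "agree_off p q ?T (lexmin M)" using N.hook_max(1,2)[of p q] agree by auto
  have "hook_max M p q = ?T"
  proof (rule M.hook_max_eqI)
    show "?T \<in> M" "agree_off p q ?T (lexmin M)" using T M_eq by auto
    fix J assume J: "J \<in> M" "agree_off p q J (lexmin M)" "J \<noteq> ?T"
    \<comment> \<open>A competitor that is new in \<open>M\<close> is smaller than its transposed
      set, and the latter already competes in \<open>N\<close>. So the maximum is the same for both
      matroids.\<close>
    show "lex_less J ?T"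
    proof (cases "J \<in> N")
      case True
      then show ?thesis using N.hook_max(3)[of J p q] J agree by simp
    next
      case False
      then have sJ: "i \<in> J" "Suc i \<notin> J" "s ` J \<in> N" using M_eq[of J] J(1) by auto
      have "agree_off p q (s ` J) (lexmin M)"
        by (rule agree_s[OF J(2)])
      then have le: "s ` J = ?T \<or> lex_less (s ` J) ?T"
        using N.hook_max(3)[of "s ` J" p q] sJ agree by auto
      have less: "lex_less J (s ` J)"
        by (rule lex_lessI[of i]) (use sJ in \<open>auto simp: transpose_def\<close>)
      from le show ?thesis
      proof
        assume "lex_less (s ` J) ?T"
        with less show ?thesis by (rule lex_less_trans)
      qed (use less in simp)
    qed
  qed
  then have Z: "hook_basis M p q = hook_basis N p q" by (simp add: hook_basis_def)
  let ?Z = "hook_basis N p q"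
  \<comment> \<open>If the attached set were a basis of \<open>M\<close> only through its transposed
    set, the three-term relation in \<open>N\<close> for \<open>p < i < Suc i < q\<close> would make
    the transposed maximum a basis too. It would be a competitor larger than the maximum.\<close>
  have "?Z \<in> N" if Z': "i \<in> ?Z" "Suc i \<notin> ?Z" "s ` ?Z \<in> N"
  proof (rule ccontr)
    assume notin: "?Z \<notin> N"
    have T': "i \<in> ?T" "Suc i \<notin> ?T" using Z' inside by (auto simp: hook_basis_def)
    have pT: "p \<in> ?T" "q \<notin> ?T" using T(2) p q by (auto simp: agree_off_def)
    define R where "R = ?T - {p, i}"
    have R: "R \<inter> {p, i, Suc i, q} = {}" using T' pT by (auto simp: R_def)
    have "?T = R \<union> {p, i}" using T' pT by (auto simp: R_def)
    then have 1: "R \<union> {p, i} \<in> N" using T(1) by simp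
    have "s ` ?Z = R \<union> {Suc i, q}"
      unfolding adj_swap_image_insert(1)[OF Z'(1,2)]
      using T' pT inside by (auto simp: R_def hook_basis_def)
    then have 2: "R \<union> {Suc i, q} \<in> N" using Z'(3) by simp
    have 3: "R \<union> {p, Suc i} \<in> N"
      by (rule three_termD(1)[OF N.positive _ _ _ R 1 2]) (use inside in auto)
    have sT: "s ` ?T = R \<union> {p, Suc i}"
      unfolding adj_swap_image_insert(1)[OF T'] using T' pT inside by (auto simp: R_def)
    have "agree_off p q (s ` ?T) (lexmin N)"
      unfolding agree by (rule agree_s[OF T(2)])
    moreover have "s ` ?T \<noteq> ?T" using T' by (metis mem_transpose_image transpose_apply_first)
    ultimately have "lex_less (s ` ?T) ?T" using N.hook_max(3) 3 sT by metis
    moreover have "lex_less ?T (s ` ?T)"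
      by (rule lex_lessI[of i]) (use T' in \<open>auto simp: transpose_def\<close>)
    ultimately show False using lex_less_asym by blast
  qed
  then show ?thesis unfolding Z pq' using M_eq[of ?Z] by blast
qed

text \<open>There is no label strictly between \<open>i\<close> and \<open>Suc i\<close>, so the
  minimal basis is its own only competitor.\<close>

lemma hook_basis_corner: "hook_basis M i (Suc i) \<in> M"
proof -
  have "hook_max M i (Suc i) = lexmin M"
  proof -
    have "J = lexmin M" if "agree_off i (Suc i) J (lexmin M)" for J
      using that by (auto simp: agree_off_def)
    then show ?thesis using M.hook_max(2) by blast
  qed
  then have "hook_basis M i (Suc i) = s ` lexmin M"
    using adj_swap_image_insert(1)[OF desc] by (simp add: hook_basis_def)
  then show ?thesis using swap_lexmin_in M_eq by simp
qed

end

section \<open>Vertex-disjoint linkings\<close>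

text \<open>
  A partial injection \<open>F\<close> of arcs obeying conservation of flow: each vertex is entered (as an element
  of \<open>S\<close> or by an arc of \<open>F\<close>) as often as it is left, and at most once.
\<close>

definition linking :: "('v \<times> 'v) set \<Rightarrow> 'v set \<Rightarrow> 'v set \<Rightarrow> ('v \<times> 'v) set \<Rightarrow> bool" where
  "linking E S T F \<longleftrightarrow> F \<subseteq> E \<and> single_valued F \<and> single_valued (F\<inverse>) \<and>
     (\<forall>v. (v \<in> S \<or> v \<in> Range F \<longleftrightarrow> v \<in> T \<or> v \<in> Domain F) \<and>
        \<not> (v \<in> S \<and> v \<in> Range F) \<and> \<not> (v \<in> T \<and> v \<in> Domain F))"

definition linkable :: "('v \<times> 'v) set \<Rightarrow> 'v set \<Rightarrow> 'v set \<Rightarrow> bool" where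
  "linkable E S T \<longleftrightarrow> (\<exists>F. linking E S T F)"

locale linked_arcs =
  fixes E F :: "('v \<times> 'v) set" and S T :: "'v set"
  assumes link: "linking E S T F"
begin

lemma subset: "F \<subseteq> E"
  and inj: "(u, v) \<in> F \<Longrightarrow> (u, w) \<in> F \<Longrightarrow> v = w" "(u, w) \<in> F \<Longrightarrow> (v, w) \<in> F \<Longrightarrow> u = v"
  and flow: "v \<in> S \<or> v \<in> Range F \<longleftrightarrow> v \<in> T \<or> v \<in> Domain F"
  and disjoint: "\<not> (v \<in> S \<and> v \<in> Range F)" "\<not> (v \<in> T \<and> v \<in> Domain F)"
  using link unfolding linking_def single_valued_def by (auto 0 3)

end

lemma linkableE:
  assumes "linkable E S T"
  obtains F where "linked_arcs E F S T"
  using assms unfolding linkable_def linked_arcs_def by blast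

text \<open>
  Local picture at the corner \<open>z\<close> of the removed box, with \<open>x\<close> the boundary vertex \<open>i\<close> and \<open>y\<close> the
  boundary vertex \<open>i + 1\<close>: the arcs into \<open>z\<close> from above start in \<open>U\<close>, the arcs out of \<open>z\<close> to the left
  end in \<open>W\<close>. After the removal the former end in the sink \<open>x\<close> and the latter start in the source \<open>y\<close>.
\<close>

locale corner_surgery =
  fixes H :: "('v \<times> 'v) set" and U W :: "'v set" and x y z :: 'v
  assumes distinct: "x \<noteq> y" "x \<noteq> z" "y \<noteq> z"
    and H: "\<And>u v. (u, v) \<in> H \<Longrightarrow> u \<notin> {x, y, z} \<and> v \<notin> {x, y, z}"
    and UW: "x \<notin> U" "y \<notin> U" "z \<notin> U" "x \<notin> W" "y \<notin> W" "z \<notin> W"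
begin

text \<open>Arcs into \<open>x\<close> and arcs out of \<open>y\<close> are led through
  \<open>z\<close> again. \<open>P\<close> is for the arcs \<open>(x, z)\<close> and
  \<open>(z, y)\<close>, which have no counterpart once the corner is gone.\<close>

definition "restore_corner P F = {e \<in> F. e \<in> H} \<union> {(u, z) | u. (u, x) \<in> F} \<union> {(z, w) | w. (y, w) \<in> F} \<union> P"

definition "remove_corner F =
  {e \<in> F. e \<in> H} \<union> {(u, x) | u. u \<in> U \<and> (u, z) \<in> F} \<union> {(y, w) | w. w \<in> W \<and> (z, w) \<in> F}"

abbreviation "with_corner \<equiv> H \<union> U \<times> {z} \<union> {z} \<times> W \<union> {(x, z), (z, y)}"
abbreviation "without_corner \<equiv> H \<union> U \<times> {x} \<union> {y} \<times> W"

lemma bridge_linkable_remove: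
  assumes S: "x \<notin> S" "y \<notin> S" "z \<notin> S" and T: "z \<notin> T"
    and link: "linkable with_corner (insert x S) T" (is "linkable ?E1 ?S1 T")
  shows "linkable without_corner (insert y S) T \<or>
     x \<in> T \<and> y \<notin> T \<and> linkable without_corner (insert y S) (insert y (T - {x}))"
    (is "linkable ?E2 ?S2 T \<or> x \<in> T \<and> y \<notin> T \<and> linkable ?E2 ?S2 ?T'")
proof -
  obtain F where "linked_arcs ?E1 F ?S1 T" using link by (rule linkableE)
  then interpret L: linked_arcs ?E1 F ?S1 T .
  have arcs: "\<And>v. (v, x) \<notin> F" "\<And>v. (y, v) \<notin> F" "\<And>v. v \<noteq> z \<Longrightarrow> (x, v) \<notin> F" "\<And>v. v \<noteq> z \<Longrightarrow> (v, y) \<notin> F"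
    "\<And>v. v \<notin> U \<Longrightarrow> v \<noteq> x \<Longrightarrow> (v, z) \<notin> F" "\<And>v. v \<notin> W \<Longrightarrow> v \<noteq> y \<Longrightarrow> (z, v) \<notin> F"
    using L.subset H UW distinct by auto
  have fld: "x \<notin> Range F" "y \<notin> Domain F" using arcs(1,2) by blast+
  show ?thesis
  proof (cases "z \<in> Domain F")
    case False
    then have "z \<notin> Range F" using L.flow[of z] T by blast
    then have "F \<subseteq> H" using L.subset False by auto
    then have fld': "x \<notin> Domain F" "y \<notin> Range F" using H by auto
    have T': "x \<in> T" "y \<notin> T" using L.flow[of x] L.flow[of y] S distinct fld fld' by simp_all
    moreover have "linking ?E2 ?S2 ?T' F"
      unfolding linking_def
    proof (intro conjI allI)
      show "F \<subseteq> ?E2" using \<open>F \<subseteq> H\<close> by auto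
      fix v
      show "v \<in> ?S2 \<or> v \<in> Range F \<longleftrightarrow> v \<in> ?T' \<or> v \<in> Domain F"
        using L.flow[of v] S distinct fld fld' by (cases "v = x"; cases "v = y") simp_all
      show "\<not> (v \<in> ?S2 \<and> v \<in> Range F)"
        using L.disjoint(1)[of v] fld' by (cases "v = y") auto
      show "\<not> (v \<in> ?T' \<and> v \<in> Domain F)"
        using L.disjoint(2)[of v] fld by (cases "v = y") simp_all
    qed (use L.link in \<open>auto simp: linking_def\<close>)
    ultimately show ?thesis unfolding linkable_def by auto
  next
    case True
    then have "z \<in> Range F" using L.flow[of z] T S distinct by simp
    then obtain p where p: "(p, z) \<in> F" by auto
    from True obtain q where q: "(z, q) \<in> F" by auto
    have uniq: "(v, z) \<in> F \<longleftrightarrow> v = p" "(z, v) \<in> F \<longleftrightarrow> v = q"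
      "(p, v) \<in> F \<longleftrightarrow> v = z" "(v, q) \<in> F \<longleftrightarrow> v = z" for v
      using L.inj p q by blast+
    have pq: "p \<in> U \<or> p = x" "q \<in> W \<or> q = y" using p q arcs(5,6) by blast+
    then have pq': "p \<noteq> y" "p \<noteq> z" "q \<noteq> x" "q \<noteq> z" using UW distinct by auto
    have dom_x: "x \<in> Domain F \<longleftrightarrow> p = x" using arcs(3) uniq(1)[of x] by (metis Domain_iff)
    have ran_y: "y \<in> Range F \<longleftrightarrow> q = y" using arcs(4) uniq(2)[of y] by (metis Range_iff)
    let ?F = "remove_corner F"
    have mem: "(u, v) \<in> ?F \<longleftrightarrow> (u, v) \<in> F \<and> u \<noteq> x \<and> u \<noteq> z \<and> v \<noteq> y \<and> v \<noteq> z \<or>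
        v = x \<and> u = p \<and> p \<noteq> x \<or> u = y \<and> v = q \<and> q \<noteq> y" for u v
    proof -
      have "(u, v) \<in> H \<and> (u, v) \<in> F \<longleftrightarrow> (u, v) \<in> F \<and> u \<noteq> x \<and> u \<noteq> z \<and> v \<noteq> y \<and> v \<noteq> z"
        using L.subset H[of u v] arcs(1,2) by auto
      then show ?thesis unfolding remove_corner_def uniq using pq UW by auto
    qed
    have Ran: "x \<in> Range ?F \<longleftrightarrow> p \<noteq> x" "y \<notin> Range ?F" "z \<notin> Range ?F"
      unfolding Range_iff mem using distinct pq' arcs(1) by auto
    have Ran': "v \<in> Range ?F \<longleftrightarrow> v \<in> Range F" if v: "v \<noteq> x" "v \<noteq> y" "v \<noteq> z" for v
    proof -
      have "\<exists>u. (u, v) \<in> ?F" if u: "(u, v) \<in> F" for u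
        using u v arcs(3)[of v] uniq(2)[of v] unfolding mem by (cases "u = x"; cases "u = z") auto
      moreover have "\<exists>u. (u, v) \<in> F" if u: "(u, v) \<in> ?F" for u
        using u v q unfolding mem by auto
      ultimately show ?thesis by blast
    qed
    have Dom: "y \<in> Domain ?F \<longleftrightarrow> q \<noteq> y" "x \<notin> Domain ?F" "z \<notin> Domain ?F"
      unfolding Domain_iff mem using distinct pq' arcs(2) by auto
    have Dom': "v \<in> Domain ?F \<longleftrightarrow> v \<in> Domain F" if v: "v \<noteq> x" "v \<noteq> y" "v \<noteq> z" for v
    proof -
      have "\<exists>w. (v, w) \<in> ?F" if w: "(v, w) \<in> F" for w
        using w v arcs(4)[of v] uniq(1)[of v] unfolding mem by (cases "w = y"; cases "w = z") auto
      moreover have "\<exists>w. (v, w) \<in> F" if w: "(v, w) \<in> ?F" for w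
        using w v p unfolding mem by auto
      ultimately show ?thesis by blast
    qed
    have xT: "x \<in> T \<longleftrightarrow> p \<noteq> x" using L.flow[of x] L.disjoint(2)[of x] dom_x by blast
    have yT: "y \<in> T \<longleftrightarrow> q = y" using L.flow[of y] S distinct ran_y fld by simp
    have "linking ?E2 ?S2 T ?F"
      unfolding linking_def
    proof (intro conjI allI)
      show "?F \<subseteq> ?E2" by (auto simp: remove_corner_def)
      show "single_valued ?F"
      proof (rule single_valuedI)
        fix u v w assume "(u, v) \<in> ?F" "(u, w) \<in> ?F"
        then show "v = w" unfolding mem using uniq(3) arcs(2) pq' by (elim disjE conjE) (simp_all, blast dest: L.inj)
      qed
      show "single_valued (?F\<inverse>)"
      proof (rule single_valuedI)
        fix u v w assume "(u, v) \<in> ?F\<inverse>" "(u, w) \<in> ?F\<inverse>"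
        then show "v = w" unfolding mem converse_iff using uniq(4) arcs(1) pq' by (elim disjE conjE) (simp_all, blast dest: L.inj)
      qed
      fix v
      show "v \<in> ?S2 \<or> v \<in> Range ?F \<longleftrightarrow> v \<in> T \<or> v \<in> Domain ?F"
        using L.flow[of v] xT yT S T distinct Ran Dom Ran'[of v] Dom'[of v]
        by (cases "v = x"; cases "v = y"; cases "v = z") simp_all
      show "\<not> (v \<in> ?S2 \<and> v \<in> Range ?F)"
        using L.disjoint(1)[of v] S distinct Ran Ran'[of v]
        by (cases "v = x"; cases "v = y"; cases "v = z") simp_all
      show "\<not> (v \<in> T \<and> v \<in> Domain ?F)"
        using L.disjoint(2)[of v] yT T Dom Dom'[of v] distinct
        by (cases "v = x"; cases "v = y"; cases "v = z") simp_all
    qed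
    then show ?thesis unfolding linkable_def by auto
  qed
qed

text \<open>The two ends can always be glued at \<open>z\<close>: what enters \<open>x\<close>, or
  \<open>x\<close> itself if nothing does, is led into \<open>z\<close>, and from there to the
  successor of \<open>y\<close>, or to \<open>y\<close> itself if it has none.\<close>

lemma bridge_linkable_restore:
  assumes S: "x \<notin> S" "y \<notin> S" "z \<notin> S" and T: "z \<notin> T"
    and link: "linkable without_corner (insert y S) T" (is "linkable ?E2 ?S2 T")
  shows "linkable with_corner (insert x S) T" (is "linkable ?E1 ?S1 T")
proof -
  obtain F where "linked_arcs ?E2 F ?S2 T" using link by (rule linkableE)
  then interpret L: linked_arcs ?E2 F ?S2 T .
  have arcs: "\<And>v. (v, y) \<notin> F" "\<And>v. (x, v) \<notin> F" "\<And>v. (v, z) \<notin> F" "\<And>v. (z, v) \<notin> F"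
    "(y, x) \<notin> F"
    using L.subset H UW distinct by auto
  have arcs': "(v, x) \<in> F \<Longrightarrow> v \<in> U" "(y, v) \<in> F \<Longrightarrow> v \<in> W" for v
    using L.subset H UW distinct by auto
  have fld: "y \<notin> Range F" "x \<notin> Domain F" "z \<notin> Range F" "z \<notin> Domain F" using arcs(1-4) by blast+
  let ?F = "restore_corner ({e. e = (x, z) \<and> x \<notin> Range F} \<union> {e. e = (z, y) \<and> y \<notin> Domain F}) F"
  have mem: "(u, v) \<in> ?F \<longleftrightarrow> (u, v) \<in> F \<and> v \<noteq> x \<and> u \<noteq> y \<or> v = z \<and> (u, x) \<in> F \<or> u = z \<and> (y, v) \<in> F \<or>
      u = x \<and> v = z \<and> x \<notin> Range F \<or> u = z \<and> v = y \<and> y \<notin> Domain F" for u v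
  proof -
    have "(u, v) \<in> F \<and> (u, v) \<in> H \<longleftrightarrow> (u, v) \<in> F \<and> v \<noteq> x \<and> u \<noteq> y"
      using L.subset H by auto
    then show ?thesis unfolding restore_corner_def by auto
  qed
  have Ran: "x \<notin> Range ?F" "y \<in> Range ?F \<longleftrightarrow> y \<notin> Domain F"
    unfolding Range_iff[of _ ?F] mem using arcs distinct by auto
  have Ran_z: "z \<in> Range ?F"
    unfolding Range_iff[of _ ?F] mem by (cases "x \<in> Range F") auto
  have Ran': "v \<in> Range ?F \<longleftrightarrow> v \<in> Range F" if v: "v \<noteq> x" "v \<noteq> y" "v \<noteq> z" for v
  proof -
    have "\<exists>u. (u, v) \<in> ?F" if u: "(u, v) \<in> F" for u
      using u v unfolding mem by (cases "u = y") auto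
    moreover have "\<exists>u. (u, v) \<in> F" if u: "(u, v) \<in> ?F" for u
      using u v unfolding mem by auto
    ultimately show ?thesis by blast
  qed
  have Dom: "y \<notin> Domain ?F" "x \<in> Domain ?F \<longleftrightarrow> x \<notin> Range F"
    unfolding Domain_iff[of _ ?F] mem using arcs distinct by auto
  have Dom_z: "z \<in> Domain ?F"
    unfolding Domain_iff[of _ ?F] mem by (cases "y \<in> Domain F") auto
  have Dom': "v \<in> Domain ?F \<longleftrightarrow> v \<in> Domain F" if v: "v \<noteq> x" "v \<noteq> y" "v \<noteq> z" for v
  proof -
    have "\<exists>w. (v, w) \<in> ?F" if w: "(v, w) \<in> F" for w
      using w v unfolding mem by (cases "w = x") auto
    moreover have "\<exists>w. (v, w) \<in> F" if w: "(v, w) \<in> ?F" for w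
      using w v unfolding mem by auto
    ultimately show ?thesis by blast
  qed
  have xT: "x \<in> T \<longleftrightarrow> x \<in> Range F" using L.flow[of x] S distinct fld by simp
  have yT: "y \<in> T \<longleftrightarrow> y \<notin> Domain F" using L.flow[of y] L.disjoint(2)[of y] by blast
  have "linking ?E1 ?S1 T ?F"
    unfolding linking_def
  proof (intro conjI allI)
    show "?F \<subseteq> ?E1" unfolding restore_corner_def using arcs' by blast
    show "single_valued ?F"
    proof (rule single_valuedI)
      fix u v w assume "(u, v) \<in> ?F" "(u, w) \<in> ?F"
      then show "v = w" unfolding mem using arcs distinct by (elim disjE conjE) (simp_all, (blast dest: L.inj)+)
    qed
    show "single_valued (?F\<inverse>)"
    proof (rule single_valuedI)
      fix u v w assume "(u, v) \<in> ?F\<inverse>" "(u, w) \<in> ?F\<inverse>"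
      then show "v = w" unfolding mem converse_iff using arcs distinct by (elim disjE conjE) (simp_all, (blast dest: L.inj)+)
    qed
    fix v
    show "v \<in> ?S1 \<or> v \<in> Range ?F \<longleftrightarrow> v \<in> T \<or> v \<in> Domain ?F"
      using L.flow[of v] xT yT S T distinct Ran Ran_z Dom Dom_z Ran'[of v] Dom'[of v]
      by (cases "v = x"; cases "v = y"; cases "v = z") simp_all
    show "\<not> (v \<in> ?S1 \<and> v \<in> Range ?F)"
      using L.disjoint(1)[of v] S distinct Ran Ran'[of v]
      by (cases "v = x"; cases "v = y"; cases "v = z") simp_all
    show "\<not> (v \<in> T \<and> v \<in> Domain ?F)"
      using L.disjoint(2)[of v] xT T Dom Dom'[of v] distinct
      by (cases "v = x"; cases "v = y"; cases "v = z") simp_all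
  qed
  then show ?thesis unfolding linkable_def by auto
qed

text \<open>After the removal \<open>y\<close> is both start and destination and \<open>x\<close> is
  neither, so no arc of the linking meets them. The trivial path at \<open>y\<close> is traded for
  one at \<open>x\<close>.\<close>

lemma bridge_linkable_restore_idle:
  assumes S: "x \<notin> S" "y \<notin> S" "z \<notin> S" and T: "x \<in> T" "y \<notin> T"
    and link: "linkable without_corner (insert y S) (insert y (T - {x}))" (is "linkable ?E2 ?S2 ?T'")
  shows "linkable with_corner (insert x S) T" (is "linkable ?E1 ?S1 T")
proof -
  obtain F where "linked_arcs ?E2 F ?S2 ?T'" using link by (rule linkableE)
  then interpret L: linked_arcs ?E2 F ?S2 ?T' .
  have y: "y \<notin> Domain F" "y \<notin> Range F" using L.disjoint(1)[of y] L.disjoint(2)[of y] by simp_all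
  have "x \<notin> Domain F" using L.subset H UW distinct by auto
  then have x: "x \<notin> Domain F" "x \<notin> Range F" using L.flow[of x] distinct by simp_all
  have "linking ?E1 ?S1 T F"
    unfolding linking_def
  proof (intro conjI allI)
    show "F \<subseteq> ?E1" using L.subset x y by auto
    fix v
    show "v \<in> ?S1 \<or> v \<in> Range F \<longleftrightarrow> v \<in> T \<or> v \<in> Domain F"
      using L.flow[of v] T x y S distinct by (cases "v = x"; cases "v = y") simp_all
    show "\<not> (v \<in> ?S1 \<and> v \<in> Range F)" using L.disjoint(1)[of v] x by (cases "v = x") auto
    show "\<not> (v \<in> T \<and> v \<in> Domain F)" using L.disjoint(2)[of v] x y by (cases "v = x") auto
  qed (use L.link in \<open>auto simp: linking_def\<close>)
  then show ?thesis unfolding linkable_def by auto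
qed

lemma bridge_linkable:
  assumes "x \<notin> S" "y \<notin> S" "z \<notin> S" "z \<notin> T"
  shows "linkable with_corner (insert x S) T \<longleftrightarrow>
     linkable without_corner (insert y S) T \<or>
     x \<in> T \<and> y \<notin> T \<and> linkable without_corner (insert y S) (insert y (T - {x}))"
  using bridge_linkable_remove[OF assms] bridge_linkable_restore[OF assms]
    bridge_linkable_restore_idle[OF assms(1-3)] by blast

end

lemma linkable_ends:
  assumes "linkable E S T"
  shows "v \<in> T \<Longrightarrow> v \<in> S \<or> v \<in> Range E" "v \<in> S \<Longrightarrow> v \<in> T \<or> v \<in> Domain E"
proof -
  obtain F where "linked_arcs E F S T" using assms by (rule linkableE)
  then interpret linked_arcs E F S T .
  have "Range F \<subseteq> Range E" "Domain F \<subseteq> Domain E" using subset by auto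
  then show "v \<in> T \<Longrightarrow> v \<in> S \<or> v \<in> Range E" "v \<in> S \<Longrightarrow> v \<in> T \<or> v \<in> Domain E"
    using flow[of v] by (meson subsetD)+
qed

text \<open>In each alternative no strand can run through the arc: its tail is a destination, or its
  tail cannot be reached, or its head is a dead end that is not a destination.\<close>

lemma linkable_useless_arc:
  assumes "u \<noteq> v" and useless: "u \<in> T \<or> u \<notin> S \<and> u \<notin> Range E \<or> v \<notin> T \<and> v \<notin> Domain E"
  shows "linkable (insert (u, v) E) S T \<longleftrightarrow> linkable E S T"
proof
  assume "linkable (insert (u, v) E) S T"
  then obtain F where "linked_arcs (insert (u, v) E) F S T" by (rule linkableE)
  then interpret L: linked_arcs "insert (u, v) E" F S T .
  have "(u, v) \<notin> F"
  proof
    assume "(u, v) \<in> F"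
    then have F: "u \<in> Domain F" "v \<in> Range F" by auto
    have "Range F \<subseteq> insert v (Range E)" "Domain F \<subseteq> insert u (Domain E)" using L.subset by auto
    then have "u \<in> S \<or> u \<in> Range E" "v \<in> T \<or> v \<in> Domain E"
      using F L.flow[of u] L.flow[of v] assms(1) by (metis insertE subsetD)+
    then show False using useless F(1) L.disjoint(2)[of u] by metis
  qed
  with L.subset have "F \<subseteq> E" by auto
  then have "linking E S T F" using L.link unfolding linking_def by (elim conjE) (intro conjI)
  then show "linkable E S T" unfolding linkable_def ..
next
  assume "linkable E S T"
  then obtain F where "linked_arcs E F S T" by (rule linkableE)
  then interpret L: linked_arcs E F S T .
  have "F \<subseteq> insert (u, v) E" using L.subset by auto
  then have "linking (insert (u, v) E) S T F" using L.link unfolding linking_def by (elim conjE) (intro conjI)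
  then show "linkable (insert (u, v) E) S T" unfolding linkable_def ..
qed

context corner_surgery
begin

text \<open>The case that \<open>y\<close> carries a loop, so that nothing comes down to
  \<open>z\<close>. Missing arcs at \<open>z\<close> can be added because they are useless, which
  reduces the claim to \<open>bridge_linkable\<close>. Nothing enters \<open>x\<close> after the
  removal, so whether \<open>x\<close> is a destination decides between the two alternatives
  there.\<close>

lemma loop_linkable:
  assumes S: "x \<notin> S" "y \<notin> S" "z \<notin> S" and T: "z \<notin> T" "y \<notin> T"
    and P: "P \<subseteq> {(x, z)}" "W \<noteq> {} \<Longrightarrow> P = {(x, z)}" and U: "U = {}"
  shows "linkable (H \<union> {z} \<times> W \<union> P) (insert x S) T \<longleftrightarrow>
     linkable (H \<union> {y} \<times> W) (insert y S) (transpose x y ` T)"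
proof -
  let ?E = "H \<union> {z} \<times> W" and ?E2 = "H \<union> {y} \<times> W"
  have avoid: "z \<notin> Domain H" "y \<notin> Domain H" "x \<notin> Range H" using H by auto
  have "linkable (?E \<union> P) (insert x S) T \<longleftrightarrow> linkable (insert (x, z) ?E) (insert x S) T"
  proof (cases "W = {}")
    case True
    then have "linkable (insert (x, z) ?E) (insert x S) T \<longleftrightarrow> linkable ?E (insert x S) T"
      using avoid T distinct by (intro linkable_useless_arc) auto
    moreover have "P = {} \<or> P = {(x, z)}" using P(1) by blast
    ultimately show ?thesis by auto
  qed (use P(2) in simp)
  also have "\<dots> \<longleftrightarrow> linkable (insert (z, y) (insert (x, z) ?E)) (insert x S) T"
    using avoid T distinct by (intro linkable_useless_arc[symmetric]) auto
  also have "insert (z, y) (insert (x, z) ?E) = with_corner"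
    unfolding U by auto
  also have "linkable \<dots> (insert x S) T \<longleftrightarrow> linkable ?E2 (insert y S) T \<or>
      x \<in> T \<and> linkable ?E2 (insert y S) (insert y (T - {x}))"
    using bridge_linkable[OF S T(1)] T(2) U by simp
  also have "\<dots> \<longleftrightarrow> linkable ?E2 (insert y S) (transpose x y ` T)"
  proof (cases "x \<in> T")
    case True
    have "x \<notin> Range ?E2" using avoid UW by auto
    then have "\<not> linkable ?E2 (insert y S) T"
      using linkable_ends(1)[of ?E2 "insert y S" T x] True S distinct by blast
    moreover have "transpose x y ` T = insert y (T - {x})"
      using True T(2) by (force simp: transpose_def image_iff)
    ultimately show ?thesis using True by simp
  next
    case False
    then have "transpose x y ` T = T" using T(2) by (force simp: transpose_def image_iff)
    then show ?thesis using False by simp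
  qed
  finally show ?thesis .
qed

text \<open>The mirror image: a coloop at \<open>x\<close> leaves no way from \<open>z\<close> to
  the left, and \<open>(x, z)\<close> is useless because \<open>x\<close> is a destination. Nothing
  leaves \<open>y\<close> after the removal, so whether \<open>y\<close> is a destination decides
  between the alternatives.\<close>

lemma coloop_linkable:
  assumes S: "x \<notin> S" "y \<notin> S" "z \<notin> S" and T: "z \<notin> T" "x \<in> T"
    and P: "P \<subseteq> {(z, y)}" "U \<noteq> {} \<Longrightarrow> P = {(z, y)}" and W: "W = {}"
  shows "linkable (H \<union> U \<times> {z} \<union> P) (insert x S) T \<longleftrightarrow>
     linkable (H \<union> U \<times> {x}) (insert y S) (transpose x y ` T)"
proof -
  let ?E = "H \<union> U \<times> {z}" and ?E2 = "H \<union> U \<times> {x}"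
  have avoid: "z \<notin> Range H" "y \<notin> Domain H" using H by auto
  have "linkable (?E \<union> P) (insert x S) T \<longleftrightarrow> linkable (insert (z, y) ?E) (insert x S) T"
  proof (cases "U = {}")
    case True
    then have "linkable (insert (z, y) ?E) (insert x S) T \<longleftrightarrow> linkable ?E (insert x S) T"
      using avoid S distinct by (intro linkable_useless_arc) auto
    moreover have "P = {} \<or> P = {(z, y)}" using P(1) by blast
    ultimately show ?thesis by auto
  qed (use P(2) in simp)
  also have "\<dots> \<longleftrightarrow> linkable (insert (x, z) (insert (z, y) ?E)) (insert x S) T"
    using T distinct by (intro linkable_useless_arc[symmetric]) auto
  also have "insert (x, z) (insert (z, y) ?E) = with_corner"
    unfolding W by auto
  also have "linkable \<dots> (insert x S) T \<longleftrightarrow> linkable ?E2 (insert y S) T \<or>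
      y \<notin> T \<and> linkable ?E2 (insert y S) (insert y (T - {x}))"
    using bridge_linkable[OF S T(1)] T(2) W by simp
  also have "\<dots> \<longleftrightarrow> linkable ?E2 (insert y S) (transpose x y ` T)"
  proof (cases "y \<in> T")
    case False
    have "y \<notin> Domain ?E2" using avoid UW by auto
    then have "\<not> linkable ?E2 (insert y S) T"
      using linkable_ends(2)[of ?E2 "insert y S" T y] False by blast
    moreover have "transpose x y ` T = insert y (T - {x})"
      using False T(2) by (force simp: transpose_def image_iff)
    ultimately show ?thesis using False by simp
  next
    case True
    then have "transpose x y ` T = T" using T(2) by (force simp: transpose_def image_iff)
    then show ?thesis using True by simp
  qed
  finally show ?thesis .
qed

end

section \<open>Minors of a totally nonnegative configuration\<close>

definition coldet :: "nat \<Rightarrow> (nat \<Rightarrow> nat \<Rightarrow> real) \<Rightarrow> real" where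
  "coldet k c = det (mat k k (\<lambda>(s, j). c j s))"

definition minor :: "nat \<Rightarrow> (nat \<Rightarrow> nat \<Rightarrow> real) \<Rightarrow> nat list \<Rightarrow> real" where
  "minor k f xs = coldet k (\<lambda>j. f (xs ! j))"

lemma coldet_cong: "(\<And>j. j < k \<Longrightarrow> c j = d j) \<Longrightarrow> coldet k c = coldet k d"
  unfolding coldet_def by (intro arg_cong[where f = det] eq_matI) auto

definition col_cofactor :: "nat \<Rightarrow> (nat \<Rightarrow> nat \<Rightarrow> real) \<Rightarrow> nat \<Rightarrow> nat \<Rightarrow> real" where
  "col_cofactor k c p s = cofactor (mat k k (\<lambda>(s, j). c j s)) s p"

lemma coldet_expand:
  assumes "p < k"
  shows "coldet k (c(p := v)) = (\<Sum>s<k. v s * col_cofactor k c p s)"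
proof -
  let ?A = "mat k k (\<lambda>(s, j). (c(p := v)) j s)"
  let ?B = "mat k k (\<lambda>(s, j). c j s)"
  have "coldet k (c(p := v)) = (\<Sum>s<k. ?A $$ (s, p) * cofactor ?A s p)"
    unfolding coldet_def using assms by (intro laplace_expansion_column[of _ k]) auto
  also have "\<dots> = (\<Sum>s<k. v s * cofactor ?B s p)"
  proof (intro sum.cong refl)
    fix s assume s: "s \<in> {..<k}"
    have "mat_delete ?A s p = mat_delete ?B s p"
      using assms s by (intro eq_matI) (auto simp: mat_delete_def)
    then show "?A $$ (s, p) * cofactor ?A s p = v s * cofactor ?B s p"
      using assms s by (simp add: cofactor_def)
  qed
  finally show ?thesis unfolding col_cofactor_def .
qed

text \<open>Cramer's rule cleared of denominators: expand each determinant along the replaced column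
  and recognise the product of the matrix with its adjugate.\<close>

lemma coldet_cramer:
  assumes "r < k"
  shows "coldet k w * v r = (\<Sum>j<k. coldet k (w(j := v)) * w j r)"
proof -
  let ?A = "mat k k (\<lambda>(s, j). w j s)"
  have A: "?A \<in> carrier_mat k k" by simp
  have "(\<Sum>j<k. coldet k (w(j := v)) * w j r) = (\<Sum>j<k. \<Sum>s<k. v s * col_cofactor k w j s * w j r)"
    by (intro sum.cong refl) (simp add: coldet_expand sum_distrib_right)
  also have "\<dots> = (\<Sum>s<k. v s * (\<Sum>j<k. w j r * col_cofactor k w j s))"
    by (subst sum.swap) (simp add: sum_distrib_left mult_ac)
  also have "\<dots> = (\<Sum>s<k. v s * (if r = s then coldet k w else 0))"
  proof (intro sum.cong refl)
    fix s assume "s \<in> {..<k}"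
    then have s: "s < k" by simp
    have "(\<Sum>j<k. w j r * col_cofactor k w j s) = (?A * adj_mat ?A) $$ (r, s)"
      using s assms by (auto simp: adj_mat_def scalar_prod_def col_cofactor_def lessThan_atLeast0 intro!: sum.cong)
    also have "\<dots> = (if r = s then coldet k w else 0)"
      unfolding adj_mat(2)[OF A] using s assms by (simp add: coldet_def)
    finally show "v s * (\<Sum>j<k. w j r * col_cofactor k w j s) = v s * (if r = s then coldet k w else 0)"
      by simp
  qed
  also have "\<dots> = (\<Sum>s<k. if r = s then v s * coldet k w else 0)"
    by (intro sum.cong) auto
  also have "\<dots> = coldet k w * v r" using assms by simp
  finally show ?thesis by simp
qed

text \<open>Expand the first determinant along its column \<open>p\<close> and express that column
  through the columns of \<open>w\<close> by \<open>coldet_cramer\<close>. Being free of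
  denominators, the identity covers dependent columns as well.\<close>

lemma coldet_exchange:
  assumes "p < k"
  shows "coldet k v * coldet k w = (\<Sum>j<k. coldet k (v(p := w j)) * coldet k (w(j := v p)))"
proof -
  have expand: "coldet k v = (\<Sum>s<k. v p s * col_cofactor k v p s)"
    using coldet_expand[OF assms, of v "v p"] by simp
  have "coldet k v * coldet k w = (\<Sum>s<k. col_cofactor k v p s * (coldet k w * v p s))"
    unfolding expand sum_distrib_right by (rule sum.cong[OF refl]) (simp add: mult_ac)
  also have "\<dots> = (\<Sum>s<k. col_cofactor k v p s * (\<Sum>j<k. coldet k (w(j := v p)) * w j s))"
    by (intro sum.cong refl) (simp add: coldet_cramer[where w = w and v = "v p"])
  also have "\<dots> = (\<Sum>s<k. \<Sum>j<k. coldet k (w(j := v p)) * (w j s * col_cofactor k v p s))"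
    by (simp add: sum_distrib_left mult_ac)
  also have "\<dots> = (\<Sum>j<k. coldet k (w(j := v p)) * (\<Sum>s<k. w j s * col_cofactor k v p s))"
    by (subst sum.swap) (simp add: sum_distrib_left)
  also have "\<dots> = (\<Sum>j<k. coldet k (v(p := w j)) * coldet k (w(j := v p)))"
    using assms by (simp add: coldet_expand mult_ac)
  finally show ?thesis .
qed

lemma minor_update: "length xs = k \<Longrightarrow> p < k \<Longrightarrow> minor k f (xs[p := b]) = coldet k ((\<lambda>j. f (xs ! j))(p := f b))"
  unfolding minor_def by (rule coldet_cong) (auto simp: nth_list_update)

lemma minor_exchange:
  assumes "length xs = k" "length ys = k" "p < k"
  shows "minor k f xs * minor k f ys =
    (\<Sum>j<k. minor k f (xs[p := ys ! j]) * minor k f (ys[j := xs ! p]))"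
  using coldet_exchange[OF assms(3), of "\<lambda>j. f (xs ! j)" "\<lambda>j. f (ys ! j)"] assms
  by (simp add: minor_update minor_def[of k f xs] minor_def[of k f ys])

lemma minor_repeated:
  assumes "length xs = k" "\<not> distinct xs"
  shows "minor k f xs = 0"
proof -
  obtain a b where ab: "a < k" "b < k" "a \<noteq> b" "xs ! a = xs ! b"
    using assms by (auto simp: distinct_conv_nth)
  show ?thesis unfolding minor_def coldet_def
    by (rule det_identical_columns[OF _ ab(3,1,2)]) (use ab in \<open>auto intro!: eq_vecI\<close>)
qed

lemma minor_swap_adjacent:
  assumes "length (us @ a # b # vs) = k"
  shows "minor k f (us @ a # b # vs) = - minor k f (us @ b # a # vs)"
proof -
  let ?m = "length us"
  let ?B = "mat k k (\<lambda>(s, j). f ((us @ b # a # vs) ! j) s)"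
  have "det (swapcols ?m (Suc ?m) ?B) = - det ?B"
    by (rule det_swapcols[of _ k]) (use assms in auto)
  moreover have "swapcols ?m (Suc ?m) ?B = mat k k (\<lambda>(s, j). f ((us @ a # b # vs) ! j) s)"
  proof (rule eq_matI)
    fix s j assume "s < dim_row (mat k k (\<lambda>(s, j). f ((us @ a # b # vs) ! j) s))"
      "j < dim_col (mat k k (\<lambda>(s, j). f ((us @ a # b # vs) ! j) s))"
    then show "swapcols ?m (Suc ?m) ?B $$ (s, j) = mat k k (\<lambda>(s, j). f ((us @ a # b # vs) ! j) s) $$ (s, j)"
      using assms by (auto simp: nth_append nth_Cons' )
  qed auto
  ultimately show ?thesis by (simp add: minor_def coldet_def)
qed

lemma minor_move:
  assumes "length (us @ a # vs @ ws) = k"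
  shows "minor k f (us @ a # vs @ ws) = (-1) ^ length vs * minor k f (us @ vs @ a # ws)"
  using assms
proof (induction vs arbitrary: us)
  case (Cons v vs)
  have "minor k f (us @ a # (v # vs) @ ws) = - minor k f (us @ v # a # vs @ ws)"
    using minor_swap_adjacent[of us a v "vs @ ws" k f] Cons.prems by simp
  also have "minor k f (us @ v # a # vs @ ws) = (-1) ^ length vs * minor k f (us @ v # vs @ a # ws)"
    using Cons.IH[of "us @ [v]"] Cons.prems by simp
  finally show ?case by simp
qed simp

text \<open>Reordering columns changes only the sign. For the matroid just the vanishing of a minor
  matters, so signs of permutations need not be tracked.\<close>

lemma minor_abs_mset:
  assumes "length xs = k" "mset xs = mset ys"
  shows "\<bar>minor k f xs\<bar> = \<bar>minor k f ys\<bar>"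
proof -
  have "\<bar>minor k f (us @ xs)\<bar> = \<bar>minor k f (us @ ys)\<bar>"
    if "mset xs = mset ys" "length (us @ xs) = k" for us
    using that
  proof (induction xs arbitrary: ys us)
    case (Cons x xs)
    then have "x \<in> set ys" by (metis list.set_intros(1) mset_eq_setD)
    then obtain vs ws where ys: "ys = vs @ x # ws" by (auto simp: in_set_conv_decomp)
    have len: "length (us @ ys) = k"
      using Cons.prems by (metis length_append mset_eq_length)
    have "\<bar>minor k f (us @ ys)\<bar> = \<bar>minor k f (us @ x # vs @ ws)\<bar>"
      using minor_move[of us x vs ws k f] len ys by (simp add: abs_mult power_abs)
    also have "\<dots> = \<bar>minor k f ((us @ [x]) @ vs @ ws)\<bar>" by simp
    also have "\<dots> = \<bar>minor k f ((us @ [x]) @ xs)\<bar>"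
      using Cons.IH[of "vs @ ws" "us @ [x]"] Cons.prems ys by simp
    finally show ?case by simp
  qed simp
  from this[of "[]"] assms show ?thesis by simp
qed

section \<open>Minors indexed by sets and their support\<close>

definition sminor :: "nat \<Rightarrow> (nat \<Rightarrow> nat \<Rightarrow> real) \<Rightarrow> nat set \<Rightarrow> real" where
  "sminor k f J = minor k f (sorted_list_of_set J)"

definition support :: "nat \<Rightarrow> nat \<Rightarrow> (nat \<Rightarrow> nat \<Rightarrow> real) \<Rightarrow> nat set set" where
  "support n k f = {J \<in> nsets {1..n} k. sminor k f J \<noteq> 0}"

lemma sminor_nonzero_iff:
  assumes "distinct xs" "length xs = k"
  shows "sminor k f (set xs) \<noteq> 0 \<longleftrightarrow> minor k f xs \<noteq> 0"
proof -
  have "mset xs = mset (sorted_list_of_set (set xs))"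
    using assms(1) by (simp add: set_eq_iff_mset_eq_distinct[symmetric])
  from minor_abs_mset[OF assms(2) this, of f] show ?thesis by (auto simp: sminor_def)
qed

text \<open>A nonzero product of two minors equals the sum in \<open>minor_exchange\<close>, so some
  summand is nonzero, and its two factors are the two new bases at once. An entry \<open>b\<close>
  already in \<open>J\<close> would repeat a column.\<close>

lemma support_exchange: "basis_exchange (support n k f)"
  unfolding basis_exchange_def
proof (intro ballI)
  fix J K a assume J: "J \<in> support n k f" and K: "K \<in> support n k f" and a: "a \<in> J - K"
  let ?xs = "sorted_list_of_set J" let ?ys = "sorted_list_of_set K"
  have fin: "finite J" "finite K" "card J = k" "card K = k" "J \<subseteq> {1..n}" "K \<subseteq> {1..n}"
    using J K by (auto simp: support_def nsets_def)
  then have len: "length ?xs = k" "length ?ys = k" by auto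
  obtain p where p: "p < k" "?xs ! p = a"
    using a fin len by (metis DiffD1 in_set_conv_nth set_sorted_list_of_set)
  have "minor k f ?xs * minor k f ?ys \<noteq> 0" using J K by (auto simp: support_def sminor_def)
  then obtain j where j: "j < k" "minor k f (?xs[p := ?ys ! j]) \<noteq> 0" "minor k f (?ys[j := a]) \<noteq> 0"
    unfolding minor_exchange[OF len p(1)] p(2)
    by (metis (no_types, lifting) lessThan_iff mult_not_zero sum.not_neutral_contains_not_neutral)
  define b where "b = ?ys ! j"
  have bK: "b \<in> K" using j(1) fin len by (metis b_def nth_mem set_sorted_list_of_set)
  have dist: "distinct (?xs[p := b])" "distinct (?ys[j := a])"
    using j minor_repeated[of "?xs[p := b]"] minor_repeated[of "?ys[j := a]"] len b_def by auto
  have set1: "set (?xs[p := b]) = insert b (J - {a})"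
    using set_update_distinct[of ?xs p b] p len fin by simp
  have set2: "set (?ys[j := a]) = insert a (K - {b})"
    using set_update_distinct[of ?ys j a] j(1) len fin b_def by simp
  have "b \<notin> J"
  proof
    assume "b \<in> J"
    moreover have "b \<noteq> a" using bK a by auto
    ultimately have "set (?xs[p := b]) = J - {a}" using set1 by auto
    moreover have "card (J - {a}) < card J" using a fin(1) by (intro card_Diff1_less) auto
    ultimately show False using distinct_card[OF dist(1)] len fin(3) by simp
  qed
  moreover have "insert b (J - {a}) \<in> support n k f"
    using sminor_nonzero_iff[OF dist(1), of k f] len j(2) set1 b_def distinct_card[OF dist(1)] bK fin
    by (auto simp: support_def nsets_def)
  moreover have "insert a (K - {b}) \<in> support n k f"
    using sminor_nonzero_iff[OF dist(2), of k f] len j(3) set2 distinct_card[OF dist(2)] a fin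
    by (auto simp: support_def nsets_def)
  ultimately show "\<exists>b\<in>K - J. insert b (J - {a}) \<in> support n k f \<and> insert a (K - {b}) \<in> support n k f"
    using bK by auto
qed

text \<open>Exchange the last entry \<open>c\<close> of the first list: replacing it by an entry of
  \<open>rs\<close> repeats a column, so only the terms for \<open>b\<close> and \<open>d\<close>
  survive.\<close>

lemma minor_three_term:
  assumes "Suc (Suc (length rs)) = k"
  shows "minor k f (rs @ [a, c]) * minor k f (rs @ [b, d]) =
    minor k f (rs @ [a, b]) * minor k f (rs @ [c, d]) +
    minor k f (rs @ [a, d]) * minor k f (rs @ [b, c])"
proof -
  let ?m = "length rs"
  let ?t = "\<lambda>j. minor k f ((rs @ [a, c])[Suc ?m := (rs @ [b, d]) ! j]) *
    minor k f ((rs @ [b, d])[j := (rs @ [a, c]) ! Suc ?m])"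
  have "minor k f (rs @ [a, c]) * minor k f (rs @ [b, d]) = (\<Sum>j<k. ?t j)"
    by (rule minor_exchange) (use assms in auto)
  also have "{..<k} = insert ?m (insert (Suc ?m) {..<?m})" using assms by auto
  also have "sum ?t \<dots> = ?t ?m + (?t (Suc ?m) + sum ?t {..<?m})" by simp
  also have "sum ?t {..<?m} = 0"
  proof (intro sum.neutral ballI)
    fix j assume "j \<in> {..<?m}"
    then have "\<not> distinct ((rs @ [a, c])[Suc ?m := (rs @ [b, d]) ! j])"
      by (auto simp: list_update_append nth_append)
    from minor_repeated[OF _ this, of k f] show "?t j = 0" using assms by simp
  qed
  finally show ?thesis by (simp add: list_update_append nth_append)
qed

lemma sorted_list_of_set_insert2:
  fixes R :: "nat set"
  assumes "finite R" "x < y" "x \<notin> R" "y \<notin> R"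
  shows "\<exists>us vs ws. sorted_list_of_set R = us @ vs @ ws \<and>
    sorted_list_of_set (R \<union> {x, y}) = us @ x # vs @ y # ws \<and>
    length vs + length ws = card {r \<in> R. x < r} \<and> length ws = card {r \<in> R. y < r}"
proof (intro exI conjI)
  let ?us = "sorted_list_of_set {r \<in> R. r < x}"
  let ?vs = "sorted_list_of_set {r \<in> R. x < r \<and> r < y}"
  let ?ws = "sorted_list_of_set {r \<in> R. y < r}"
  have tri: "r < x \<or> x < r \<and> r < y \<or> y < r" if "r \<in> R" for r
    using assms that by (metis linorder_neqE_nat)
  then have R: "R = {r \<in> R. r < x} \<union> {r \<in> R. x < r \<and> r < y} \<union> {r \<in> R. y < r}" by auto
  show "sorted_list_of_set R = ?us @ ?vs @ ?ws"
    by (rule sorted_distinct_set_unique) (use assms(1,2) R in \<open>auto simp: sorted_append\<close>)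
  define T where "T = R \<union> {x, y}"
  have T: "finite T" "T = {r \<in> R. r < x} \<union> {x} \<union> {r \<in> R. x < r \<and> r < y} \<union> {y} \<union> {r \<in> R. y < r}"
    using assms(1) R unfolding T_def by auto
  have "sorted_list_of_set T = ?us @ x # ?vs @ y # ?ws"
  proof (rule sorted_distinct_set_unique)
    show "set (sorted_list_of_set T) = set (?us @ x # ?vs @ y # ?ws)"
      unfolding set_sorted_list_of_set[OF T(1)] by (subst T(2)) (use assms(1) in auto)
  qed (use assms(1,2) in \<open>auto simp: sorted_append\<close>)
  then show "sorted_list_of_set (R \<union> {x, y}) = ?us @ x # ?vs @ y # ?ws" unfolding T_def .
  have "{r \<in> R. x < r} = {r \<in> R. x < r \<and> r < y} \<union> {r \<in> R. y < r}"
    using tri assms(2) by fastforce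
  then have "card {r \<in> R. x < r} = card {r \<in> R. x < r \<and> r < y} + card {r \<in> R. y < r}"
    using assms(1) by (simp add: card_Un_disjoint disjoint_iff)
  then show "length ?vs + length ?ws = card {r \<in> R. x < r}" using assms(1) by simp
  show "length ?ws = card {r \<in> R. y < r}" using assms(1) by simp
qed

text \<open>Moving \<open>x\<close> and \<open>y\<close> to the end passes exactly the elements of
  \<open>R\<close> above them. The sign is a product of one factor per label, so it is the same for
  all three products of a three-term relation, each of which involves the four labels once.\<close>

lemma sminor_insert2:
  assumes "finite R" "x < y" "x \<notin> R" "y \<notin> R" "Suc (Suc (card R)) = k"
  shows "sminor k f (R \<union> {x, y}) =
    (-1) ^ (card {r \<in> R. x < r} + card {r \<in> R. y < r}) * minor k f (sorted_list_of_set R @ [x, y])"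
proof -
  obtain us vs ws where R: "sorted_list_of_set R = us @ vs @ ws"
    and Rxy: "sorted_list_of_set (R \<union> {x, y}) = us @ x # vs @ y # ws"
    and cards: "card {r \<in> R. x < r} = length vs + length ws" "card {r \<in> R. y < r} = length ws"
    using sorted_list_of_set_insert2[OF assms(1-4)] by metis
  have len: "length us + length vs + length ws + 2 = k"
    using arg_cong[OF R, of length] assms(1,5) by simp
  have "sminor k f (R \<union> {x, y}) = minor k f ((us @ x # vs) @ y # ws @ [])"
    unfolding sminor_def Rxy by simp
  also have "\<dots> = (-1) ^ length ws * minor k f ((us @ x # vs) @ ws @ [y])"
    using minor_move[of "us @ x # vs" y ws "[]" k f] len by simp
  also have "minor k f ((us @ x # vs) @ ws @ [y]) = minor k f (us @ x # (vs @ ws) @ [y])" by simp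
  also have "\<dots> = (-1) ^ length (vs @ ws) * minor k f (us @ (vs @ ws) @ x # [y])"
    by (rule minor_move) (use len in simp)
  finally show ?thesis unfolding cards R by (simp add: power_add)
qed

text \<open>The factor \<open>t\<close> is there because Pluecker coordinates are only homogeneous coordinates.\<close>

definition nonneg :: "nat \<Rightarrow> nat \<Rightarrow> real \<Rightarrow> (nat \<Rightarrow> nat \<Rightarrow> real) \<Rightarrow> bool" where
  "nonneg n k t f \<longleftrightarrow> t \<noteq> 0 \<and> (\<forall>J \<in> nsets {1..n} k. 0 \<le> t * sminor k f J) \<and> support n k f \<noteq> {}"

lemma support_three_term:
  assumes "nonneg n k t f"
  shows "three_term (support n k f)"
  unfolding three_term_def
proof (intro allI impI)
  fix R a b c d
  let ?M = "support n k f"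
  assume *: "a < b \<and> b < c \<and> c < d \<and> R \<inter> {a, b, c, d} = {} \<and>
     (R \<union> {a, b} \<in> ?M \<and> R \<union> {c, d} \<in> ?M \<or> R \<union> {a, d} \<in> ?M \<and> R \<union> {b, c} \<in> ?M)"
  have ord: "a < b" "b < c" "c < d" "a < c" "a < d" "b < d" using * by auto
  have notin: "a \<notin> R" "b \<notin> R" "c \<notin> R" "d \<notin> R" using * by auto
  from * obtain x y where xy: "R \<union> {x, y} \<in> ?M" "x \<notin> R" "y \<notin> R" "x \<noteq> y" using ord notin by blast
  have R: "finite R" "Suc (Suc (card R)) = k" "R \<subseteq> {1..n}"
    using xy by (auto simp: support_def nsets_def)
  have mem: "a \<in> {1..n}" "b \<in> {1..n}" "c \<in> {1..n}" "d \<in> {1..n}"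
    using * by (auto simp: support_def nsets_def)
  have nsets: "R \<union> {x, y} \<in> nsets {1..n} k" if "x \<in> {1..n}" "y \<in> {1..n}" "x \<notin> R" "y \<notin> R" "x < y" for x y
    using that R by (auto simp: nsets_def)
  define e where "e x = card {r \<in> R. x < r}" for x
  define P where "P x y = t * sminor k f (R \<union> {x, y})" for x y
  define Q where "Q x y = minor k f (sorted_list_of_set R @ [x, y])" for x y
  have P_eq: "P x y = t * (-1) ^ (e x + e y) * Q x y" if "x < y" "x \<notin> R" "y \<notin> R" for x y
    unfolding e_def P_def Q_def using sminor_insert2[OF R(1) that R(2), of f] by simp
  have "Q a c * Q b d = Q a b * Q c d + Q a d * Q b c"
    unfolding Q_def by (rule minor_three_term) (use R in simp)
  moreover have "P a c * P b d = (t * t * (-1) ^ (e a + e b + e c + e d)) * (Q a c * Q b d)"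
    "P a b * P c d = (t * t * (-1) ^ (e a + e b + e c + e d)) * (Q a b * Q c d)"
    "P a d * P b c = (t * t * (-1) ^ (e a + e b + e c + e d)) * (Q a d * Q b c)"
    using ord notin by (simp_all add: P_eq power_add mult_ac)
  ultimately have id: "P a c * P b d = P a b * P c d + P a d * P b c"
    by (simp add: distrib_left)
  have nonneg: "0 \<le> P x y" if "x \<in> {1..n}" "y \<in> {1..n}" "x \<notin> R" "y \<notin> R" "x < y" for x y
    unfolding P_def using nsets[OF that] assms by (auto simp: nonneg_def)
  have t: "t \<noteq> 0" using assms by (simp add: nonneg_def)
  have "0 \<le> P a b * P c d" "0 \<le> P a d * P b c"
    using nonneg mem notin ord by (auto intro!: mult_nonneg_nonneg)
  moreover have "P a b * P c d \<noteq> 0 \<or> P a d * P b c \<noteq> 0"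
    using * t by (auto simp: support_def P_def)
  ultimately have "P a c * P b d \<noteq> 0" unfolding id by linarith
  then show "R \<union> {a, c} \<in> ?M \<and> R \<union> {b, d} \<in> ?M"
    using nsets mem notin ord by (auto simp: support_def P_def)
qed

lemma nonneg_tnn_matroid:
  assumes "nonneg n k t f"
  shows "tnn_matroid n k (support n k f)"
proof
  show "support n k f \<subseteq> nsets {1..n} k" by (auto simp: support_def)
  show "support n k f \<noteq> {}" using assms by (simp add: nonneg_def)
qed (rule support_exchange, rule support_three_term[OF assms])

section \<open>Column operations and their effect on minors\<close>

lemma sorted_list_of_set_replace:
  fixes J :: "nat set"
  assumes "finite J" "i \<in> J" "Suc i \<notin> J"
  shows "\<exists>us vs. sorted_list_of_set J = us @ i # vs \<and> i \<notin> set us \<and> i \<notin> set vs \<and> Suc i \<notin> set us \<and> Suc i \<notin> set vs \<and>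
    sorted_list_of_set (adj_swap i ` J) = us @ Suc i # vs"
proof -
  let ?us = "sorted_list_of_set (J \<inter> {..<i})" let ?vs = "sorted_list_of_set (J \<inter> {i<..})"
  have J: "sorted_list_of_set J = ?us @ i # ?vs" using sorted_list_of_set_split[OF assms(1,2)] .
  have "Suc i \<in> adj_swap i ` J" using assms by simp
  from sorted_list_of_set_split[OF _ this] assms(1)
  have "sorted_list_of_set (adj_swap i ` J) = sorted_list_of_set (adj_swap i ` J \<inter> {..<Suc i}) @ Suc i #
      sorted_list_of_set (adj_swap i ` J \<inter> {Suc i<..})" by simp
  moreover have "adj_swap i ` J \<inter> {..<Suc i} = J \<inter> {..<i}"
    unfolding adj_swap_image_insert(1)[OF assms(2,3)] by auto
  moreover have "adj_swap i ` J \<inter> {Suc i<..} = J \<inter> {i<..}"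
    unfolding adj_swap_image_insert(1)[OF assms(2,3)] using assms(3)
    by (auto simp: less_Suc_eq) (metis Suc_lessI)
  ultimately show ?thesis using J assms by (intro exI[of _ ?us] exI[of _ ?vs]) simp
qed

lemma sorted_list_of_set_both:
  fixes J :: "nat set"
  assumes "finite J" "i \<in> J" "Suc i \<in> J"
  shows "\<exists>us vs. sorted_list_of_set J = us @ i # Suc i # vs \<and> i \<notin> set us \<and> i \<notin> set vs \<and> Suc i \<notin> set us \<and> Suc i \<notin> set vs"
proof -
  let ?us = "sorted_list_of_set (J \<inter> {..<i})" let ?vs = "sorted_list_of_set (J \<inter> {Suc i<..})"
  have "sorted_list_of_set (J \<inter> {i<..}) = Suc i # ?vs"
  proof -
    have "J \<inter> {i<..} \<inter> {..<Suc i} = {}" "J \<inter> {i<..} \<inter> {Suc i<..} = J \<inter> {Suc i<..}" by auto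
    then show ?thesis
      using sorted_list_of_set_split[of "J \<inter> {i<..}" "Suc i"] assms by simp
  qed
  then show ?thesis
    using sorted_list_of_set_split[OF assms(1,2)] assms(1) by (intro exI[of _ ?us] exI[of _ ?vs]) simp
qed

lemma minor_cong: "length xs = k \<Longrightarrow> map f xs = map g ys \<Longrightarrow> minor k f xs = minor k g ys"
  unfolding minor_def by (rule coldet_cong) (metis length_map nth_map)

text \<open>A minor as a linear form in one column. The coefficients are chosen before the
  configuration \<open>g\<close> and the label \<open>b\<close>, so that minors of configurations
  differing only in this column can be compared.\<close>

lemma minor_column:
  assumes "length (us @ a # vs) = k"
  shows "\<exists>\<gamma>. \<forall>g b. (\<forall>x \<in> set us \<union> set vs. g x = f x) \<longrightarrow>
    minor k g (us @ b # vs) = (\<Sum>s<k. g b s * \<gamma> s)"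
proof (intro exI allI impI)
  fix g b assume g: "\<forall>x \<in> set us \<union> set vs. g x = f x"
  let ?c = "\<lambda>j. f ((us @ a # vs) ! j)"
  have "minor k g (us @ b # vs) = coldet k (?c(length us := g b))"
    unfolding minor_def
  proof (rule coldet_cong)
    fix j assume j: "j < k"
    consider "j < length us" | "j = length us" | "length us < j" "j - Suc (length us) < length vs"
      using j assms by fastforce
    then show "g ((us @ b # vs) ! j) = (?c(length us := g b)) j"
    proof cases
      case 3
      then have "(us @ b # vs) ! j = vs ! (j - Suc (length us))"
        "(us @ a # vs) ! j = vs ! (j - Suc (length us))"
        by (auto simp: nth_append nth_Cons')
      then show ?thesis using 3 g by simp
    qed (use g in \<open>auto simp: nth_append\<close>)
  qed
  then show "minor k g (us @ b # vs) = (\<Sum>s<k. g b s * col_cofactor k ?c (length us) s)"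
    using assms by (simp add: coldet_expand)
qed

text \<open>Linearity in column \<open>i\<close>: the correction has column \<open>Suc i\<close> in
  place of column \<open>i\<close>, so it is the minor of the transposed set if \<open>Suc i\<close>
  was absent and has a repeated column otherwise.\<close>

lemma sminor_bridge:
  fixes f :: "nat \<Rightarrow> nat \<Rightarrow> real" and i :: nat and b :: real
  assumes "finite J" "card J = k"
  defines "g \<equiv> f(i := \<lambda>s. f i s - b * f (Suc i) s)"
  shows "sminor k g J = (if i \<in> J \<and> Suc i \<notin> J then sminor k f J - b * sminor k f (adj_swap i ` J)
    else sminor k f J)"
proof -
  have len: "length (sorted_list_of_set J) = k" using assms by simp
  consider "i \<notin> J" | "i \<in> J" "Suc i \<notin> J" | "i \<in> J" "Suc i \<in> J" by blast
  then show ?thesis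
  proof cases
    case 1
    then show ?thesis using len assms(1) by (auto simp: sminor_def g_def intro!: minor_cong)
  next
    case 2
    obtain us vs where l: "sorted_list_of_set J = us @ i # vs" "i \<notin> set us" "i \<notin> set vs"
      "sorted_list_of_set (adj_swap i ` J) = us @ Suc i # vs"
      using sorted_list_of_set_replace[OF assms(1) 2] by blast
    obtain \<gamma> where \<gamma>: "\<And>g b. (\<forall>x \<in> set us \<union> set vs. g x = f x) \<Longrightarrow>
        minor k g (us @ b # vs) = (\<Sum>s<k. g b s * \<gamma> s)"
      using minor_column[of us i vs k f] len l(1) by metis
    have "minor k g (us @ i # vs) = (\<Sum>s<k. g i s * \<gamma> s)"
      by (rule \<gamma>) (use l in \<open>auto simp: g_def\<close>)
    then show ?thesis using 2 l \<gamma>[of f]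
      by (simp add: sminor_def g_def algebra_simps sum_subtractf sum_distrib_left)
  next
    case 3
    obtain us vs where l: "sorted_list_of_set J = us @ i # Suc i # vs" "i \<notin> set us" "i \<notin> set vs"
      using sorted_list_of_set_both[OF assms(1) 3] by blast
    obtain \<gamma> where \<gamma>: "\<And>g b. (\<forall>x \<in> set us \<union> set (Suc i # vs). g x = f x) \<Longrightarrow>
        minor k g (us @ b # Suc i # vs) = (\<Sum>s<k. g b s * \<gamma> s)"
      using minor_column[of us i "Suc i # vs" k f] len l(1) by metis
    have "minor k g (us @ i # Suc i # vs) = (\<Sum>s<k. g i s * \<gamma> s)"
      by (rule \<gamma>) (use l in \<open>auto simp: g_def\<close>)
    moreover have "minor k f (us @ Suc i # Suc i # vs) = 0"
      by (rule minor_repeated) (use len l in auto)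
    moreover have "(\<Sum>s<k. g i s * \<gamma> s) = (\<Sum>s<k. f i s * \<gamma> s) - b * (\<Sum>s<k. f (Suc i) s * \<gamma> s)"
      by (simp add: g_def algebra_simps sum_subtractf sum_distrib_left)
    ultimately show ?thesis using 3 l \<gamma>[of f] by (simp add: sminor_def)
  qed
qed

text \<open>The minus sign on the new column \<open>i\<close> makes up for interchanging two
  adjacent columns when both labels occur. The price is a sign for sets with \<open>Suc i\<close>
  but without \<open>i\<close>, and these are not bases when \<open>i\<close> is a coloop or
  \<open>Suc i\<close> is a loop.\<close>

lemma sminor_swap_columns:
  fixes f :: "nat \<Rightarrow> nat \<Rightarrow> real" and i :: nat
  assumes "finite J" "card J = k"
  defines "g \<equiv> f(i := \<lambda>s. - f (Suc i) s, Suc i := f i)"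
  shows "sminor k g (adj_swap i ` J) = (if Suc i \<in> J \<and> i \<notin> J then - sminor k f J else sminor k f J)"
proof -
  have len: "length (sorted_list_of_set J) = k" using assms by simp
  consider "i \<notin> J" "Suc i \<notin> J" | "i \<in> J" "Suc i \<notin> J" | "i \<notin> J" "Suc i \<in> J" | "i \<in> J" "Suc i \<in> J" by blast
  then show ?thesis
  proof cases
    case 1
    then show ?thesis using len assms(1)
      by (auto simp: sminor_def g_def adj_swap_image_same intro!: minor_cong)
  next
    case 2
    obtain us vs where l: "sorted_list_of_set J = us @ i # vs" "i \<notin> set us" "i \<notin> set vs"
      "Suc i \<notin> set us" "Suc i \<notin> set vs" "sorted_list_of_set (adj_swap i ` J) = us @ Suc i # vs"
      using sorted_list_of_set_replace[OF assms(1) 2] by blast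
    obtain \<gamma> where \<gamma>: "\<And>g b. (\<forall>x \<in> set us \<union> set vs. g x = f x) \<Longrightarrow>
        minor k g (us @ b # vs) = (\<Sum>s<k. g b s * \<gamma> s)"
      using minor_column[of us i vs k f] len l(1) by metis
    have "minor k g (us @ Suc i # vs) = (\<Sum>s<k. g (Suc i) s * \<gamma> s)"
      by (rule \<gamma>) (use l in \<open>auto simp: g_def\<close>)
    then show ?thesis using 2 l \<gamma>[of f] by (simp add: sminor_def g_def)
  next
    case 3
    let ?K = "adj_swap i ` J"
    have K: "finite ?K" "i \<in> ?K" "Suc i \<notin> ?K" using assms(1) 3 by auto
    obtain us vs where l: "sorted_list_of_set ?K = us @ i # vs" "i \<notin> set us" "i \<notin> set vs"
      "Suc i \<notin> set us" "Suc i \<notin> set vs" "sorted_list_of_set (adj_swap i ` ?K) = us @ Suc i # vs"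
      using sorted_list_of_set_replace[OF K] by blast
    have "length (us @ i # vs) = k" using arg_cong[OF l(6), of length] len by simp
    then obtain \<gamma> where \<gamma>: "\<And>g b. (\<forall>x \<in> set us \<union> set vs. g x = f x) \<Longrightarrow>
        minor k g (us @ b # vs) = (\<Sum>s<k. g b s * \<gamma> s)"
      using minor_column[of us i vs k f] by metis
    have "minor k g (us @ i # vs) = (\<Sum>s<k. g i s * \<gamma> s)"
      by (rule \<gamma>) (use l in \<open>auto simp: g_def\<close>)
    then show ?thesis using 3 l \<gamma>[of f] by (simp add: sminor_def g_def sum_negf)
  next
    case 4
    obtain us vs where l: "sorted_list_of_set J = us @ i # Suc i # vs" "i \<notin> set us" "i \<notin> set vs"
      "Suc i \<notin> set us" "Suc i \<notin> set vs"
      using sorted_list_of_set_both[OF assms(1) 4] by blast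
    define h where "h = f(i := f (Suc i), Suc i := f i)"
    obtain \<gamma> where \<gamma>: "\<And>g b. (\<forall>x \<in> set us \<union> set (Suc i # vs). g x = h x) \<Longrightarrow>
        minor k g (us @ b # Suc i # vs) = (\<Sum>s<k. g b s * \<gamma> s)"
      using minor_column[of us i "Suc i # vs" k h] len l(1) by metis
    have "minor k g (us @ i # Suc i # vs) = (\<Sum>s<k. g i s * \<gamma> s)"
      by (rule \<gamma>) (use l in \<open>auto simp: g_def h_def\<close>)
    also have "\<dots> = - (\<Sum>s<k. h i s * \<gamma> s)" by (simp add: g_def h_def sum_negf)
    also have "(\<Sum>s<k. h i s * \<gamma> s) = minor k h (us @ i # Suc i # vs)" by (rule \<gamma>[symmetric]) simp
    also have "\<dots> = minor k f (us @ Suc i # i # vs)"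
      by (rule minor_cong) (use len l in \<open>auto simp: h_def\<close>)
    also have "- minor k f (us @ Suc i # i # vs) = minor k f (us @ i # Suc i # vs)"
      using minor_swap_adjacent[of us "Suc i" i vs k f] len l(1) by simp
    finally show ?thesis using 4 l by (simp add: sminor_def adj_swap_image_same)
  qed
qed

section \<open>Removing a corner box from a configuration\<close>

lemma nsets_adj_swap:
  assumes "1 \<le> i" "Suc i \<le> n"
  shows "adj_swap i ` J \<in> nsets {1..n} k \<longleftrightarrow> J \<in> nsets {1..n} k"
proof -
  have "adj_swap i ` K \<in> nsets {1..n} k" if "K \<in> nsets {1..n} k" for K
  proof -
    have "adj_swap i ` K \<subseteq> {1..n}"
    proof
      fix t assume "t \<in> adj_swap i ` K"
      then have "adj_swap i t \<in> {1..n}" using that by (auto simp: nsets_def)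
      then show "t \<in> {1..n}" using assms by (auto simp: transpose_def split: if_splits)
    qed
    then show ?thesis using that by (auto simp: nsets_def)
  qed
  from this[of J] this[of "adj_swap i ` J"] show ?thesis by auto
qed

lemma trivial_removal_exists:
  assumes f: "nonneg n k t f" and i: "i \<in> lexmin (support n k f)" "Suc i \<notin> lexmin (support n k f)" "Suc i \<le> n"
    and swap: "adj_swap i ` lexmin (support n k f) \<notin> support n k f"
  shows "\<exists>g. nonneg n k t g \<and> trivial_removal n k (support n k f) (support n k g) i"
proof -
  let ?M = "support n k f"
  interpret M: tnn_matroid n k ?M using f by (rule nonneg_tnn_matroid)
  have lc: "(\<forall>J\<in>?M. i \<in> J) \<or> (\<forall>J\<in>?M. Suc i \<notin> J)" by (rule M.loop_or_coloop[OF i(1,2) swap])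
  have i1: "1 \<le> i" using i(1) M.member(3)[OF M.lexmin_in] by auto
  define g where "g = f(i := \<lambda>s. - f (Suc i) s, Suc i := f i)"
  have g: "sminor k g (adj_swap i ` J) = sminor k f J" if J: "J \<in> nsets {1..n} k" for J
  proof (cases "Suc i \<in> J \<and> i \<notin> J")
    case True
    then have "J \<notin> ?M" using lc by auto
    then have "sminor k f J = 0" using J by (simp add: support_def)
    then show ?thesis using sminor_swap_columns[of J k f i] J True by (simp add: g_def nsets_def)
  next
    case False
    then show ?thesis using sminor_swap_columns[of J k f i] J by (auto simp: g_def nsets_def)
  qed
  have g': "sminor k g J = sminor k f (adj_swap i ` J)" if "J \<in> nsets {1..n} k" for J
    using g[of "adj_swap i ` J"] that nsets_adj_swap[OF i1 i(3)] by simp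
  have mem: "J \<in> support n k g \<longleftrightarrow> adj_swap i ` J \<in> ?M" for J
    using g'[of J] nsets_adj_swap[OF i1 i(3), of J] by (auto simp: support_def)
  have N: "support n k g = (`) (adj_swap i) ` ?M"
  proof (intro Set.set_eqI iffI)
    fix J assume "J \<in> support n k g"
    then show "J \<in> (`) (adj_swap i) ` ?M"
      unfolding mem by (intro image_eqI[of _ _ "adj_swap i ` J"]) auto
  qed (auto simp: mem)
  have "nonneg n k t g"
    using f g' nsets_adj_swap[OF i1 i(3)] N by (auto simp: nonneg_def)
  moreover have "trivial_removal n k ?M (support n k g) i"
  proof -
    interpret N: tnn_matroid n k "support n k g" using calculation by (rule nonneg_tnn_matroid)
    show ?thesis by unfold_locales (fact i N lc)+
  qed
  ultimately show ?thesis by blast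
qed

lemma bridge_removal_exists:
  assumes f: "nonneg n k t f" and i: "i \<in> lexmin (support n k f)" "Suc i \<notin> lexmin (support n k f)" "Suc i \<le> n"
    and swap: "adj_swap i ` lexmin (support n k f) \<in> support n k f"
  shows "\<exists>g. nonneg n k t g \<and> bridge_removal n k (support n k f) (support n k g) i"
proof -
  let ?M = "support n k f" let ?I = "lexmin (support n k f)" let ?s = "\<lambda>J. adj_swap i ` J"
  interpret M: tnn_matroid n k ?M using f by (rule nonneg_tnn_matroid)
  have i1: "1 \<le> i" using i(1) M.member(3)[OF M.lexmin_in] by auto
  note nsets_swap = nsets_adj_swap[OF i1 i(3)]
  define P where "P J = t * sminor k f J" for J
  have t: "t \<noteq> 0" using f by (simp add: nonneg_def)
  have P0: "0 \<le> P J" if "J \<in> nsets {1..n} k" for J using f that by (auto simp: nonneg_def P_def)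
  have PM: "J \<in> ?M \<longleftrightarrow> J \<in> nsets {1..n} k \<and> 0 < P J" for J
    using P0[of J] t by (auto simp: support_def P_def order_less_le)
  \<comment> \<open>These index the coordinates that decrease when a multiple of column
    \<open>Suc i\<close> is subtracted from column \<open>i\<close>. The least ratio
    \<open>b\<close> below is the first moment at which one of them vanishes.\<close>
  define C where "C = {J \<in> nsets {1..n} k. i \<in> J \<and> Suc i \<notin> J \<and> ?s J \<in> ?M}"
  have "finite C" unfolding C_def using finite_imp_finite_nsets[of "{1..n}" k] by simp
  moreover have "?I \<in> C" using i swap M.lexmin_in by (auto simp: C_def support_def)
  ultimately have C: "finite C" "C \<noteq> {}" by auto
  define b where "b = Min ((\<lambda>J. P J / P (?s J)) ` C)"
  \<comment> \<open>None of these coordinates vanishes at the start; this makes \<open>b\<close>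
    positive.\<close>
  have CM: "J \<in> ?M" if "J \<in> C" for J
    using M.adj_swap_closed[OF i(1,2), of "?s J"] that by (auto simp: C_def)
  obtain J0 where J0: "J0 \<in> C" "b = P J0 / P (?s J0)"
  proof -
    have "b \<in> (\<lambda>J. P J / P (?s J)) ` C" unfolding b_def using C by (intro Min_in) auto
    then show ?thesis using that by blast
  qed
  have b_le: "b * P (?s J) \<le> P J" if "J \<in> C" for J
  proof -
    have "b \<le> P J / P (?s J)" unfolding b_def using that C(1) by auto
    moreover have "0 < P (?s J)" using that PM by (auto simp: C_def)
    ultimately show ?thesis by (simp add: pos_le_divide_eq)
  qed
  have b: "0 < b"
    using J0 CM[OF J0(1)] PM[of J0] PM[of "?s J0"] by (simp add: C_def)
  define g where "g = f(i := \<lambda>s. f i s - b * f (Suc i) s)"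
  define Q where "Q J = t * sminor k g J" for J
  have Q: "Q J = (if i \<in> J \<and> Suc i \<notin> J then P J - b * P (?s J) else P J)" if "J \<in> nsets {1..n} k" for J
    using sminor_bridge[of J k f i b] that by (simp add: Q_def P_def g_def nsets_def algebra_simps)
  have Q0: "0 \<le> Q J" if J: "J \<in> nsets {1..n} k" for J
  proof (cases "i \<in> J \<and> Suc i \<notin> J")
    case True
    show ?thesis
    proof (cases "?s J \<in> ?M")
      case True
      then show ?thesis using b_le[of J] Q[OF J] \<open>i \<in> J \<and> Suc i \<notin> J\<close> J by (simp add: C_def)
    next
      case False
      then have "P (?s J) = 0" using PM[of "?s J"] P0[of "?s J"] nsets_swap[of J] J by auto
      then show ?thesis using Q[OF J] P0[OF J] by simp
    qed
  qed (use Q[OF J] P0[OF J] in auto)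
  let ?N = "support n k g"
  have QN: "J \<in> ?N \<longleftrightarrow> J \<in> nsets {1..n} k \<and> Q J \<noteq> 0" for J
    using t by (auto simp: support_def Q_def)
  have swap_N: "?s J \<in> ?N \<longleftrightarrow> ?s J \<in> ?M" if "i \<in> J" "Suc i \<notin> J" "J \<in> nsets {1..n} k" for J
    using Q[of "?s J"] that nsets_swap[of J] P0[of "?s J"] by (auto simp: QN PM)
  have M_eq: "J \<in> ?M \<longleftrightarrow> J \<in> ?N \<or> i \<in> J \<and> Suc i \<notin> J \<and> ?s J \<in> ?N" for J
  proof (cases "J \<in> nsets {1..n} k")
    case J: True
    show ?thesis
    proof (cases "i \<in> J \<and> Suc i \<notin> J")
      case True
      have "P J = Q J + b * P (?s J)" using Q[OF J] True by simp
      moreover have "0 \<le> P (?s J)" using P0 J nsets_swap by simp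
      ultimately have "0 < P J \<longleftrightarrow> Q J \<noteq> 0 \<or> 0 < P (?s J)"
        using Q0[OF J] mult_pos_pos[OF b, of "P (?s J)"] by (cases "P (?s J) = 0") auto
      then show ?thesis using swap_N[of J] True J nsets_swap by (auto simp: PM QN)
    next
      case False
      then show ?thesis using Q[OF J] P0[OF J] J by (auto simp: PM QN)
    qed
  next
    case False
    then show ?thesis using nsets_swap[of J] by (auto simp: support_def)
  qed
  have swap_in: "?s ?I \<in> ?N" using swap_N[of ?I] i swap M.lexmin_in by (auto simp: support_def)
  have "nonneg n k t g" unfolding nonneg_def
    using t Q0 swap_in by (auto simp: Q_def)
  moreover have "bridge_removal n k ?M ?N i"
  proof -
    interpret N: tnn_matroid n k ?N using calculation by (rule nonneg_tnn_matroid)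
    \<comment> \<open>Otherwise \<open>?I\<close> would remain the minimal basis, and
      \<open>adj_swap_closed\<close> in \<open>?N\<close> would recover \<open>J0\<close> from its
      transposed set, although the choice of \<open>b\<close> makes the coordinate of
      \<open>J0\<close> vanish.\<close>
    have "?I \<notin> ?N"
    proof
      assume I: "?I \<in> ?N"
      have "lexmin ?N = ?I"
        by (rule lexmin_characterization[OF N.sets _ I]) (use M_eq M.lexmin_lex_less in auto)
      moreover have "?s J0 \<in> ?N" using swap_N[of J0] J0(1) by (auto simp: C_def)
      moreover have "i \<in> J0" "Suc i \<notin> J0" using J0(1) by (auto simp: C_def)
      ultimately have "J0 \<in> ?N" using N.adj_swap_closed[of i "?s J0"] i by simp
      moreover have "Q J0 = 0"
        using Q[of J0] J0 PM[of "?s J0"] by (simp add: C_def)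
      ultimately show False using QN by simp
    qed
    then show ?thesis using M_eq i by unfold_locales auto
  qed
  ultimately show ?thesis by blast
qed

text \<open>The measure is the number of boxes up to a constant: if the \<open>r\<close>-th label of
  \<open>I\<close> is i_r, row \<open>r\<close> has n - k + r - i_r boxes, which add up to nk -
  \<Sum>I - k(k - 1)/2. The predicate \<open>Q\<close> sees only the matroid, so its cases can be
  settled inside the locales, without coordinates.\<close>

theorem support_induct [consumes 1, case_names base trivial bridge]:
  assumes f: "nonneg n k t f"
    and base: "\<And>M. tnn_matroid n k M \<Longrightarrow> (\<And>i. i \<in> lexmin M \<Longrightarrow> Suc i \<le> n \<Longrightarrow> Suc i \<in> lexmin M) \<Longrightarrow> Q M"
    and trivial: "\<And>M N i. trivial_removal n k M N i \<Longrightarrow> Suc i \<le> n \<Longrightarrow> Q N \<Longrightarrow> Q M"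
    and bridge: "\<And>M N i. bridge_removal n k M N i \<Longrightarrow> Suc i \<le> n \<Longrightarrow> Q N \<Longrightarrow> Q M"
  shows "Q (support n k f)"
  using f
proof (induction "n * k - \<Sum>(lexmin (support n k f))" arbitrary: f rule: less_induct)
  case (less f)
  let ?M = "support n k f"
  interpret M: tnn_matroid n k ?M using less.prems by (rule nonneg_tnn_matroid)
  have sum_le: "\<Sum>(lexmin (support n k g)) \<le> n * k" if "nonneg n k t g" for g
  proof -
    interpret N: tnn_matroid n k "support n k g" using that by (rule nonneg_tnn_matroid)
    have "\<Sum>(lexmin (support n k g)) \<le> of_nat (card (lexmin (support n k g))) * n"
      by (rule sum_bounded_above) (use N.member[OF N.lexmin_in] in auto)
    then show ?thesis using N.member[OF N.lexmin_in] by (simp add: mult.commute)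
  qed
  show ?case
  proof (cases "\<exists>i. i \<in> lexmin ?M \<and> Suc i \<notin> lexmin ?M \<and> Suc i \<le> n")
    case False
    then show ?thesis by (intro base) (auto simp: M.tnn_matroid_axioms)
  next
    case True
    then obtain i where i: "i \<in> lexmin ?M" "Suc i \<notin> lexmin ?M" "Suc i \<le> n" by blast
    have decrease: "n * k - \<Sum>(lexmin (support n k g)) < n * k - \<Sum>(lexmin ?M)"
      if "nonneg n k t g" "lexmin (support n k g) = adj_swap i ` lexmin ?M" for g
    proof -
      have fin: "finite (lexmin ?M)" using M.member M.lexmin_in by blast
      have "\<Sum>(adj_swap i ` lexmin ?M) = Suc i + \<Sum>(lexmin ?M - {i})"
        unfolding adj_swap_image_insert(1)[OF i(1,2)] using fin i(2) by simp
      moreover have "\<Sum>(lexmin ?M) = i + \<Sum>(lexmin ?M - {i})"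
        using fin i(1) by (simp add: sum.remove)
      ultimately show ?thesis using sum_le[OF that(1)] that(2) by simp
    qed
    show ?thesis
    proof (cases "adj_swap i ` lexmin ?M \<in> ?M")
      case True
      then obtain g where g: "nonneg n k t g" "bridge_removal n k ?M (support n k g) i"
        using bridge_removal_exists[OF less.prems i] by blast
      then have "lexmin (support n k g) = adj_swap i ` lexmin ?M"
        by (intro bridge_removal.lexmin_N)
      from bridge[OF g(2) i(3) less.hyps[OF decrease[OF g(1) this] g(1)]] show ?thesis .
    next
      case False
      then obtain g where g: "nonneg n k t g" "trivial_removal n k ?M (support n k g) i"
        using trivial_removal_exists[OF less.prems i] by blast
      then have "lexmin (support n k g) = adj_swap i ` lexmin ?M"
        by (intro trivial_removal.lexmin_N)
      from trivial[OF g(2) i(3) less.hyps[OF decrease[OF g(1) this] g(1)]] show ?thesis .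
    qed
  qed
qed

section \<open>Hook arcs and representation by Le-diagrams\<close>

lemma sorted_list_of_set_strict_mono_image:
  fixes S :: "nat set"
  assumes "finite S" "strict_mono_on S \<phi>"
  shows "sorted_list_of_set (\<phi> ` S) = map \<phi> (sorted_list_of_set S)"
proof (rule sorted_distinct_set_unique)
  have "sorted_wrt (<) (sorted_list_of_set S)" using assms(1) by simp
  then have "sorted_wrt (\<lambda>a b. \<phi> a < \<phi> b) (sorted_list_of_set S)"
    by (rule sorted_wrt_mono_rel[rotated]) (use assms in \<open>auto simp: strict_mono_on_def\<close>)
  then have "sorted_wrt (<) (map \<phi> (sorted_list_of_set S))" by (simp add: sorted_wrt_map)
  then show "sorted (map \<phi> (sorted_list_of_set S))" "distinct (map \<phi> (sorted_list_of_set S))"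
    by (auto simp: strict_sorted_iff)
qed (use assms(1) in auto)

lemma nth_elem_image:
  assumes "finite S" "strict_mono_on S \<phi>" "1 \<le> r" "r \<le> card S"
  shows "nth_elem (\<phi> ` S) r = \<phi> (nth_elem S r)"
  unfolding nth_elem_def sorted_list_of_set_strict_mono_image[OF assms(1,2)]
  using assms(3,4) by (intro nth_map) simp

lemma nth_elem_in: "finite S \<Longrightarrow> 1 \<le> r \<Longrightarrow> r \<le> card S \<Longrightarrow> nth_elem S r \<in> S"
  unfolding nth_elem_def using nth_mem[of "r - 1" "sorted_list_of_set S"] by simp

lemma nth_elem_mono:
  assumes "finite S" "1 \<le> r" "r < r'" "r' \<le> card S"
  shows "nth_elem S r < nth_elem S r'"
  unfolding nth_elem_def
  using sorted_wrt_nth_less[of "(<)" "sorted_list_of_set S" "r - 1" "r' - 1"] assms by simp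

lemma nth_elem_surj:
  assumes "finite S" "s \<in> S"
  obtains r where "1 \<le> r" "r \<le> card S" "nth_elem S r = s"
proof -
  obtain m where "m < card S" "sorted_list_of_set S ! m = s"
    using assms by (metis in_set_conv_nth length_sorted_list_of_set set_sorted_list_of_set)
  then show thesis by (intro that[of "Suc m"]) (auto simp: nth_elem_def)
qed

text \<open>The shape in terms of labels; \<open>boxes_shape\<close> identifies it with the one
  given by row lengths. In this form the effect of transposing two labels is a comparison of
  numbers.\<close>

definition shape_boxes :: "nat \<Rightarrow> nat \<Rightarrow> nat set set \<Rightarrow> (nat \<times> nat) set" where
  "shape_boxes n k M = {(r, c). r \<in> {1..k} \<and> c \<in> {1..n - k} \<and> src M r < snk n M c}"

definition plus_boxes :: "nat \<Rightarrow> nat \<Rightarrow> nat set set \<Rightarrow> (nat \<times> nat) set" where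
  "plus_boxes n k M = {(r, c) \<in> shape_boxes n k M. hook_basis M (src M r) (snk n M c) \<in> M}"

context tnn_matroid
begin

lemma card_cosources: "card ({1..n} - lexmin M) = n - k"
  using member[OF lexmin_in] by (simp add: card_Diff_subset)

lemma src_in_lexmin: "r \<in> {1..k} \<Longrightarrow> src M r \<in> lexmin M"
  unfolding src_def using member[OF lexmin_in] by (intro nth_elem_in) auto

lemma snk_notin_lexmin: "c \<in> {1..n - k} \<Longrightarrow> snk n M c \<in> {1..n} - lexmin M"
  unfolding snk_def using card_cosources by (intro nth_elem_in) auto

lemma src_mono: "1 \<le> r \<Longrightarrow> r < r' \<Longrightarrow> r' \<le> k \<Longrightarrow> src M r < src M r'"
  unfolding src_def using member[OF lexmin_in] by (intro nth_elem_mono) auto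

lemma snk_mono: "1 \<le> c \<Longrightarrow> c < c' \<Longrightarrow> c' \<le> n - k \<Longrightarrow> snk n M c < snk n M c'"
  unfolding snk_def using card_cosources by (intro nth_elem_mono) auto

lemma shape_boxes_closed:
  assumes "(r, c) \<in> shape_boxes n k M" "1 \<le> r'" "r' \<le> r" "c \<le> c'" "c' \<le> n - k"
  shows "(r', c') \<in> shape_boxes n k M"
proof -
  have "src M r' \<le> src M r" using assms src_mono[of r' r] by (cases "r' = r") (auto simp: shape_boxes_def)
  moreover have "snk n M c \<le> snk n M c'"
    using assms snk_mono[of c c'] by (cases "c' = c") (auto simp: shape_boxes_def)
  ultimately show ?thesis using assms by (auto simp: shape_boxes_def)
qed

end

text \<open>The union of the hooks of the boxes in \<open>P\<close>, listed by kinds of arcs: an arc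
  occurs as soon as some box of \<open>P\<close> suitably far to the left in its row, or high enough
  in its column, has a hook running over it. Columns are counted from the right, so a source is
  joined to the box with least \<open>c\<close>. The labels \<open>s\<close> and \<open>t\<close>
  are parameters because a removal relabels one row and one column.\<close>

definition hook_arcs ::
    "(nat \<times> nat) set \<Rightarrow> (nat \<Rightarrow> nat) \<Rightarrow> (nat \<Rightarrow> nat) \<Rightarrow> (nat \<times> nat) set \<Rightarrow> (vertex \<times> vertex) set" where
  "hook_arcs D s t P =
    {(Boundary (s r), Corner (r, c)) | r c. (r, c) \<in> D \<and> (\<forall>c'<c. (r, c') \<notin> D) \<and> (\<exists>c'. (r, c') \<in> P)} \<union>
    {(Corner (r, c), Corner (r, Suc c)) | r c. (r, c) \<in> D \<and> (\<exists>c'>c. (r, c') \<in> P)} \<union>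
    {(Corner (r, c), Corner (Suc r, c)) | r c. (Suc r, c) \<in> D \<and> (\<exists>r'\<le>r. (r', c) \<in> P)} \<union>
    {(Corner (r, c), Boundary (t c)) | r c. (r, c) \<in> D \<and> (\<forall>r'>r. (r', c) \<notin> D) \<and> (\<exists>r'. (r', c) \<in> P)}"

lemma hook_arcsI:
  "(r, c) \<in> D \<Longrightarrow> \<forall>c'<c. (r, c') \<notin> D \<Longrightarrow> (r, c') \<in> P \<Longrightarrow> (Boundary (s r), Corner (r, c)) \<in> hook_arcs D s t P"
  "(r, c) \<in> D \<Longrightarrow> c < c' \<Longrightarrow> (r, c') \<in> P \<Longrightarrow> (Corner (r, c), Corner (r, Suc c)) \<in> hook_arcs D s t P"
  "(Suc r, c) \<in> D \<Longrightarrow> r' \<le> r \<Longrightarrow> (r', c) \<in> P \<Longrightarrow> (Corner (r, c), Corner (Suc r, c)) \<in> hook_arcs D s t P"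
  "(r, c) \<in> D \<Longrightarrow> \<forall>r'>r. (r', c) \<notin> D \<Longrightarrow> (r', c) \<in> P \<Longrightarrow> (Corner (r, c), Boundary (t c)) \<in> hook_arcs D s t P"
  unfolding hook_arcs_def by auto

lemma hook_arcsE [consumes 1, case_names source left down sink]:
  assumes "(u, v) \<in> hook_arcs D s t P"
  obtains r c c' where "u = Boundary (s r)" "v = Corner (r, c)" "(r, c) \<in> D" "\<forall>c'<c. (r, c') \<notin> D" "(r, c') \<in> P"
    | r c c' where "u = Corner (r, c)" "v = Corner (r, Suc c)" "(r, c) \<in> D" "c < c'" "(r, c') \<in> P"
    | r c r' where "u = Corner (r, c)" "v = Corner (Suc r, c)" "(Suc r, c) \<in> D" "r' \<le> r" "(r', c) \<in> P"
    | r c r' where "u = Corner (r, c)" "v = Boundary (t c)" "(r, c) \<in> D" "\<forall>r'>r. (r', c) \<notin> D" "(r', c) \<in> P"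
  using assms unfolding hook_arcs_def by blast

definition Le_filling :: "(nat \<times> nat) set \<Rightarrow> (nat \<times> nat) set \<Rightarrow> bool" where
  "Le_filling D P \<longleftrightarrow> \<not> (\<exists>r c r' c'. (r, c) \<in> D - P \<and> r' < r \<and> (r', c) \<in> P \<and> c < c' \<and> (r, c') \<in> P)"

abbreviation matroid_arcs :: "nat \<Rightarrow> nat \<Rightarrow> nat set set \<Rightarrow> (vertex \<times> vertex) set" where
  "matroid_arcs n k M \<equiv> hook_arcs (shape_boxes n k M) (src M) (snk n M) (plus_boxes n k M)"

text \<open>Both claims of the final result in the form carried through the induction, with linkings
  in place of path families and membership in \<open>M\<close> in place of coordinates.\<close>

definition Le_represented :: "nat \<Rightarrow> nat \<Rightarrow> nat set set \<Rightarrow> bool" where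
  "Le_represented n k M \<longleftrightarrow> Le_filling (shape_boxes n k M) (plus_boxes n k M) \<and>
     (\<forall>J \<in> nsets {1..n} k. J \<in> M \<longleftrightarrow>
        linkable (matroid_arcs n k M) (Boundary ` lexmin M) (Boundary ` J))"

text \<open>As columns are counted from the right, a southeast corner is a box with no other box of
  \<open>D\<close> in a weakly larger row and a weakly smaller column. The primed labels are those
  after the removal, when the border passes the corner the other way round.\<close>

locale corner_box =
  fixes D P :: "(nat \<times> nat) set" and s t s' t' :: "nat \<Rightarrow> nat" and r0 c0 i :: nat
  assumes box: "(r0, c0) \<in> D" and P: "P \<subseteq> D"
    and corner: "\<And>r c. (r, c) \<in> D \<Longrightarrow> r0 \<le> r \<Longrightarrow> c \<le> c0 \<Longrightarrow> r = r0 \<and> c = c0"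
    and convex: "\<And>r c r1 c1 r' c'. (r, c) \<in> D \<Longrightarrow> (r1, c1) \<in> D \<Longrightarrow> r1 \<le> r' \<Longrightarrow> r' \<le> r \<Longrightarrow>
      c \<le> c' \<Longrightarrow> c' \<le> c1 \<Longrightarrow> (r', c') \<in> D"
    and s: "s r0 = i" "s' r0 = Suc i"
      "\<And>r c. (r, c) \<in> D \<Longrightarrow> r \<noteq> r0 \<Longrightarrow> s' r = s r \<and> s r \<noteq> i \<and> s r \<noteq> Suc i"
    and t: "t c0 = Suc i" "t' c0 = i"
      "\<And>r c. (r, c) \<in> D \<Longrightarrow> c \<noteq> c0 \<Longrightarrow> t' c = t c \<and> t c \<noteq> i \<and> t c \<noteq> Suc i"
begin

definition "H = {(u, v) \<in> hook_arcs D s t P. u \<noteq> Corner (r0, c0) \<and> v \<noteq> Corner (r0, c0)}"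
definition "U = {Corner (r, c0) | r. Suc r = r0 \<and> (\<exists>r'\<le>r. (r', c0) \<in> P)}"
definition "W = {Corner (r0, Suc c0) | c'. c' > c0 \<and> (r0, c') \<in> P}"

lemma right_of_corner: "(r0, c) \<in> D \<Longrightarrow> c0 \<le> c"
  using corner[of r0 c] by force

lemma above_corner: "(r, c0) \<in> D \<Longrightarrow> r \<le> r0"
  using corner[of r c0] by force

lemma arc_H:
  "(r, c) \<in> D \<Longrightarrow> \<forall>c'<c. (r, c') \<notin> D \<Longrightarrow> (r, c') \<in> P \<Longrightarrow> r \<noteq> r0 \<Longrightarrow> (Boundary (s r), Corner (r, c)) \<in> H"
  "(r, c) \<in> D \<Longrightarrow> c < c' \<Longrightarrow> (r, c') \<in> P \<Longrightarrow> (r, c) \<noteq> (r0, c0) \<Longrightarrow> (Corner (r, c), Corner (r, Suc c)) \<in> H"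
  "(Suc r, c) \<in> D \<Longrightarrow> r' \<le> r \<Longrightarrow> (r', c) \<in> P \<Longrightarrow> (Suc r, c) \<noteq> (r0, c0) \<Longrightarrow> (Corner (r, c), Corner (Suc r, c)) \<in> H"
  "(r, c) \<in> D \<Longrightarrow> \<forall>r'>r. (r', c) \<notin> D \<Longrightarrow> (r', c) \<in> P \<Longrightarrow> c \<noteq> c0 \<Longrightarrow> (Corner (r, c), Boundary (t c)) \<in> H"
proof -
  assume "(r, c) \<in> D" "c < c'" "(r, c') \<in> P" "(r, c) \<noteq> (r0, c0)"
  moreover from this have "(r, Suc c) \<noteq> (r0, c0)" using right_of_corner[of c] by auto
  ultimately show "(Corner (r, c), Corner (r, Suc c)) \<in> H" unfolding H_def hook_arcs_def by auto
next
  assume "(Suc r, c) \<in> D" "r' \<le> r" "(r', c) \<in> P" "(Suc r, c) \<noteq> (r0, c0)"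
  moreover from this have "(r, c) \<noteq> (r0, c0)" using above_corner[of "Suc r"] by auto
  ultimately show "(Corner (r, c), Corner (Suc r, c)) \<in> H" unfolding H_def hook_arcs_def by auto
qed (auto simp: H_def hook_arcs_def)

lemma arc_H_cases:
  assumes "(u, v) \<in> H"
  obtains (H_source) r c c' where "u = Boundary (s r)" "v = Corner (r, c)" "(r, c) \<in> D" "\<forall>c'<c. (r, c') \<notin> D"
      "(r, c') \<in> P" "r \<noteq> r0"
    | (H_left) r c c' where "u = Corner (r, c)" "v = Corner (r, Suc c)" "(r, c) \<in> D" "c < c'" "(r, c') \<in> P"
      "(r, c) \<noteq> (r0, c0)" "(r, c') \<noteq> (r0, c0)" "(r, Suc c) \<noteq> (r0, c0)"
    | (H_down) r c r' where "u = Corner (r, c)" "v = Corner (Suc r, c)" "(Suc r, c) \<in> D" "r' \<le> r" "(r', c) \<in> P"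
      "(Suc r, c) \<noteq> (r0, c0)" "(r', c) \<noteq> (r0, c0)" "(r, c) \<noteq> (r0, c0)"
    | (H_sink) r c r' where "u = Corner (r, c)" "v = Boundary (t c)" "(r, c) \<in> D" "\<forall>r'>r. (r', c) \<notin> D"
      "(r', c) \<in> P" "c \<noteq> c0"
proof -
  have nz: "u \<noteq> Corner (r0, c0)" "v \<noteq> Corner (r0, c0)" and arc: "(u, v) \<in> hook_arcs D s t P"
    using assms by (auto simp: H_def)
  from arc show thesis
  proof (cases rule: hook_arcsE)
    case (source r c c')
    have "r \<noteq> r0"
    proof
      assume "r = r0"
      then have "c0 \<le> c" "\<not> c0 < c" using source right_of_corner box by auto
      then show False using nz source \<open>r = r0\<close> by simp
    qed
    then show thesis using source H_source by blast
  next
    case (left r c c')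
    then have "(r, c') \<noteq> (r0, c0)" using right_of_corner[of c] by auto
    then show thesis using left nz H_left by blast
  next
    case (down r c r')
    then have "(r', c) \<noteq> (r0, c0)" using above_corner[of "Suc r"] by auto
    then show thesis using down nz H_down by blast
  next
    case (sink r c r')
    have "c \<noteq> c0"
    proof
      assume "c = c0"
      then have "r \<le> r0" "\<not> r < r0" using sink above_corner box by auto
      then show False using nz sink \<open>c = c0\<close> by simp
    qed
    then show thesis using sink H_sink by blast
  qed
qed

lemma H_avoids:
  assumes "(u, v) \<in> H"
  shows "u \<notin> {Boundary i, Boundary (Suc i), Corner (r0, c0)} \<and> v \<notin> {Boundary i, Boundary (Suc i), Corner (r0, c0)}"
  using assms
proof (cases rule: arc_H_cases)
  case (H_source r c c')
  then show ?thesis using s(3)[of r c] by auto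
next
  case (H_sink r c r')
  moreover have "(r, c) \<noteq> (r0, c0)" using H_sink by auto
  ultimately show ?thesis using t(3)[of r c] by auto
qed auto

sublocale corner_surgery H U W "Boundary i" "Boundary (Suc i)" "Corner (r0, c0)"
  by unfold_locales (use H_avoids in \<open>auto simp: U_def W_def\<close>)

text \<open>The two boundary arcs at the corner are conditional: they occur only if some hook runs
  along the row, respectively down the column, of the corner box. For a bridge its own hook does
  so.\<close>

lemma hook_arcs_eq:
  "hook_arcs D s t P = H \<union> U \<times> {Corner (r0, c0)} \<union> {Corner (r0, c0)} \<times> W \<union>
     {e. e = (Boundary i, Corner (r0, c0)) \<and> (\<exists>c'. (r0, c') \<in> P)} \<union>
     {e. e = (Corner (r0, c0), Boundary (Suc i)) \<and> (\<exists>r'. (r', c0) \<in> P)}" (is "?L = ?R")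
proof (intro equalityI subrelI)
  fix u v assume arc: "(u, v) \<in> ?L"
  show "(u, v) \<in> ?R"
  proof (cases "(u, v) \<in> H")
    case False
    then have z: "u = Corner (r0, c0) \<or> v = Corner (r0, c0)" using arc by (auto simp: H_def)
    from arc show ?thesis
    proof (cases rule: hook_arcsE)
      case (source r c c')
      then show ?thesis using z s(1) by auto
    next
      case (left r c c')
      then have "(r, Suc c) \<noteq> (r0, c0)" using right_of_corner[of c] by auto
      then have "r = r0" "c = c0" using left z by auto
      then show ?thesis using left by (auto simp: W_def)
    next
      case (down r c r')
      then have "(r, c) \<noteq> (r0, c0)" using above_corner[of "Suc r"] by auto
      then have "Suc r = r0" "c = c0" using down z by auto
      then show ?thesis using down by (auto simp: U_def)
    next
      case (sink r c r')
      then show ?thesis using z t(1) by auto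
    qed
  qed simp
next
  fix u v assume "(u, v) \<in> ?R"
  then consider "(u, v) \<in> H" | "u \<in> U" "v = Corner (r0, c0)" | "u = Corner (r0, c0)" "v \<in> W"
    | c' where "u = Boundary i" "v = Corner (r0, c0)" "(r0, c') \<in> P"
    | r' where "u = Corner (r0, c0)" "v = Boundary (Suc i)" "(r', c0) \<in> P" by blast
  then show "(u, v) \<in> ?L"
  proof cases
    case 1
    then show ?thesis by (simp add: H_def)
  next
    case 2
    then show ?thesis using box unfolding U_def by (auto intro: hook_arcsI)
  next
    case 3
    then show ?thesis using box unfolding W_def by (auto intro: hook_arcsI)
  next
    case 4
    moreover have "\<forall>c'<c0. (r0, c') \<notin> D" using right_of_corner by (meson leD)
    ultimately show ?thesis using hook_arcsI(1)[OF box, of c' P s t] s(1) by simp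
  next
    case 5
    moreover have "\<forall>r'>r0. (r', c0) \<notin> D" using above_corner by (meson leD)
    ultimately show ?thesis using hook_arcsI(4)[OF box, of r' P t s] t(1) by simp
  qed
qed

text \<open>Without the box its corner vertex falls apart into two boundary vertices: the column now
  ends one box higher, in the sink \<open>i\<close>, and the row starts one box further left, at the
  source \<open>Suc i\<close>.\<close>

lemma hook_arcs_removed_eq:
  "hook_arcs (D - {(r0, c0)}) s' t' (P - {(r0, c0)}) = H \<union> U \<times> {Boundary i} \<union> {Boundary (Suc i)} \<times> W"
    (is "?L = ?R")
proof (intro equalityI subrelI)
  let ?D = "D - {(r0, c0)}" and ?P = "P - {(r0, c0)}"
  fix u v assume "(u, v) \<in> ?L"
  then show "(u, v) \<in> ?R"
  proof (cases rule: hook_arcsE)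
    case (source r c c')
    show ?thesis
    proof (cases "r = r0")
      case True
      have c: "c0 < c" "c0 < c'" using source True right_of_corner[of c] right_of_corner[of c'] P by (auto simp: order_less_le)
      then have "(r0, Suc c0) \<in> D" using convex[OF box, of r0 c r0 "Suc c0"] source True by simp
      then have "c = Suc c0" using source(4) c True by (metis DiffI Pair_inject Suc_lessI n_not_Suc_n singletonD)
      then show ?thesis using source True c s(2) by (auto simp: W_def)
    next
      case False
      then show ?thesis using source arc_H(1)[of r c c'] s(3)[of r c] by auto
    qed
  next
    case (left r c c')
    then show ?thesis using arc_H(2) by auto
  next
    case (down r c r')
    then show ?thesis using arc_H(3) by auto
  next
    case (sink r c r')
    show ?thesis
    proof (cases "c = c0")
      case True
      have r: "r < r0" "r' < r0" using sink True above_corner[of r] above_corner[of r'] P by (auto simp: order_less_le)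
      have r_r': "r' \<le> r" using sink P True by (metis DiffD1 DiffD2 DiffI leI singletonI subsetD)
      have "Suc r = r0"
      proof (rule ccontr)
        assume "Suc r \<noteq> r0"
        then have "(Suc r, c0) \<in> D" "(Suc r, c0) \<noteq> (r0, c0)"
          using convex[OF box, of r c0 "Suc r" c0] sink True r by auto
        then show False using sink(4) True by auto
      qed
      then show ?thesis using sink True r_r' t(2) by (auto simp: U_def)
    next
      case False
      then show ?thesis using sink arc_H(4)[of r c r'] t(3)[of r c] by auto
    qed
  qed
next
  let ?D = "D - {(r0, c0)}" and ?P = "P - {(r0, c0)}"
  fix u v assume "(u, v) \<in> ?R"
  then consider "(u, v) \<in> H" | "u \<in> U" "v = Boundary i" | "u = Boundary (Suc i)" "v \<in> W" by blast
  then show "(u, v) \<in> ?L"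
  proof cases
    case 1
    then show ?thesis
    proof (cases rule: arc_H_cases)
      case (H_source r c c')
      then have "(Boundary (s' r), Corner (r, c)) \<in> ?L" by (intro hook_arcsI(1)) auto
      then show ?thesis using H_source s(3) by simp
    next
      case (H_left r c c')
      then have "(Corner (r, c), Corner (r, Suc c)) \<in> ?L" by (intro hook_arcsI(2)) auto
      then show ?thesis using H_left by simp
    next
      case (H_down r c r')
      then have "(Corner (r, c), Corner (Suc r, c)) \<in> ?L" by (intro hook_arcsI(3)) auto
      then show ?thesis using H_down by simp
    next
      case (H_sink r c r')
      then have "(Corner (r, c), Boundary (t' c)) \<in> ?L" by (intro hook_arcsI(4)) auto
      then show ?thesis using H_sink t(3) by simp
    qed
  next
    case 2
    then obtain r r' where r: "u = Corner (r, c0)" "Suc r = r0" "r' \<le> r" "(r', c0) \<in> P" by (auto simp: U_def)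
    have "(r, c0) \<in> ?D" using convex[OF box, of r' c0 r c0] r P by auto
    moreover have "\<forall>r'>r. (r', c0) \<notin> ?D"
    proof (intro allI impI notI)
      fix r' assume "r < r'" "(r', c0) \<in> ?D"
      then show False using above_corner[of r'] r(2) by simp
    qed
    moreover have "(r', c0) \<in> ?P" using r by auto
    ultimately have "(Corner (r, c0), Boundary (t' c0)) \<in> ?L" by (rule hook_arcsI(4))
    then show ?thesis using 2 r t(2) by simp
  next
    case 3
    then obtain c' where c: "v = Corner (r0, Suc c0)" "c0 < c'" "(r0, c') \<in> P" by (auto simp: W_def)
    have "(r0, Suc c0) \<in> ?D" using convex[OF box, of r0 c' r0 "Suc c0"] c P by auto
    moreover have "\<forall>c'<Suc c0. (r0, c') \<notin> ?D"
    proof (intro allI impI notI)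
      fix c' assume "c' < Suc c0" "(r0, c') \<in> ?D"
      then show False using right_of_corner[of c'] by simp
    qed
    moreover have "(r0, c') \<in> ?P" using c by auto
    ultimately have "(Boundary (s' r0), Corner (r0, Suc c0)) \<in> ?L" by (rule hook_arcsI(1))
    then show ?thesis using 3 c s(2) by simp
  qed
qed

end

section \<open>Shape and filling after the removal\<close>

locale box_removal = removable_step +
  assumes le_n: "Suc i \<le> n" and lex: "lexmin N = adj_swap i ` lexmin M"
    and hooks: "\<forall>p q. p \<in> lexmin M \<and> q \<notin> lexmin M \<and> q \<in> {1..n} \<and> p < q \<and> (p, q) \<noteq> (i, Suc i) \<longrightarrow>
      (hook_basis N (adj_swap i p) (adj_swap i q) \<in> N \<longleftrightarrow> hook_basis M p q \<in> M)"
begin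

definition "r0 = (SOME r. 1 \<le> r \<and> r \<le> k \<and> src M r = i)"
definition "c0 = (SOME c. 1 \<le> c \<and> c \<le> n - k \<and> snk n M c = Suc i)"

lemma lexmin_facts: "finite (lexmin M)" "card (lexmin M) = k" "lexmin M \<subseteq> {1..n}" "card ({1..n} - lexmin M) = n - k"
  using M.member[OF M.lexmin_in] M.card_cosources by auto

lemma r0: "1 \<le> r0" "r0 \<le> k" "src M r0 = i"
proof -
  have "\<exists>r. 1 \<le> r \<and> r \<le> k \<and> src M r = i"
    using nth_elem_surj[OF lexmin_facts(1) desc(1)] lexmin_facts(2) unfolding src_def by metis
  from someI_ex[OF this] show "1 \<le> r0" "r0 \<le> k" "src M r0 = i" unfolding r0_def by auto
qed

lemma c0: "1 \<le> c0" "c0 \<le> n - k" "snk n M c0 = Suc i"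
proof -
  have "\<exists>c. 1 \<le> c \<and> c \<le> n - k \<and> snk n M c = Suc i"
    using nth_elem_surj[of "{1..n} - lexmin M" "Suc i"] lexmin_facts(4) desc(2) le_n unfolding snk_def
    by (metis DiffI Suc_le_eq atLeastAtMost_iff finite_Diff finite_atLeastAtMost le_add1 plus_1_eq_Suc)
  from someI_ex[OF this] show "1 \<le> c0" "c0 \<le> n - k" "snk n M c0 = Suc i" unfolding c0_def by auto
qed

text \<open>Only one of the two transposed labels lies in the minimal basis, so the transposition is
  increasing on it and keeps positions in the list.\<close>

lemma src_N: "r \<in> {1..k} \<Longrightarrow> src N r = s (src M r)"
  unfolding src_def lex
  by (rule nth_elem_image) (use lexmin_facts desc in \<open>auto simp: strict_mono_on_def transpose_def\<close>)

lemma snk_N: "c \<in> {1..n - k} \<Longrightarrow> snk n N c = s (snk n M c)"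
proof -
  assume c: "c \<in> {1..n - k}"
  have i1: "1 \<le> i" using desc(1) lexmin_facts(3) by auto
  have "s ` {1..n} = {1..n}"
    using i1 le_n by (intro adj_swap_image_same) auto
  then have "s ` ({1..n} - lexmin M) = {1..n} - s ` lexmin M"
    by (simp only: image_set_diff[OF inj_transpose])
  then show "snk n N c = s (snk n M c)"
    unfolding snk_def lex using c lexmin_facts nth_elem_image[of "{1..n} - lexmin M" s c] desc
    by (auto simp: strict_mono_on_def transpose_def)
qed

lemma src_eq_iff: "r \<in> {1..k} \<Longrightarrow> src M r = i \<longleftrightarrow> r = r0"
  using M.src_mono[of r r0] M.src_mono[of r0 r] r0 by (metis atLeastAtMost_iff linorder_neqE_nat less_irrefl)

lemma snk_eq_iff: "c \<in> {1..n - k} \<Longrightarrow> snk n M c = Suc i \<longleftrightarrow> c = c0"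
  using M.snk_mono[of c c0] M.snk_mono[of c0 c] c0 by (metis atLeastAtMost_iff linorder_neqE_nat less_irrefl)

text \<open>Transposing two neighbours reverses a comparison only for the pair
  \<open>(i, Suc i)\<close> itself, which is why exactly one box disappears.\<close>

lemma src_snk_swap:
  assumes "r \<in> {1..k}" "c \<in> {1..n - k}"
  shows "s (src M r) < s (snk n M c) \<longleftrightarrow> src M r < snk n M c \<and> (r, c) \<noteq> (r0, c0)"
proof -
  have "src M r \<noteq> Suc i" "snk n M c \<noteq> i" "src M r \<noteq> snk n M c"
    using M.src_in_lexmin[OF assms(1)] M.snk_notin_lexmin[OF assms(2)] desc by auto
  then show ?thesis
    using src_eq_iff[OF assms(1)] snk_eq_iff[OF assms(2)] by (auto simp: transpose_def)
qed

lemma shape_boxes_N: "shape_boxes n k N = shape_boxes n k M - {(r0, c0)}"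
  using src_N snk_N src_snk_swap by (auto simp: shape_boxes_def)

lemma corner_in: "(r0, c0) \<in> shape_boxes n k M"
  using r0 c0 by (auto simp: shape_boxes_def)

lemma plus_boxes_N: "plus_boxes n k N = plus_boxes n k M - {(r0, c0)}"
proof -
  have "hook_basis N (src N r) (snk n N c) \<in> N \<longleftrightarrow> hook_basis M (src M r) (snk n M c) \<in> M"
    if "(r, c) \<in> shape_boxes n k M" "(r, c) \<noteq> (r0, c0)" for r c
  proof -
    have rc: "r \<in> {1..k}" "c \<in> {1..n - k}" "src M r < snk n M c"
      using that by (auto simp: shape_boxes_def)
    have "(src M r, snk n M c) \<noteq> (i, Suc i)"
      using that(2) src_eq_iff[OF rc(1)] snk_eq_iff[OF rc(2)] by auto
    then show ?thesis
      using hooks rc M.src_in_lexmin M.snk_notin_lexmin src_N snk_N by auto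
  qed
  then show ?thesis unfolding plus_boxes_def shape_boxes_N by auto
qed

lemma corner_box: "corner_box (shape_boxes n k M) (plus_boxes n k M) (src M) (snk n M) (src N) (snk n N) r0 c0 i"
proof
  show "(r0, c0) \<in> shape_boxes n k M" by (rule corner_in)
  show "plus_boxes n k M \<subseteq> shape_boxes n k M" by (auto simp: plus_boxes_def)
  show "r = r0 \<and> c = c0" if rc: "(r, c) \<in> shape_boxes n k M" "r0 \<le> r" "c \<le> c0" for r c
  proof -
    have "src M r0 \<le> src M r" using M.src_mono[of r0 r] rc r0 by (cases "r0 = r") (auto simp: shape_boxes_def)
    moreover have "snk n M c \<le> snk n M c0"
      using M.snk_mono[of c c0] rc c0 by (cases "c0 = c") (auto simp: shape_boxes_def)
    ultimately have "src M r = i" "snk n M c = Suc i" using rc(1) r0 c0 by (auto simp: shape_boxes_def)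
    then show ?thesis using src_eq_iff snk_eq_iff rc(1) by (auto simp: shape_boxes_def)
  qed
  show "(r', c') \<in> shape_boxes n k M"
    if rc: "(r, c) \<in> shape_boxes n k M" "(r1, c1) \<in> shape_boxes n k M" "r1 \<le> r'" "r' \<le> r" "c \<le> c'" "c' \<le> c1"
    for r c r1 c1 r' c'
    by (rule M.shape_boxes_closed[OF rc(1)]) (use rc in \<open>auto simp: shape_boxes_def\<close>)
  show "src M r0 = i" "src N r0 = Suc i" "snk n M c0 = Suc i" "snk n N c0 = i"
    using r0 c0 src_N[of r0] snk_N[of c0] by auto
  show "src N r = src M r \<and> src M r \<noteq> i \<and> src M r \<noteq> Suc i"
    if "(r, c) \<in> shape_boxes n k M" "r \<noteq> r0" for r c
  proof -
    have r: "r \<in> {1..k}" using that by (auto simp: shape_boxes_def)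
    have "src M r \<noteq> i" "src M r \<noteq> Suc i" using src_eq_iff[OF r] that(2) M.src_in_lexmin[OF r] desc by auto
    then show ?thesis using src_N[OF r] by (auto simp: transpose_def)
  qed
  show "snk n N c = snk n M c \<and> snk n M c \<noteq> i \<and> snk n M c \<noteq> Suc i"
    if "(r, c) \<in> shape_boxes n k M" "c \<noteq> c0" for r c
  proof -
    have c: "c \<in> {1..n - k}" using that by (auto simp: shape_boxes_def)
    have "snk n M c \<noteq> i" "snk n M c \<noteq> Suc i" using snk_eq_iff[OF c] that(2) M.snk_notin_lexmin[OF c] desc by auto
    then show ?thesis using snk_N[OF c] by (auto simp: transpose_def)
  qed
qed

lemma lexmin_M_insert: "Boundary ` lexmin M = insert (Boundary i) (Boundary ` (lexmin M - {i}))"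
  using desc by auto

lemma lexmin_N_insert: "Boundary ` lexmin N = insert (Boundary (Suc i)) (Boundary ` (lexmin M - {i}))"
  unfolding lex adj_swap_image_insert(1)[OF desc] by simp

lemma Boundary_swap: "Boundary ` s ` J = transpose (Boundary i) (Boundary (Suc i)) ` Boundary ` J"
  unfolding image_image by (rule image_cong) (auto simp: transpose_def)

lemma nsets_swap: "s ` J \<in> nsets {1..n} k \<longleftrightarrow> J \<in> nsets {1..n} k"
  using desc(1) lexmin_facts(3) le_n by (intro nsets_adj_swap) auto

end

lemma bridge_represented:
  assumes "bridge_removal n k M N i" "Suc i \<le> n" "Le_represented n k N"
  shows "Le_represented n k M"
proof -
  interpret bridge_removal n k M N i by fact
  interpret box_removal n k M N i
    by unfold_locales (use assms(2) lexmin_N hook_basis_mem_N in auto)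
  interpret B: corner_box "shape_boxes n k M" "plus_boxes n k M" "src M" "snk n M" "src N" "snk n N" r0 c0 i
    by (rule corner_box)
  note D_N = shape_boxes_N and P_N = plus_boxes_N
  have plus: "(r0, c0) \<in> plus_boxes n k M"
    using B.box hook_basis_corner r0 c0 by (auto simp: plus_boxes_def)
  have "Le_filling (shape_boxes n k M) (plus_boxes n k M)"
    unfolding Le_filling_def
  proof (intro notI, elim exE conjE)
    fix r c r' c' assume v: "(r, c) \<in> shape_boxes n k M - plus_boxes n k M" "r' < r" "(r', c) \<in> plus_boxes n k M"
      "c < c'" "(r, c') \<in> plus_boxes n k M"
    \<comment> \<open>No box of the shape lies below the corner box or to its right, so it cannot be
      one of the two offending boxes with \<open>Plus\<close>; and it is not the box with
      \<open>Zero\<close>, being filled with \<open>Plus\<close>.\<close>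
    have "(r', c) \<noteq> (r0, c0)" using B.above_corner[of r] v(1,2) by auto
    moreover have "(r, c') \<noteq> (r0, c0)" using B.right_of_corner[of c] v(1,4) by auto
    moreover have "(r, c) \<noteq> (r0, c0)" using v(1) plus by auto
    ultimately show False
      using assms(3) v unfolding Le_represented_def Le_filling_def D_N P_N by blast
  qed
  moreover have "J \<in> M \<longleftrightarrow> linkable (matroid_arcs n k M) (Boundary ` lexmin M) (Boundary ` J)"
    if J: "J \<in> nsets {1..n} k" for J
  proof -
    let ?x = "Boundary i" and ?y = "Boundary (Suc i)" and ?z = "Corner (r0, c0)"
    have N: "K \<in> N \<longleftrightarrow> linkable (B.H \<union> B.U \<times> {?x} \<union> {?y} \<times> B.W) (insert ?y (Boundary ` (lexmin M - {i}))) (Boundary ` K)"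
      if "K \<in> nsets {1..n} k" for K
      using assms(3) that unfolding Le_represented_def D_N P_N B.hook_arcs_removed_eq lexmin_N_insert by blast
    have "matroid_arcs n k M = B.H \<union> B.U \<times> {?z} \<union> {?z} \<times> B.W \<union> {(?x, ?z), (?z, ?y)}"
      unfolding B.hook_arcs_eq using plus by auto
    then have "linkable (matroid_arcs n k M) (Boundary ` lexmin M) (Boundary ` J) \<longleftrightarrow>
        linkable (B.H \<union> B.U \<times> {?x} \<union> {?y} \<times> B.W) (insert ?y (Boundary ` (lexmin M - {i}))) (Boundary ` J) \<or>
        ?x \<in> Boundary ` J \<and> ?y \<notin> Boundary ` J \<and>
        linkable (B.H \<union> B.U \<times> {?x} \<union> {?y} \<times> B.W) (insert ?y (Boundary ` (lexmin M - {i}))) (insert ?y (Boundary ` J - {?x}))"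
      unfolding lexmin_M_insert by (simp only:) (rule B.bridge_linkable, use desc in auto)
    \<comment> \<open>The alternatives of \<open>bridge_linkable\<close> become those of
      \<open>M_eq\<close>: moving a destination from \<open>i\<close> to \<open>Suc i\<close> is the
      transposition of \<open>J\<close>.\<close>
    also have "\<dots> \<longleftrightarrow> J \<in> N \<or> i \<in> J \<and> Suc i \<notin> J \<and> s ` J \<in> N"
    proof -
      have "insert ?y (Boundary ` J - {?x}) = Boundary ` s ` J" if "i \<in> J" "Suc i \<notin> J"
        unfolding adj_swap_image_insert(1)[OF that] by auto
      moreover have "?x \<in> Boundary ` J \<longleftrightarrow> i \<in> J" "?y \<in> Boundary ` J \<longleftrightarrow> Suc i \<in> J" by auto
      moreover have "s ` J \<in> nsets {1..n} k" using nsets_swap J by simp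
      ultimately show ?thesis using N[OF J] N[of "s ` J"] by metis
    qed
    finally show ?thesis using M_eq by blast
  qed
  ultimately show ?thesis unfolding Le_represented_def by blast
qed

lemma trivial_represented:
  assumes "trivial_removal n k M N i" "Suc i \<le> n" "Le_represented n k N"
  shows "Le_represented n k M"
proof -
  interpret trivial_removal n k M N i by fact
  interpret box_removal n k M N i
    by unfold_locales (use assms(2) lexmin_N hook_basis_mem_N in auto)
  interpret B: corner_box "shape_boxes n k M" "plus_boxes n k M" "src M" "snk n M" "src N" "snk n N" r0 c0 i
    by (rule corner_box)
  note D_N = shape_boxes_N and P_N = plus_boxes_N
  \<comment> \<open>An attached set gives up its source label and receives its sink label. So a
    coloop leaves no \<open>Plus\<close> in the row of the corner box and a loop none in its column;
    the corner box is a \<open>Zero\<close> that cannot violate the Le-condition.\<close>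
  have coloop: "(r0, c) \<notin> plus_boxes n k M" if "\<forall>J\<in>M. i \<in> J" for c
    using hook_basis_coloop[OF that] r0 by (auto simp: plus_boxes_def shape_boxes_def)
  have loop: "(r, c0) \<notin> plus_boxes n k M" if "\<forall>J\<in>M. Suc i \<notin> J" for r
    using hook_basis_loop[OF that] c0 by (auto simp: plus_boxes_def)
  have not_plus: "(r0, c0) \<notin> plus_boxes n k M" using loop_coloop coloop loop by blast
  have "Le_filling (shape_boxes n k M) (plus_boxes n k M)"
    unfolding Le_filling_def
  proof (intro notI, elim exE conjE)
    fix r c r' c' assume v: "(r, c) \<in> shape_boxes n k M - plus_boxes n k M" "r' < r" "(r', c) \<in> plus_boxes n k M"
      "c < c'" "(r, c') \<in> plus_boxes n k M"
    then have "(r, c) \<noteq> (r0, c0)" using loop_coloop coloop loop by blast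
    then show False
      using assms(3) v not_plus unfolding Le_represented_def Le_filling_def D_N P_N by blast
  qed
  moreover have "J \<in> M \<longleftrightarrow> linkable (matroid_arcs n k M) (Boundary ` lexmin M) (Boundary ` J)"
    if J: "J \<in> nsets {1..n} k" for J
  proof -
    let ?x = "Boundary i" and ?y = "Boundary (Suc i)" and ?z = "Corner (r0, c0)"
    let ?S = "Boundary ` (lexmin M - {i})"
    have "s ` J \<in> N \<longleftrightarrow> linkable (B.H \<union> B.U \<times> {?x} \<union> {?y} \<times> B.W) (insert ?y ?S) (Boundary ` s ` J)"
      using assms(3) J nsets_swap[of J]
      unfolding Le_represented_def D_N P_N B.hook_arcs_removed_eq lexmin_N_insert by blast
    then have N: "J \<in> M \<longleftrightarrow> linkable (B.H \<union> B.U \<times> {?x} \<union> {?y} \<times> B.W) (insert ?y ?S) (transpose ?x ?y ` Boundary ` J)"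
      unfolding mem_N Boundary_swap .
    from loop_coloop show ?thesis
    proof
      assume coloop': "\<forall>J\<in>M. i \<in> J"
      define Q where "Q = {e. e = (?z, ?y) \<and> (\<exists>r'. (r', c0) \<in> plus_boxes n k M)}"
      have W: "B.W = {}" unfolding B.W_def using coloop[OF coloop'] by auto
      have arcs: "matroid_arcs n k M = B.H \<union> B.U \<times> {?z} \<union> Q"
        unfolding B.hook_arcs_eq Q_def W using coloop[OF coloop'] by auto
      show ?thesis
      proof (cases "i \<in> J")
        case True
        have "linkable (B.H \<union> B.U \<times> {?z} \<union> Q) (insert ?x ?S) (Boundary ` J) \<longleftrightarrow>
            linkable (B.H \<union> B.U \<times> {?x}) (insert ?y ?S) (transpose ?x ?y ` Boundary ` J)"
          by (rule B.coloop_linkable) (use desc True W in \<open>auto simp: Q_def B.U_def\<close>)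
        then show ?thesis unfolding arcs lexmin_M_insert N W by simp
      next
        case False
        then have "J \<notin> M" using coloop' by blast
        moreover have "?x \<notin> Domain (matroid_arcs n k M)"
          unfolding arcs using B.H B.UW by (auto simp: Q_def)
        ultimately show ?thesis
          using linkable_ends(2)[of "matroid_arcs n k M" "Boundary ` lexmin M" "Boundary ` J" ?x] False desc(1) by auto
      qed
    next
      assume loop': "\<forall>J\<in>M. Suc i \<notin> J"
      define Q where "Q = {e. e = (?x, ?z) \<and> (\<exists>c'. (r0, c') \<in> plus_boxes n k M)}"
      have U: "B.U = {}" unfolding B.U_def using loop[OF loop'] by auto
      have arcs: "matroid_arcs n k M = B.H \<union> {?z} \<times> B.W \<union> Q"
        unfolding B.hook_arcs_eq Q_def U using loop[OF loop'] by auto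
      show ?thesis
      proof (cases "Suc i \<in> J")
        case False
        have "linkable (B.H \<union> {?z} \<times> B.W \<union> Q) (insert ?x ?S) (Boundary ` J) \<longleftrightarrow>
            linkable (B.H \<union> {?y} \<times> B.W) (insert ?y ?S) (transpose ?x ?y ` Boundary ` J)"
          by (rule B.loop_linkable) (use desc False U in \<open>auto simp: Q_def B.W_def\<close>)
        then show ?thesis unfolding arcs lexmin_M_insert N U by simp
      next
        case True
        then have "J \<notin> M" using loop' by blast
        moreover have "?y \<notin> Range (matroid_arcs n k M)"
          unfolding arcs using B.H B.UW by (auto simp: Q_def)
        ultimately show ?thesis
          using linkable_ends(1)[of "matroid_arcs n k M" "Boundary ` lexmin M" "Boundary ` J" ?y] True desc(2) by auto
      qed
    qed
  qed
  ultimately show ?thesis unfolding Le_represented_def by blast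
qed

text \<open>The minimal basis is closed upwards, so it consists of the \<open>k\<close> largest
  labels. No sink then follows a source, which means that there are no boxes, and no other
  \<open>k\<close>-set is lexicographically larger, so it is the only basis.\<close>

lemma base_represented:
  assumes "tnn_matroid n k M" and base: "\<And>i. i \<in> lexmin M \<Longrightarrow> Suc i \<le> n \<Longrightarrow> Suc i \<in> lexmin M"
  shows "Le_represented n k M"
proof -
  interpret tnn_matroid n k M by fact
  have up: "q \<in> lexmin M" if "p \<in> lexmin M" "p \<le> q" "q \<le> n" for p q
    using that(2,3,1) by (induction q rule: dec_induct) (auto intro: base)
  note facts = member[OF lexmin_in]
  have empty: "shape_boxes n k M = {}"
  proof -
    have "\<not> src M r < snk n M c" if "r \<in> {1..k}" "c \<in> {1..n - k}" for r c
    proof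
      assume less: "src M r < snk n M c"
      then show False using up[of "src M r" "snk n M c"] src_in_lexmin[of r] snk_notin_lexmin[of c] that by auto
    qed
    then show ?thesis by (auto simp: shape_boxes_def)
  qed
  have arcs: "matroid_arcs n k M = {}" unfolding hook_arcs_def empty plus_boxes_def by auto
  have M: "J = lexmin M" if J: "J \<in> M" for J
  proof (rule ccontr)
    assume "J \<noteq> lexmin M"
    then have "lex_less (lexmin M) J" by (rule lexmin_lex_less[OF J])
    then obtain m where m: "m \<in> lexmin M" "m \<notin> J" "\<And>t. t < m \<Longrightarrow> t \<in> lexmin M \<longleftrightarrow> t \<in> J"
      by (erule lex_lessE)
    have "J \<subseteq> lexmin M"
    proof
      fix j assume "j \<in> J"
      then show "j \<in> lexmin M" using m(3)[of j] up[OF m(1), of j] member(3)[OF J] by (cases "j < m") auto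
    qed
    then show False using m card_subset_eq[of "lexmin M" J] facts member[OF J] by auto
  qed
  have "linkable {} S T \<longleftrightarrow> S = T" for S T :: "vertex set"
    unfolding linkable_def linking_def by (auto intro!: exI[of _ "{}"])
  then have "J \<in> M \<longleftrightarrow> linkable (matroid_arcs n k M) (Boundary ` lexmin M) (Boundary ` J)" for J
    unfolding arcs using M lexmin_in by (metis inj_image_eq_iff injI vertex.inject(1))
  moreover have "Le_filling (shape_boxes n k M) (plus_boxes n k M)" by (auto simp: Le_filling_def empty)
  ultimately show ?thesis unfolding Le_represented_def by blast
qed

theorem nonneg_represented: "nonneg n k t f \<Longrightarrow> Le_represented n k (support n k f)"
  by (induction rule: support_induct) (blast intro: base_represented trivial_represented bridge_represented)+

section \<open>Path families in the graph of a Le-diagram\<close>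

lemma vwalk_arcs_split:
  "set (vwalk_arcs (p @ x # q)) = set (vwalk_arcs (p @ [x])) \<union> set (vwalk_arcs (x # q))"
  by (induction p rule: vwalk_arcs.induct) (cases q; auto)+

lemma vwalk_arcs_map_upt: "set (vwalk_arcs (map f [a..<Suc b])) = {(f j, f (Suc j)) | j. a \<le> j \<and> j < b}"
proof (induction b)
  case (Suc b)
  show ?case
  proof (cases "a \<le> b")
    case True
    then have "map f [a..<Suc (Suc b)] = map f [a..<b] @ f b # [f (Suc b)]"
      by (simp add: upt_Suc_append)
    moreover have "map f [a..<Suc b] = map f [a..<b] @ [f b]" using True by simp
    ultimately show ?thesis
      using Suc True by (simp add: vwalk_arcs_split[of _ "f b" "[f (Suc b)]"]) (auto simp: less_Suc_eq)
  next
    case False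
    then show ?thesis by (cases "a = Suc b") auto
  qed
qed (cases "a = 0"; auto)

lemma vwalk_arcs_member: "(u, v) \<in> set (vwalk_arcs p) \<Longrightarrow> u \<in> set p \<and> v \<in> set p"
  by (induction p rule: vwalk_arcs.induct) auto

lemma vwalk_arcs_Domain_Range:
  assumes "p \<noteq> []" "distinct p"
  shows "Range (set (vwalk_arcs p)) = set p - {hd p}" "Domain (set (vwalk_arcs p)) = set p - {last p}"
  using assms by (induction p rule: vwalk_arcs.induct) auto

lemma vwalk_arcs_single_valued:
  assumes "distinct p"
  shows "single_valued (set (vwalk_arcs p))" "single_valued ((set (vwalk_arcs p))\<inverse>)"
  using assms
proof (induction p rule: vwalk_arcs.induct)
  case (3 x y p)
  { case 1
    have "(x, v) \<notin> set (vwalk_arcs (y # p))" for v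
      using 1 vwalk_arcs_member[of x v "y # p"] by auto
    then show ?case using 1 3 by (auto simp: single_valued_def)
  next
    case 2
    have "(u, y) \<notin> set (vwalk_arcs (y # p))" for u
      using 2 vwalk_arcs_Domain_Range(1)[of "y # p"] by auto
    then show ?case using 2 3 by (auto simp: single_valued_def) }
qed (auto simp: single_valued_def)

lemma paths_imp_linkable:
  assumes paths: "\<And>i. i \<in> I \<Longrightarrow> p i \<noteq> [] \<and> distinct (p i) \<and> set (vwalk_arcs (p i)) \<subseteq> E \<and> hd (p i) = g i"
    and disjoint: "\<And>i i'. i \<in> I \<Longrightarrow> i' \<in> I \<Longrightarrow> i \<noteq> i' \<Longrightarrow> set (p i) \<inter> set (p i') = {}"
    and targets: "(\<lambda>i. last (p i)) ` I = T"
  shows "linkable E (g ` I) T"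
proof -
  let ?F = "\<Union>i\<in>I. set (vwalk_arcs (p i))"
  have same: "i = i'" if "v \<in> set (p i)" "v \<in> set (p i')" "i \<in> I" "i' \<in> I" for v i i'
    using disjoint[OF that(3,4)] that(1,2) by auto
  have ends: "g i \<in> set (p i)" "last (p i) \<in> set (p i)" if "i \<in> I" for i
    using paths[OF that] by (metis hd_in_set, metis last_in_set)
  have "linking E (g ` I) T ?F"
    unfolding linking_def
  proof (intro conjI allI)
    show "?F \<subseteq> E" using paths by blast
    show "single_valued ?F"
    proof (rule single_valuedI)
      fix u v w assume "(u, v) \<in> ?F" "(u, w) \<in> ?F"
      then obtain i i' where i: "i \<in> I" "(u, v) \<in> set (vwalk_arcs (p i))" "i' \<in> I" "(u, w) \<in> set (vwalk_arcs (p i'))" by auto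
      then have "i = i'" using same vwalk_arcs_member by metis
      then show "v = w" using i vwalk_arcs_single_valued(1)[of "p i"] paths[OF i(1)] by (auto simp: single_valued_def)
    qed
    show "single_valued (?F\<inverse>)"
    proof (rule single_valuedI)
      fix u v w assume "(u, v) \<in> ?F\<inverse>" "(u, w) \<in> ?F\<inverse>"
      then obtain i i' where i: "i \<in> I" "(v, u) \<in> set (vwalk_arcs (p i))" "i' \<in> I" "(w, u) \<in> set (vwalk_arcs (p i'))" by auto
      then have "i = i'" using same vwalk_arcs_member by metis
      then show "v = w" using i vwalk_arcs_single_valued(2)[of "p i"] paths[OF i(1)] by (auto simp: single_valued_def)
    qed
    fix v
    have "Range ?F = (\<Union>i\<in>I. Range (set (vwalk_arcs (p i))))" by auto
    also have "\<dots> = (\<Union>i\<in>I. set (p i) - {g i})"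
      by (rule SUP_cong[OF refl]) (metis vwalk_arcs_Domain_Range(1) paths)
    finally have Ran: "Range ?F = (\<Union>i\<in>I. set (p i) - {g i})" .
    have "Domain ?F = (\<Union>i\<in>I. Domain (set (vwalk_arcs (p i))))" by auto
    also have "\<dots> = (\<Union>i\<in>I. set (p i) - {last (p i)})"
      by (rule SUP_cong[OF refl]) (metis vwalk_arcs_Domain_Range(2) paths)
    finally have Dom: "Domain ?F = (\<Union>i\<in>I. set (p i) - {last (p i)})" .
    have "g ` I \<union> (\<Union>i\<in>I. set (p i) - {g i}) = (\<lambda>i. last (p i)) ` I \<union> (\<Union>i\<in>I. set (p i) - {last (p i)})"
      using ends by blast
    then show "v \<in> g ` I \<or> v \<in> Range ?F \<longleftrightarrow> v \<in> T \<or> v \<in> Domain ?F"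
      unfolding targets[symmetric] Ran Dom by blast
    show "\<not> (v \<in> g ` I \<and> v \<in> Range ?F)"
      using same ends unfolding Ran by blast
    show "\<not> (v \<in> T \<and> v \<in> Domain ?F)"
      using same ends unfolding Dom targets[symmetric] by blast
  qed
  then show ?thesis unfolding linkable_def by blast
qed

text \<open>A rank that increases along arcs excludes the cycles that a linking could otherwise
  contain besides its paths. Being bounded, it also allows induction both forwards to a destination
  and backwards to a start.\<close>

locale ranked_linking = linked_arcs +
  fixes rank :: "'a \<Rightarrow> nat" and b :: nat
  assumes rank: "\<And>u v. (u, v) \<in> E \<Longrightarrow> rank u < rank v \<and> rank v \<le> b"
begin

lemma source: "v \<in> S \<Longrightarrow> v \<notin> Range F" and target: "v \<in> T \<Longrightarrow> v \<notin> Domain F"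
  using disjoint by auto

lemma path_exists:
  assumes "v \<in> S \<or> v \<in> Range F"
  shows "\<exists>p. p \<noteq> [] \<and> hd p = v \<and> last p \<in> T \<and> set (vwalk_arcs p) \<subseteq> F \<and> distinct p \<and> (\<forall>u\<in>set p. rank v \<le> rank u)"
  using assms
proof (induction "b - rank v" arbitrary: v rule: less_induct)
  case less
  show ?case
  proof (cases "v \<in> T")
    case True
    then show ?thesis by (intro exI[of _ "[v]"]) auto
  next
    case False
    then obtain w where w: "(v, w) \<in> F" using flow[of v] less.prems by auto
    then have "rank v < rank w" "rank w \<le> b" using rank subset by auto
    then obtain p where p: "p \<noteq> []" "hd p = w" "last p \<in> T" "set (vwalk_arcs p) \<subseteq> F" "distinct p" "\<forall>u\<in>set p. rank w \<le> rank u"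
      using less.hyps[of w] w by (metis Range.intros diff_less_mono2 less_le_trans)
    then have "\<forall>u\<in>set p. rank v < rank u" using \<open>rank v < rank w\<close> by fastforce
    then have "distinct (v # p)" "\<forall>u\<in>set (v # p). rank v \<le> rank u" using p(5) by (auto simp: less_imp_le)
    then show ?thesis
      using w p(1-4) by (intro exI[of _ "v # p"]) (simp add: vwalk_arcs_Cons)
  qed
qed

text \<open>Predecessors in a linking are unique, so two paths through a common vertex can be traced
  back along the same vertices until they reach the same start.\<close>

lemma paths_disjoint:
  assumes p: "set (vwalk_arcs p) \<subseteq> F" "p \<noteq> []" "distinct p" "hd p \<in> S" "v \<in> set p"
    and q: "set (vwalk_arcs q) \<subseteq> F" "q \<noteq> []" "distinct q" "hd q \<in> S" "v \<in> set q"
  shows "hd p = hd q"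
  using p(5) q(5)
proof (induction "rank v" arbitrary: v rule: less_induct)
  case less
  have pred: "v = hd r \<or> (\<exists>u. (u, v) \<in> F \<and> u \<in> set r)"
    if "set (vwalk_arcs r) \<subseteq> F" "r \<noteq> []" "distinct r" "v \<in> set r" for r
  proof (cases "v = hd r")
    case False
    then have "v \<in> Range (set (vwalk_arcs r))" using vwalk_arcs_Domain_Range(1)[OF that(2,3)] that(4) by simp
    then obtain u where "(u, v) \<in> set (vwalk_arcs r)" by auto
    then show ?thesis using that(1) vwalk_arcs_member[of u v r] by auto
  qed simp
  show ?case
  proof (cases "v \<in> S")
    case True
    then show ?thesis using pred[OF p(1-3) less.prems(1)] pred[OF q(1-3) less.prems(2)] source by (metis Range.intros)
  next
    case False
    then obtain u u' where u: "(u, v) \<in> F" "u \<in> set p" "(u', v) \<in> F" "u' \<in> set q"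
      using pred[OF p(1-3) less.prems(1)] pred[OF q(1-3) less.prems(2)] p(4) q(4) by metis
    then have "u = u'" using inj(2) by metis
    then show ?thesis using less.hyps[of u] u rank subset by blast
  qed
qed

lemma linking_imp_paths:
  obtains p where "\<And>s. s \<in> S \<Longrightarrow> p s \<noteq> [] \<and> hd (p s) = s \<and> distinct (p s) \<and> set (vwalk_arcs (p s)) \<subseteq> E"
    "\<And>s s'. s \<in> S \<Longrightarrow> s' \<in> S \<Longrightarrow> s \<noteq> s' \<Longrightarrow> set (p s) \<inter> set (p s') = {}"
    "(\<lambda>s. last (p s)) ` S = T"
proof -
  obtain p where p: "\<And>s. s \<in> S \<Longrightarrow> p s \<noteq> [] \<and> hd (p s) = s \<and> last (p s) \<in> T \<and> set (vwalk_arcs (p s)) \<subseteq> F \<and> distinct (p s)"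
    using path_exists by metis
  show thesis
  proof
    fix s assume "s \<in> S"
    then show "p s \<noteq> [] \<and> hd (p s) = s \<and> distinct (p s) \<and> set (vwalk_arcs (p s)) \<subseteq> E" using p subset by blast
  next
    fix s s' assume s: "s \<in> S" "s' \<in> S" "s \<noteq> s'"
    show "set (p s) \<inter> set (p s') = {}"
    proof (rule ccontr)
      assume "set (p s) \<inter> set (p s') \<noteq> {}"
      then obtain v where "v \<in> set (p s)" "v \<in> set (p s')" by auto
      then have "hd (p s) = hd (p s')" using paths_disjoint[of "p s" v "p s'"] p[OF s(1)] p[OF s(2)] s by auto
      then show False using p s by auto
    qed
  next
    \<comment> \<open>This is what shows that all of \<open>T\<close> is attained: a vertex of the
      linking is traced back to a path from \<open>S\<close>, and since successors are unique that
      path runs on through the vertex.\<close>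
    have cover: "\<exists>s\<in>S. v \<in> set (p s)" if "v \<in> S \<or> v \<in> Range F" for v
      using that
    proof (induction "rank v" arbitrary: v rule: less_induct)
      case less
      show ?case
      proof (cases "v \<in> S")
        case True
        then show ?thesis using p[of v] by (metis hd_in_set)
      next
        case False
        then obtain u where u: "(u, v) \<in> F" using less.prems by auto
        then obtain s where s: "s \<in> S" "u \<in> set (p s)" using less.hyps[of u] rank subset flow[of u] by blast
        have "u \<noteq> last (p s)" using p[OF s(1)] target u by blast
        then have "u \<in> Domain (set (vwalk_arcs (p s)))" using vwalk_arcs_Domain_Range(2)[of "p s"] p[OF s(1)] s by auto
        then obtain w where w: "(u, w) \<in> set (vwalk_arcs (p s))" by auto
        then have "w = v" using p[OF s(1)] u inj(1) by blast
        then show ?thesis using w s vwalk_arcs_member[OF w] by auto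
      qed
    qed
    show "(\<lambda>s. last (p s)) ` S = T"
    proof (intro equalityI subsetI)
      fix v assume v: "v \<in> T"
      then obtain s where s: "s \<in> S" "v \<in> set (p s)" using cover flow[of v] by blast
      have "v \<notin> Domain (set (vwalk_arcs (p s)))" using target[OF v] p[OF s(1)] by blast
      then have "v = last (p s)" using vwalk_arcs_Domain_Range(2)[of "p s"] p[OF s(1)] s by auto
      then show "v \<in> (\<lambda>s. last (p s)) ` S" using s by auto
    qed (use p in auto)
  qed
qed

end

lemma card_less_nth_elem:
  assumes "finite C" "1 \<le> c" "c \<le> card C"
  shows "card {j \<in> C. j < nth_elem C c} = c - 1"
proof -
  let ?m = "nth_elem C c" and ?xs = "sorted_list_of_set C" and ?l = "sorted_list_of_set (C \<inter> {..<nth_elem C c})"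
  note split = sorted_list_of_set_split[OF assms(1) nth_elem_in[OF assms]]
  have "length ?l < length ?xs" by (subst split) simp
  moreover have "?xs ! length ?l = ?m" by (subst split) (rule nth_append_length)
  moreover have "?xs ! (c - 1) = ?m" "c - 1 < length ?xs" using assms by (simp_all add: nth_elem_def)
  ultimately have "length ?l = c - 1"
    by (metis distinct_sorted_list_of_set nth_eq_iff_index_eq)
  moreover have "C \<inter> {..<?m} = {j \<in> C. j < ?m}" by auto
  ultimately show ?thesis by simp
qed

lemma card_less_iff_nth_elem:
  assumes "finite C" "1 \<le> c" "c \<le> card C"
  shows "card {j \<in> C. j < p} < c \<longleftrightarrow> p \<le> nth_elem C c"
proof
  assume "p \<le> nth_elem C c"
  then have "{j \<in> C. j < p} \<subseteq> {j \<in> C. j < nth_elem C c}" by auto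
  then have "card {j \<in> C. j < p} \<le> c - 1"
    unfolding card_less_nth_elem[OF assms, symmetric] using assms(1) by (intro card_mono) auto
  then show "card {j \<in> C. j < p} < c" using assms by simp
next
  assume less: "card {j \<in> C. j < p} < c"
  show "p \<le> nth_elem C c"
  proof (rule ccontr)
    assume "\<not> p \<le> nth_elem C c"
    then have "insert (nth_elem C c) {j \<in> C. j < nth_elem C c} \<subseteq> {j \<in> C. j < p}"
      using nth_elem_in[OF assms] by auto
    then have "card (insert (nth_elem C c) {j \<in> C. j < nth_elem C c}) \<le> card {j \<in> C. j < p}"
      using assms(1) by (intro card_mono) auto
    then show False using less card_less_nth_elem[OF assms] assms by simp
  qed
qed

section \<open>The Gamma-graph belonging to the minimal basis\<close>

context tnn_matroid
begin

lemma k_le_n: "k \<le> n"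
  using member[OF lexmin_in] card_mono[of "{1..n}" "lexmin M"] by simp

lemma sources_shape: "sources k n (shape n M) = lexmin M"
  unfolding shape_def Let_def using member[OF lexmin_in] by (intro sources_border) auto

lemma length_shape: "length (shape n M) = k"
  unfolding shape_def Let_def using member[OF lexmin_in] by simp

lemma shape_nth: "r \<in> {1..k} \<Longrightarrow> shape n M ! (r - 1) = card {j \<in> {1..n} - lexmin M. src M r < j}"
  unfolding shape_def Let_def src_def nth_elem_def using member[OF lexmin_in] by (subst nth_map) auto

text \<open>The sinks preceding the source of row \<open>r\<close> label the columns to the right of
  that row, and their number is \<open>n - k\<close> minus its length. So column \<open>c\<close>
  meets the row iff fewer than \<open>c\<close> sinks precede the source.\<close>

lemma boxes_shape: "boxes k n (shape n M) = shape_boxes n k M"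
proof -
  have "n - k - shape n M ! (r - 1) < c \<longleftrightarrow> src M r < snk n M c" if r: "r \<in> {1..k}" and c: "c \<in> {1..n - k}" for r c
  proof -
    let ?C = "{1..n} - lexmin M"
    have ne: "j \<noteq> src M r" if "j \<in> ?C" for j using src_in_lexmin[OF r] that by auto
    have "j < src M r \<or> src M r < j" if "j \<in> ?C" for j using ne[OF that] by linarith
    then have "?C = {j \<in> ?C. j < src M r} \<union> {j \<in> ?C. src M r < j}" by blast
    then have "card ?C = card ({j \<in> ?C. j < src M r} \<union> {j \<in> ?C. src M r < j})" by (rule arg_cong)
    also have "\<dots> = card {j \<in> ?C. j < src M r} + card {j \<in> ?C. src M r < j}"
      by (rule card_Un_disjoint) auto
    finally have "n - k - shape n M ! (r - 1) = card {j \<in> ?C. j < src M r}"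
      unfolding shape_nth[OF r] card_cosources by simp
    also have "\<dots> < c \<longleftrightarrow> src M r \<le> snk n M c"
      unfolding snk_def using c card_cosources by (intro card_less_iff_nth_elem) auto
    also have "\<dots> \<longleftrightarrow> src M r < snk n M c"
      using ne[OF snk_notin_lexmin[OF c]] by auto
    finally show ?thesis .
  qed
  then show ?thesis unfolding boxes_def shape_boxes_def by auto
qed

lemma partition_shape: "partition_in_rect k (n - k) (shape n M)"
  unfolding partition_in_rect_def
proof (intro conjI)
  show "length (shape n M) = k" by (rule length_shape)
  have "sorted_wrt (<) (sorted_list_of_set (lexmin M))" by simp
  then show "sorted_wrt (\<ge>) (shape n M)"
    unfolding shape_def Let_def sorted_wrt_map
    by (rule sorted_wrt_mono_rel[rotated]) (auto intro!: card_mono)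
  show "set (shape n M) \<subseteq> {0..n - k}"
    unfolding shape_def Let_def using card_cosources by (auto intro!: card_mono simp flip: card_cosources)
qed

lemma upt_split: "a \<le> b \<Longrightarrow> b \<le> c \<Longrightarrow> [a..<c] = [a..<b] @ [b..<c]"
  using upt_add_eq_append[of a b "c - b"] by simp

lemma concat_map_if_upt:
  assumes "a \<le> b" "b \<le> d" "a0 \<le> a" "\<And>j. a0 \<le> j \<Longrightarrow> j < d \<Longrightarrow> Q j \<longleftrightarrow> a \<le> j \<and> j < b"
  shows "concat (map (\<lambda>j. if Q j then [f j] else []) [a0..<d]) = map f [a..<b]"
proof -
  have "[a0..<d] = [a0..<a] @ [a..<b] @ [b..<d]"
    using assms(1-3) upt_split[of a0 a d] upt_split[of a b d] by simp
  moreover have "concat (map (\<lambda>j. if Q j then [f j] else []) [a0..<a]) = []"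
    "concat (map (\<lambda>j. if Q j then [f j] else []) [b..<d]) = []"
    using assms by auto
  moreover have "concat (map (\<lambda>j. if Q j then [f j] else []) [a..<b]) = map f [a..<b]"
  proof -
    have eq: "map (\<lambda>j. if Q j then [f j] else []) [a..<b] = map (\<lambda>j. [f j]) [a..<b]"
      using assms by (intro map_cong) auto
    show ?thesis unfolding eq by (rule concat_map_singleton)
  qed
  ultimately show ?thesis by (simp only: map_append concat_append) simp
qed

text \<open>The list is split at \<open>Corner (r, c)\<close>, where the hook turns, so that its
  horizontal and vertical arcs can be computed separately. \<open>a\<close> is the rightmost column
  of the row and \<open>b\<close> the lowest row of the column within the shape.\<close>

lemma hook_shape:
  assumes rc: "(r, c) \<in> shape_boxes n k M"
  obtains a b where "(r, a) \<in> shape_boxes n k M" "\<forall>c'<a. (r, c') \<notin> shape_boxes n k M" "a \<le> c"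
    "(b, c) \<in> shape_boxes n k M" "\<forall>r'>b. (r', c) \<notin> shape_boxes n k M" "r \<le> b"
    "hook k n (shape n M) (r, c) = (Boundary (src M r) # map (\<lambda>c'. Corner (r, c')) [a..<c]) @ Corner (r, c) #
       (map (\<lambda>r'. Corner (r', c)) [Suc r..<Suc b] @ [Boundary (snk n M c)])"
proof -
  let ?D = "shape_boxes n k M"
  define a where "a = (LEAST c'. (r, c') \<in> ?D)"
  have a: "(r, a) \<in> ?D" "\<forall>c'<a. (r, c') \<notin> ?D" "a \<le> c"
    unfolding a_def using LeastI[of "\<lambda>c'. (r, c') \<in> ?D" c] rc not_less_Least Least_le[of "\<lambda>c'. (r, c') \<in> ?D" c] by auto
  define b where "b = Max {r'. (r', c) \<in> ?D}"
  have fin: "finite {r'. (r', c) \<in> ?D}" by (rule finite_subset[of _ "{1..k}"]) (auto simp: shape_boxes_def)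
  have b: "(b, c) \<in> ?D" "\<forall>r'>b. (r', c) \<notin> ?D" "r \<le> b"
  proof -
    show "(b, c) \<in> ?D" using Max_in[OF fin] rc unfolding b_def by auto
    show "\<forall>r'>b. (r', c) \<notin> ?D"
    proof (intro allI impI notI)
      fix r' assume "b < r'" "(r', c) \<in> ?D"
      then show False using Max_ge[OF fin, of r'] unfolding b_def by simp
    qed
    show "r \<le> b" using Max_ge[OF fin, of r] rc unfolding b_def by simp
  qed
  have bounds: "1 \<le> a" "c \<le> n - k" "1 \<le> r" "b \<le> k" using a b rc by (auto simp: shape_boxes_def)
  have row: "(r, c') \<in> ?D \<longleftrightarrow> a \<le> c' \<and> c' < Suc c" if "1 \<le> c'" "c' < Suc c" for c'
    using that a(2) shape_boxes_closed[OF rc, of r c'] shape_boxes_closed[OF a(1), of r c'] bounds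
    by (meson leI le_trans less_Suc_eq_le order.refl)
  have col: "(r', c) \<in> ?D \<longleftrightarrow> Suc r \<le> r' \<and> r' < Suc b" if "Suc r \<le> r'" "r' < Suc k" for r'
    using that b(2) shape_boxes_closed[OF b(1), of r' c] bounds
    by (metis Suc_leD le_trans less_Suc_eq_le not_less order.refl)
  have "hook k n (shape n M) (r, c) = [Boundary (src M r)] @ map (\<lambda>c'. Corner (r, c')) [a..<Suc c] @
      map (\<lambda>r'. Corner (r', c)) [Suc r..<Suc b] @ [Boundary (snk n M c)]"
  proof -
    have 1: "concat (map (\<lambda>c'. if (r, c') \<in> ?D then [Corner (r, c')] else []) [1..<Suc c]) = map (\<lambda>c'. Corner (r, c')) [a..<Suc c]"
      by (rule concat_map_if_upt) (use row a bounds in auto)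
    have 2: "concat (map (\<lambda>r'. if (r', c) \<in> ?D then [Corner (r', c)] else []) [Suc r..<Suc k]) = map (\<lambda>r'. Corner (r', c)) [Suc r..<Suc b]"
      by (rule concat_map_if_upt) (use col b bounds in auto)
    have 3: "nth_elem (sources k n (shape n M)) r = src M r" "nth_elem (sinks k n (shape n M)) c = snk n M c"
      unfolding sinks_def sources_shape src_def snk_def by auto
    show ?thesis unfolding hook_def boxes_shape prod.case 1 2 3 by simp
  qed
  moreover have "map (\<lambda>c'. Corner (r, c')) [a..<Suc c] = map (\<lambda>c'. Corner (r, c')) [a..<c] @ [Corner (r, c)]"
    using a(3) by simp
  ultimately show thesis using that[OF a b] by simp
qed

lemma hook_vwalk_arcs:
  assumes rc: "(r, c) \<in> shape_boxes n k M"
  shows "set (vwalk_arcs (hook k n (shape n M) (r, c))) =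
    {(Boundary (src M r), Corner (r, a)) | a. (r, a) \<in> shape_boxes n k M \<and> (\<forall>c'<a. (r, c') \<notin> shape_boxes n k M)} \<union>
    {(Corner (r, c'), Corner (r, Suc c')) | c'. (r, c') \<in> shape_boxes n k M \<and> c' < c} \<union>
    {(Corner (r', c), Corner (Suc r', c)) | r'. (Suc r', c) \<in> shape_boxes n k M \<and> r \<le> r'} \<union>
    {(Corner (b, c), Boundary (snk n M c)) | b. (b, c) \<in> shape_boxes n k M \<and> (\<forall>r'>b. (r', c) \<notin> shape_boxes n k M)}"
proof -
  let ?D = "shape_boxes n k M"
  obtain a b where a: "(r, a) \<in> ?D" "\<forall>c'<a. (r, c') \<notin> ?D" "a \<le> c"
    and b: "(b, c) \<in> ?D" "\<forall>r'>b. (r', c) \<notin> ?D" "r \<le> b"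
    and hook: "hook k n (shape n M) (r, c) = (Boundary (src M r) # map (\<lambda>c'. Corner (r, c')) [a..<c]) @ Corner (r, c) #
       (map (\<lambda>r'. Corner (r', c)) [Suc r..<Suc b] @ [Boundary (snk n M c)])"
    using hook_shape[OF rc] by blast
  let ?row = "map (\<lambda>c'. Corner (r, c')) [a..<Suc c]" and ?col = "map (\<lambda>r'. Corner (r', c)) [r..<Suc b]"
  have a_uniq: "a' = a" if "(r, a') \<in> ?D" "\<forall>c'<a'. (r, c') \<notin> ?D" for a'
    using a that by (meson linorder_neqE_nat)
  have b_uniq: "b' = b" if "(b', c) \<in> ?D" "\<forall>r'>b'. (r', c) \<notin> ?D" for b'
    using b that by (meson linorder_neqE_nat)
  have row_ne: "?row \<noteq> []" and row_hd: "hd ?row = Corner (r, a)" using a(3) by (auto simp del: upt_Suc simp: hd_map)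
  have col_ne: "?col \<noteq> []" and col_last: "last ?col = Corner (b, c)" using b(3) by (auto simp: last_map)
  have "set (vwalk_arcs (hook k n (shape n M) (r, c))) =
      set (vwalk_arcs (Boundary (src M r) # ?row)) \<union> set (vwalk_arcs (?col @ [Boundary (snk n M c)]))"
  proof -
    have "(Boundary (src M r) # map (\<lambda>c'. Corner (r, c')) [a..<c]) @ [Corner (r, c)] = Boundary (src M r) # ?row"
      using a(3) by simp
    moreover have "Corner (r, c) # (map (\<lambda>r'. Corner (r', c)) [Suc r..<Suc b] @ [Boundary (snk n M c)]) = ?col @ [Boundary (snk n M c)]"
      using b(3) by (simp add: upt_conv_Cons del: upt_Suc)
    ultimately show ?thesis unfolding hook by (subst vwalk_arcs_split) (simp only:)
  qed
  also have "set (vwalk_arcs (Boundary (src M r) # ?row)) = insert (Boundary (src M r), Corner (r, a)) (set (vwalk_arcs ?row))"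
    using vwalk_arcs_Cons[OF row_ne] row_hd by simp
  also have "set (vwalk_arcs (?col @ [Boundary (snk n M c)])) = insert (Corner (b, c), Boundary (snk n M c)) (set (vwalk_arcs ?col))"
    using set_vwalk_arcs_snoc[OF col_ne] col_last by simp
  also have "set (vwalk_arcs ?row) = {(Corner (r, j), Corner (r, Suc j)) | j. a \<le> j \<and> j < c}" by (rule vwalk_arcs_map_upt)
  also have "\<dots> = {(Corner (r, c'), Corner (r, Suc c')) | c'. (r, c') \<in> ?D \<and> c' < c}"
  proof -
    have "a \<le> j \<and> j < c \<longleftrightarrow> (r, j) \<in> ?D \<and> j < c" for j
    proof -
      have "1 \<le> r" "c \<le> n - k" using rc by (auto simp: shape_boxes_def)
      then show ?thesis using a(2) shape_boxes_closed[OF a(1), of r j] by (meson leI le_trans less_imp_le order.refl)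
    qed
    then show ?thesis by simp
  qed
  also have "set (vwalk_arcs ?col) = {(Corner (j, c), Corner (Suc j, c)) | j. r \<le> j \<and> j < b}" by (rule vwalk_arcs_map_upt)
  also have "\<dots> = {(Corner (r', c), Corner (Suc r', c)) | r'. (Suc r', c) \<in> ?D \<and> r \<le> r'}"
  proof -
    have "r \<le> j \<and> j < b \<longleftrightarrow> (Suc j, c) \<in> ?D \<and> r \<le> j" for j
    proof -
      have "c \<le> n - k" using rc by (auto simp: shape_boxes_def)
      then show ?thesis using b(2) shape_boxes_closed[OF b(1), of "Suc j" c]
        by (metis Suc_leI le_add1 not_less not_less_eq order.refl plus_1_eq_Suc)
    qed
    then show ?thesis by simp
  qed
  finally have arcs: "set (vwalk_arcs (hook k n (shape n M) (r, c))) =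
      insert (Boundary (src M r), Corner (r, a)) {(Corner (r, c'), Corner (r, Suc c')) | c'. (r, c') \<in> ?D \<and> c' < c} \<union>
      insert (Corner (b, c), Boundary (snk n M c)) {(Corner (r', c), Corner (Suc r', c)) | r'. (Suc r', c) \<in> ?D \<and> r \<le> r'}" .
  have "{(Boundary (src M r), Corner (r, a)) | a. (r, a) \<in> ?D \<and> (\<forall>c'<a. (r, c') \<notin> ?D)} = {(Boundary (src M r), Corner (r, a))}"
    using a(1,2) a_uniq by blast
  moreover have "{(Corner (b, c), Boundary (snk n M c)) | b. (b, c) \<in> ?D \<and> (\<forall>r'>b. (r', c) \<notin> ?D)} = {(Corner (b, c), Boundary (snk n M c))}"
    using b(1,2) b_uniq by blast
  ultimately show ?thesis unfolding arcs by (simp only: insert_is_Un[of _ "Collect _"] Un_ac)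
qed

lemma Gamma_graph_arcs:
  assumes L: "{B \<in> shape_boxes n k M. L B = Plus} = plus_boxes n k M"
  shows "parcs (Gamma_graph k n (shape n M) L) = matroid_arcs n k M"
proof -
  let ?D = "shape_boxes n k M" and ?P = "plus_boxes n k M"
  have PD: "?P \<subseteq> ?D" by (auto simp: plus_boxes_def)
  have "parcs (Gamma_graph k n (shape n M) L) = (\<Union>B\<in>?P. set (vwalk_arcs (hook k n (shape n M) B)))"
    unfolding Gamma_graph_def Let_def boxes_shape L by simp
  also have "\<dots> = matroid_arcs n k M"
  proof (intro equalityI subrelI)
    fix u v assume "(u, v) \<in> (\<Union>B\<in>?P. set (vwalk_arcs (hook k n (shape n M) B)))"
    then obtain r c where rc: "(r, c) \<in> ?P" and uv: "(u, v) \<in> set (vwalk_arcs (hook k n (shape n M) (r, c)))" by auto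
    then have "(r, c) \<in> ?D" using PD by auto
    from uv[unfolded hook_vwalk_arcs[OF this]] show "(u, v) \<in> matroid_arcs n k M"
      using rc by (auto intro: hook_arcsI)
  next
    fix u v assume "(u, v) \<in> matroid_arcs n k M"
    then show "(u, v) \<in> (\<Union>B\<in>?P. set (vwalk_arcs (hook k n (shape n M) B)))"
    proof (cases rule: hook_arcsE)
      case (source r c c')
      then show ?thesis using PD hook_vwalk_arcs[of r c'] by (intro UN_I[of "(r, c')"]) auto
    next
      case (left r c c')
      then show ?thesis using PD hook_vwalk_arcs[of r c'] by (intro UN_I[of "(r, c')"]) auto
    next
      case (down r c r')
      then show ?thesis using PD hook_vwalk_arcs[of r' c] by (intro UN_I[of "(r', c)"]) auto
    next
      case (sink r c r')
      then show ?thesis using PD hook_vwalk_arcs[of r' c] by (intro UN_I[of "(r', c)"]) auto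
    qed
  qed
  finally show ?thesis .
qed

lemma Le_matroid_linkable:
  assumes L: "{B \<in> shape_boxes n k M. L B = Plus} = plus_boxes n k M" and J: "J \<in> nsets {1..n} k"
  shows "J \<in> Le_matroid k n (shape n M) L \<longleftrightarrow> linkable (matroid_arcs n k M) (Boundary ` lexmin M) (Boundary ` J)"
proof -
  let ?G = "Gamma_graph k n (shape n M) L" and ?E = "matroid_arcs n k M" and ?I = "lexmin M"
  note arcs = Gamma_graph_arcs[OF L]
  have arcs_ends: "arcs_ends (with_proj ?G) = ?E" unfolding arcs[symmetric] by (simp add: arcs_ends_def arc_to_ends_def)
  have verts: "Boundary ` ?I \<subseteq> pverts ?G"
    unfolding Gamma_graph_def Let_def using member(3)[OF lexmin_in] by auto
  have verts': "u \<in> pverts ?G \<and> v \<in> pverts ?G" if "(u, v) \<in> ?E" for u v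
    using that unfolding arcs[symmetric] Gamma_graph_def Let_def by (auto dest: vwalk_arcs_member)
  \<comment> \<open>The requirement that all vertices belong to the graph comes for free: the first
    vertex is a source and every other one is the head of an arc.\<close>
  have vpath: "vpath p (with_proj ?G) \<longleftrightarrow> p \<noteq> [] \<and> distinct p \<and> set (vwalk_arcs p) \<subseteq> ?E"
    if "hd p = Boundary i" "i \<in> ?I" for p i
  proof -
    have "set p \<subseteq> pverts ?G" if p: "p \<noteq> []" "distinct p" "set (vwalk_arcs p) \<subseteq> ?E"
    proof
      fix v assume "v \<in> set p"
      then have "v = hd p \<or> v \<in> Range (set (vwalk_arcs p))" using vwalk_arcs_Domain_Range(1)[OF p(1,2)] by auto
      then show "v \<in> pverts ?G" using p(3) verts verts' \<open>hd p = Boundary i\<close> \<open>i \<in> ?I\<close> by blast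
    qed
    then show ?thesis unfolding vpath_def vwalk_def arcs_ends by auto
  qed
  \<comment> \<open>Horizontal arcs increase the column and vertical arcs the row, with
    \<open>2 \<le> r + c \<le> n\<close> on the shape; boundary sources are put below and sinks
    above all corners.\<close>
  define rank where "rank v = (case v of Boundary j \<Rightarrow> if j \<in> ?I then 0 else 2 * n + 1 | Corner (r, c) \<Rightarrow> r + c)" for v
  have rank: "rank u < rank v \<and> rank v \<le> 2 * n + 1" if "(u, v) \<in> ?E" for u v
    using that
  proof (cases rule: hook_arcsE)
    case (source r c c')
    then show ?thesis using src_in_lexmin[of r] by (auto simp: rank_def shape_boxes_def)
  next
    case (left r c c')
    then have "(r, c') \<in> shape_boxes n k M" by (auto simp: plus_boxes_def)
    then show ?thesis using left by (auto simp: rank_def shape_boxes_def)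
  next
    case (down r c r')
    then show ?thesis by (auto simp: rank_def shape_boxes_def)
  next
    case (sink r c r')
    then show ?thesis using snk_notin_lexmin[of c] by (auto simp: rank_def shape_boxes_def)
  qed
  have "J \<in> Le_matroid k n (shape n M) L \<longleftrightarrow> (\<exists>p. nonintersecting_paths ?G ?I J p)"
    unfolding Le_matroid_def sources_shape using J by simp
  also have "\<dots> \<longleftrightarrow> linkable ?E (Boundary ` ?I) (Boundary ` J)"
  proof
    assume "\<exists>p. nonintersecting_paths ?G ?I J p"
    then obtain p where p: "nonintersecting_paths ?G ?I J p" by blast
    show "linkable ?E (Boundary ` ?I) (Boundary ` J)"
    proof (rule paths_imp_linkable)
      fix i assume "i \<in> ?I"
      then show "p i \<noteq> [] \<and> distinct (p i) \<and> set (vwalk_arcs (p i)) \<subseteq> ?E \<and> hd (p i) = Boundary i"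
        using p vpath[of "p i" i] unfolding nonintersecting_paths_def by blast
    qed (use p in \<open>auto simp: nonintersecting_paths_def\<close>)
  next
    assume "linkable ?E (Boundary ` ?I) (Boundary ` J)"
    then obtain F where "linking ?E (Boundary ` ?I) (Boundary ` J) F" unfolding linkable_def by blast
    then interpret ranked_linking ?E F "Boundary ` ?I" "Boundary ` J" rank "2 * n + 1"
      by unfold_locales (use rank in auto)
    obtain p where p: "\<And>s. s \<in> Boundary ` ?I \<Longrightarrow> p s \<noteq> [] \<and> hd (p s) = s \<and> distinct (p s) \<and> set (vwalk_arcs (p s)) \<subseteq> ?E"
      "\<And>s s'. s \<in> Boundary ` ?I \<Longrightarrow> s' \<in> Boundary ` ?I \<Longrightarrow> s \<noteq> s' \<Longrightarrow> set (p s) \<inter> set (p s') = {}"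
      "(\<lambda>s. last (p s)) ` Boundary ` ?I = Boundary ` J"
      by (rule linking_imp_paths) blast
    have "nonintersecting_paths ?G ?I J (\<lambda>i. p (Boundary i))"
      unfolding nonintersecting_paths_def
    proof (intro conjI ballI impI)
      fix i assume i: "i \<in> ?I"
      then have q: "p (Boundary i) \<noteq> [] \<and> hd (p (Boundary i)) = Boundary i \<and> distinct (p (Boundary i)) \<and>
          set (vwalk_arcs (p (Boundary i))) \<subseteq> ?E" by (intro p(1)) simp
      then show "hd (p (Boundary i)) = Boundary i" by simp
      show "vpath (p (Boundary i)) (with_proj ?G)" using vpath[of "p (Boundary i)" i] q i by simp
      fix i' assume "i' \<in> ?I" "i \<noteq> i'"
      then show "set (p (Boundary i)) \<inter> set (p (Boundary i')) = {}" using i by (intro p(2)) auto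
    qed (use p(3) in \<open>simp add: image_image\<close>)
    then show "\<exists>p. nonintersecting_paths ?G ?I J p" by blast
  qed
  finally show ?thesis .
qed

end

section \<open>Points of the nonnegative Grassmannian\<close>

definition matrix_columns :: "real mat \<Rightarrow> nat \<Rightarrow> nat \<Rightarrow> real" where
  "matrix_columns A j s = A $$ (s, j - 1)"

lemma det_submatrix_eq_sminor:
  assumes A: "A \<in> carrier_mat k n" and J: "J \<in> nsets {1..n} k"
  shows "det (submatrix A UNIV (Suc -` J)) = sminor k (matrix_columns A) J"
proof -
  have fin: "finite J" "card J = k" "J \<subseteq> {1..n}" using J by (auto simp: nsets_def)
  have "{j. j < n \<and> j \<in> Suc -` J} = (\<lambda>j. j - 1) ` J"
    using fin(3) by (force simp: image_iff)
  moreover have "inj_on (\<lambda>j. j - 1) J"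
  proof (rule inj_onI)
    fix a b assume "a \<in> J" "b \<in> J" "a - 1 = b - 1"
    moreover from this have "1 \<le> a" "1 \<le> b" using fin(3) by auto
    ultimately show "a = b" by simp
  qed
  ultimately have cols: "card {j. j < n \<and> j \<in> Suc -` J} = k" using fin(2) by (simp add: card_image)
  \<comment> \<open>A value of \<open>pick\<close> is determined by the number of smaller elements
    in the shifted set of columns, and this is the number of smaller elements of
    \<open>J\<close>.\<close>
  have pick: "pick (Suc -` J) j = sorted_list_of_set J ! j - 1" if j: "j < k" for j
  proof -
    let ?m = "sorted_list_of_set J ! j"
    have m: "?m \<in> J" using j fin nth_mem[of j "sorted_list_of_set J"] by simp
    then have m1: "1 \<le> ?m" using fin(3) by auto
    have "card {b \<in> J. b < ?m} = j"
      using card_less_nth_elem[of J "Suc j"] fin j by (simp add: nth_elem_def)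
    moreover have "{b \<in> J. b < ?m} = Suc ` {a \<in> Suc -` J. a < ?m - 1}"
    proof (intro equalityI subsetI)
      fix b assume b: "b \<in> {b \<in> J. b < ?m}"
      then have "1 \<le> b" using fin(3) by auto
      then show "b \<in> Suc ` {a \<in> Suc -` J. a < ?m - 1}"
        using b by (intro image_eqI[of _ _ "b - 1"]) auto
    qed auto
    ultimately have "card {a \<in> Suc -` J. a < ?m - 1} = j" by (simp add: card_image)
    then show ?thesis using pick_card_in_set[of "?m - 1" "Suc -` J"] m m1 by simp
  qed
  have "submatrix A UNIV (Suc -` J) = mat k k (\<lambda>(s, j). matrix_columns A (sorted_list_of_set J ! j) s)"
  proof (rule eq_matI)
    fix s j assume "s < dim_row (mat k k (\<lambda>(s, j). matrix_columns A (sorted_list_of_set J ! j) s))"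
      "j < dim_col (mat k k (\<lambda>(s, j). matrix_columns A (sorted_list_of_set J ! j) s))"
    then show "submatrix A UNIV (Suc -` J) $$ (s, j) = mat k k (\<lambda>(s, j). matrix_columns A (sorted_list_of_set J ! j) s) $$ (s, j)"
      using A cols by (subst submatrix_index) (auto simp: pick pick_UNIV matrix_columns_def)
  qed (use A cols in \<open>auto simp: dim_submatrix\<close>)
  then show ?thesis unfolding sminor_def minor_def coldet_def by simp
qed

lemma sminor_mult:
  assumes P: "P \<in> carrier_mat k k" and A: "A \<in> carrier_mat k n" and J: "J \<in> nsets {1..n} k"
  shows "sminor k (matrix_columns (P * A)) J = det P * sminor k (matrix_columns A) J"
proof -
  let ?m = "\<lambda>A. mat k k (\<lambda>(s, j). matrix_columns A (sorted_list_of_set J ! j) s)"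
  have idx: "sorted_list_of_set J ! j - 1 < n" if "j < k" for j
    using J that nth_mem[of j "sorted_list_of_set J"] by (fastforce simp: nsets_def)
  have "?m (P * A) = P * ?m A"
    by (rule eq_matI) (use P A idx in \<open>auto simp: matrix_columns_def scalar_prod_def intro!: sum.cong\<close>)
  then have "det (?m (P * A)) = det P * det (?m A)" using P by (simp add: det_mult[of _ k])
  then show ?thesis unfolding sminor_def minor_def coldet_def .
qed

context vec_space
begin

text \<open>The rows are a basis of \<open>x\<close>. One exists as a maximal independent subset,
  because independence inside \<open>x\<close> is independence in the whole space, whose dimension
  bounds the size.\<close>

lemma row_space_representation:
  assumes x: "subspace class_ring x V" and dim: "vectorspace.dim class_ring (vs x) = k"
  shows "\<exists>A \<in> carrier_mat k n. row_space A = x"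
proof -
  interpret W: vectorspace class_ring "vs x" using x by (rule subspace_is_vs)
  have sub: "submodule class_ring x V" using x unfolding subspace_def by simp
  have xV: "x \<subseteq> carrier V" using sub unfolding submodule_def by simp
  have li: "finite S \<and> card S \<le> local.dim" if "S \<subseteq> carrier (vs x) \<and> W.lin_indpt S" for S
  proof -
    have "S \<subseteq> x" using that by simp
    then have "lin_indpt S" using span_li_not_depend(2)[OF _ sub] that by blast
    moreover have "S \<subseteq> carrier V" using \<open>S \<subseteq> x\<close> xV by (rule order_trans)
    ultimately show ?thesis using li_le_dim[OF fin_dim, of S] by simp
  qed
  have "lin_indpt {}" by (auto simp: lin_dep_def)
  then have li_empty: "W.lin_indpt {}" using span_li_not_depend(2)[OF empty_subsetI sub] by simp
  have "\<exists>B. finite B \<and> maximal B (\<lambda>S. S \<subseteq> carrier (vs x) \<and> W.lin_indpt S)"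
    by (rule maximal_exists[of _ local.dim "{}"]) (use li li_empty in auto)
  then obtain B where B: "finite B" "maximal B (\<lambda>S. S \<subseteq> carrier (vs x) \<and> W.lin_indpt S)" by (elim exE conjE)
  note B = B(1) W.max_li_is_basis[OF B(2)]
  then have "card B = k" using W.dim_basis dim by simp
  obtain bs where bs: "set bs = B" "distinct bs" using finite_distinct_list[OF B(1)] by blast
  then have len: "length bs = k" using \<open>card B = k\<close> distinct_card by fastforce
  have Bx: "B \<subseteq> x" using B(2) unfolding W.basis_def by simp
  then have BV: "set bs \<subseteq> carrier_vec n" using bs xV by auto
  have "W.span B = span B" using span_li_not_depend(1)[OF Bx sub] .
  moreover have "W.span B = x" using B(2) unfolding W.basis_def by simp
  ultimately have "row_space (mat_of_rows n bs) = x"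
    unfolding row_space_def using bs BV by (simp add: rows_mat_of_rows)
  moreover have "mat_of_rows n bs \<in> carrier_mat k n" using mat_of_rows_carrier(1)[of n bs] len by simp
  ultimately show ?thesis by blast
qed

text \<open>A maximal independent set of rows avoids the zero vector. If that were a row, fewer than
  \<open>k\<close> vectors would have to span the row space.\<close>

lemma rows_nonzero_of_full_dim:
  assumes C: "C \<in> carrier_mat k n" and dim: "vectorspace.dim class_ring (vs (row_space C)) = k" and i: "i < k"
  shows "row C i \<noteq> 0\<^sub>v n"
proof
  assume zero: "row C i = 0\<^sub>v n"
  let ?S = "set (rows C)"
  have SV: "?S \<subseteq> carrier_vec n" using C by (auto simp: rows_def)
  obtain U where U: "maximal U (\<lambda>T. T \<subseteq> ?S \<and> lin_indpt T)"
    using maximal_exists_superset[of ?S "\<lambda>T. T \<subseteq> ?S \<and> lin_indpt T" "{}"] by (auto simp: lin_dep_def)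
  then have US: "U \<subseteq> ?S" "lin_indpt U" unfolding maximal_def by auto
  have "(UNIV :: 'a set) \<noteq> {0}" by (metis UNIV_I one_neq_zero singletonD)
  then have "0\<^sub>v n \<notin> U" using zero_nin_lin_indpt[of U] US SV by auto
  then have "U \<subseteq> ?S - {0\<^sub>v n}" using US by auto
  then have "card U \<le> card (?S - {0\<^sub>v n})" by (intro card_mono) auto
  also have "\<dots> < card ?S"
    using zero i C by (intro card_Diff1_less) (auto simp: rows_def intro!: image_eqI[of _ _ i])
  also have "\<dots> \<le> k" using card_length[of "rows C"] C by simp
  finally have "card U < k" .
  moreover have "vectorspace.dim class_ring (span_vs ?S) = card U"
    by (rule dim_span) (use SV U in auto)
  ultimately show False using dim unfolding row_space_def by simp
qed

end

text \<open>With a pivot in every row the pivot columns form the identity matrix, so the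
  corresponding minor is 1.\<close>

lemma echelon_minor:
  fixes C :: "real mat"
  assumes C: "C \<in> carrier_mat k n" and piv: "pivot_fun C g n" and full: "\<And>i. i < k \<Longrightarrow> g i < n"
  shows "\<exists>J \<in> nsets {1..n} k. sminor k (matrix_columns C) J \<noteq> 0"
proof -
  have dim: "dim_row C = k" using C by simp
  note p = pivot_funD[OF dim piv]
  have step: "g i < g (Suc i)" if "Suc i < k" for i using p(3)[of i] full[of "Suc i"] that by auto
  have mono: "g i < g j" if "i < j" "j < k" for i j
    using that by (induction j) (auto simp: less_Suc_eq intro: step less_trans)
  define J where "J = (\<lambda>i. Suc (g i)) ` {..<k}"
  have inj: "inj_on (\<lambda>i. Suc (g i)) {..<k}"
    using mono by (auto simp: inj_on_def) (metis linorder_neqE_nat less_irrefl)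
  have J: "J \<in> nsets {1..n} k" using full card_image[OF inj] by (auto simp: J_def nsets_def Suc_le_eq)
  have "sorted_list_of_set ((\<lambda>i. Suc (g i)) ` {..<k}) = map (\<lambda>i. Suc (g i)) (sorted_list_of_set {..<k})"
    by (rule sorted_list_of_set_strict_mono_image) (use mono in \<open>auto simp: strict_mono_on_def\<close>)
  then have J_list: "sorted_list_of_set J = map (\<lambda>i. Suc (g i)) [0..<k]"
    by (simp add: J_def lessThan_atLeast0)
  have "mat k k (\<lambda>(s, j). matrix_columns C (sorted_list_of_set J ! j) s) = 1\<^sub>m k"
    by (rule eq_matI) (use p full in \<open>auto simp: J_list matrix_columns_def\<close>)
  then have "sminor k (matrix_columns C) J = 1" unfolding sminor_def minor_def coldet_def by simp
  then show ?thesis by (intro bexI[OF _ J]) simp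
qed

text \<open>Gauss-Jordan elimination multiplies by an invertible matrix, which keeps the row space
  and changes all minors by one common factor. Full dimension leaves no zero row, hence a pivot in
  every row of the reduced matrix.\<close>

lemma nonzero_minor_exists:
  assumes A: "represents k n A x" and x: "x \<in> Grassmannian k n"
  shows "\<exists>J \<in> nsets {1..n} k. sminor k (matrix_columns A) J \<noteq> 0"
proof -
  interpret vec_space "TYPE(real)" n .
  have A': "A \<in> carrier_mat k n" "row_space A = x" using A by (auto simp: represents_def)
  obtain C where C: "gauss_jordan_single A = C" by simp
  note gj = gauss_jordan_single[OF A'(1) C]
  obtain P Q where PQ: "C = P * A" "P \<in> carrier_mat k k" "Q \<in> carrier_mat k k" "P * Q = 1\<^sub>m k" "Q * P = 1\<^sub>m k"
    using gj(4) by blast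
  have "invertible_mat P"
    unfolding invertible_mat_def inverts_mat_def using PQ by (auto intro!: exI[of _ Q])
  then have "row_space C = x" using row_space_is_preserved[OF _ PQ(2) A'(1)] PQ(1) A'(2) by simp
  then have dim: "vectorspace.dim class_ring (vs (row_space C)) = k"
    using x by (simp add: Grassmannian_def)
  obtain g where g: "pivot_fun C g n" using gj(2,3) unfolding row_echelon_form_def by auto
  have "g i < n" if i: "i < k" for i
    using rows_nonzero_of_full_dim[OF gj(2) dim i] pivot_fun_zero_row_iff[OF g gj(2) i]
      pivot_funD(1)[OF _ g i] gj(2) by (metis carrier_matD(1) le_neq_implies_less)
  then obtain J where J: "J \<in> nsets {1..n} k" "sminor k (matrix_columns C) J \<noteq> 0"
    using echelon_minor[OF gj(2) g] by blast
  then show ?thesis using sminor_mult[OF PQ(2) A'(1) J(1)] PQ(1) by (intro bexI[of _ J]) auto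
qed

lemma nonneg_Grassmannian_columns:
  assumes x: "x \<in> nonneg_Grassmannian k n"
  shows "\<exists>t f. nonneg n k t f \<and> (\<forall>J \<in> nsets {1..n} k. Pluecker k n x J = sminor k f J)"
proof -
  interpret vec_space "TYPE(real)" n .
  have G: "x \<in> Grassmannian k n" using x by (simp add: nonneg_Grassmannian_def)
  then have "\<exists>A. represents k n A x"
    using row_space_representation[of x k] by (auto simp: Grassmannian_def represents_def)
  \<comment> \<open>Some matrix represents \<open>x\<close>, so the one chosen in the definition of
    \<open>Pluecker\<close> does too.\<close>
  then have A: "represents k n (SOME A. represents k n A x) x" by (rule someI_ex)
  define f where "f = matrix_columns (SOME A. represents k n A x)"
  have P: "Pluecker k n x J = sminor k f J" if "J \<in> nsets {1..n} k" for J
    unfolding Pluecker_def f_def using A that by (intro det_submatrix_eq_sminor) (auto simp: represents_def)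
  obtain t where "t \<noteq> 0" "\<forall>J \<in> nsets {1..n} k. 0 \<le> t * Pluecker k n x J"
    using x by (auto simp: nonneg_Grassmannian_def)
  moreover have "support n k f \<noteq> {}"
    using nonzero_minor_exists[OF A G] by (auto simp: support_def f_def)
  ultimately show ?thesis using P unfolding nonneg_def by (intro exI[of _ t] exI[of _ f]) auto
qed

context tnn_matroid
begin

lemma M_set_eq_hook_basis:
  assumes "(r, c) \<in> shape_boxes n k M"
  shows "M_set n (r, c) M = hook_basis M (src M r) (snk n M c)"
proof -
  have "J \<inter> fixed_labels n M (r, c) = lexmin M \<inter> fixed_labels n M (r, c) \<longleftrightarrow>
      agree_off (src M r) (snk n M c) J (lexmin M)" if "J \<in> M" for J
    using agree_off_iff[of J "{1..n}" "lexmin M"] member(3)[OF that] member(3)[OF lexmin_in]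
    by (simp add: fixed_labels_def)
  then have "{J \<in> M. J \<inter> fixed_labels n M (r, c) = lexmin M \<inter> fixed_labels n M (r, c)} =
      {J \<in> M. agree_off (src M r) (snk n M c) J (lexmin M)}" by blast
  then show ?thesis by (simp add: M_set_def M_set'_def hook_basis_def hook_max_def)
qed

lemma hook_basis_in_nsets:
  assumes "(r, c) \<in> shape_boxes n k M"
  shows "hook_basis M (src M r) (snk n M c) \<in> nsets {1..n} k"
proof -
  let ?p = "src M r" and ?q = "snk n M c" and ?T = "hook_max M (src M r) (snk n M c)"
  have rc: "?p \<in> lexmin M" "?q \<in> {1..n} - lexmin M"
    using assms src_in_lexmin snk_notin_lexmin by (auto simp: shape_boxes_def)
  \<comment> \<open>The end labels do not belong to the open interval, so every competitor agrees
    there with the minimal basis; trading one for the other keeps the cardinality.\<close>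
  have "?p \<in> ?T" "?q \<notin> ?T" using hook_max(2)[of ?p ?q] rc by (auto simp: agree_off_def)
  moreover note T = member[OF hook_max(1)[of ?p ?q]]
  moreover have "Suc (card (?T - {?p})) = card ?T" using \<open>?p \<in> ?T\<close> T(1) by (rule card_Suc_Diff1[rotated])
  ultimately show ?thesis using rc by (auto simp: hook_basis_def nsets_def)
qed

end

theorem theorem2p3:
  fixes k n :: nat and x :: "real vec set"
  assumes "x \<in> nonneg_Grassmannian k n"
  shows "Le_diagram k n (shape n (matroid_of k n x)) (filling_of k n x) \<and>
         x \<in> positroid_cell k n
               (Le_matroid k n (shape n (matroid_of k n x)) (filling_of k n x))"
proof -
  obtain t f where f: "nonneg n k t f" and P: "\<And>J. J \<in> nsets {1..n} k \<Longrightarrow> Pluecker k n x J = sminor k f J"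
    using nonneg_Grassmannian_columns[OF assms] by blast
  define M where "M = matroid_of k n x"
  have M: "M = support n k f" unfolding M_def matroid_of_def support_def using P by auto
  interpret tnn_matroid n k M unfolding M using f by (rule nonneg_tnn_matroid)
  have rep: "Le_represented n k M" unfolding M using f by (rule nonneg_represented)
  let ?L = "filling_of k n x"
  \<comment> \<open>The given filling tests a coordinate, \<open>plus_boxes\<close> tests membership
    in \<open>M\<close>. They agree because the attached set is a \<open>k\<close>-subset of
    \<open>{1..n}\<close>.\<close>
  have L: "?L (r, c) = Plus \<longleftrightarrow> (r, c) \<in> plus_boxes n k M" if rc: "(r, c) \<in> shape_boxes n k M" for r c
    using rc hook_basis_in_nsets[OF rc]
    unfolding filling_of_def M_def[symmetric] M_set_eq_hook_basis[OF rc]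
    by (simp add: plus_boxes_def) (simp add: M_def matroid_of_def)
  have Plus: "{B \<in> shape_boxes n k M. ?L B = Plus} = plus_boxes n k M"
    using L by (auto simp: plus_boxes_def)
  have "Le_diagram k n (shape n M) ?L"
    unfolding Le_diagram_def
  proof (intro conjI notI)
    assume "\<exists>r c r' c'. (r, c) \<in> boxes k n (shape n M) \<and> ?L (r, c) = Zero \<and>
           (r', c) \<in> boxes k n (shape n M) \<and> r' < r \<and> ?L (r', c) = Plus \<and>
           (r, c') \<in> boxes k n (shape n M) \<and> c < c' \<and> ?L (r, c') = Plus"
    then obtain r c r' c' where v: "(r, c) \<in> shape_boxes n k M" "?L (r, c) = Zero"
      "(r', c) \<in> shape_boxes n k M" "r' < r" "?L (r', c) = Plus"
      "(r, c') \<in> shape_boxes n k M" "c < c'" "?L (r, c') = Plus" unfolding boxes_shape by blast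
    have "?L (r, c) \<noteq> Plus" using v(2) by simp
    then have "(r, c) \<in> shape_boxes n k M - plus_boxes n k M" using L v(1) by auto
    moreover have "(r', c) \<in> plus_boxes n k M" "(r, c') \<in> plus_boxes n k M"
      using L v by auto
    ultimately show False using rep v(4,7) unfolding Le_represented_def Le_filling_def by blast
  qed (rule k_le_n, rule partition_shape)
  moreover have "x \<in> positroid_cell k n (Le_matroid k n (shape n M) ?L)"
    unfolding positroid_cell_def
  proof (intro CollectI conjI ballI)
    fix J assume J: "J \<in> nsets {1..n} k"
    have "Pluecker k n x J \<noteq> 0 \<longleftrightarrow> J \<in> M" using J by (simp add: M_def matroid_of_def)
    also have "\<dots> \<longleftrightarrow> linkable (matroid_arcs n k M) (Boundary ` lexmin M) (Boundary ` J)"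
      using rep J unfolding Le_represented_def by blast
    also have "\<dots> \<longleftrightarrow> J \<in> Le_matroid k n (shape n M) ?L" by (rule Le_matroid_linkable[OF Plus J, symmetric])
    finally show "Pluecker k n x J \<noteq> 0 \<longleftrightarrow> J \<in> Le_matroid k n (shape n M) ?L" .
  qed (rule assms)
  ultimately show ?thesis unfolding M_def by blast
qed

end
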